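(* Let $\{(A_\gamma,\mathfrak{m}_\gamma):\gamma\in\Gamma\}$ be a direct system of Noetherian local Cohen-Macaulay rings such that $\mathfrak{m}_\gamma A_\delta=\mathfrak{m}_\delta$ for all $\gamma<\delta$. Then $\varinjlim_{\gamma\in\Gamma}A_\gamma$ is a Noetherian Cohen-Macaulay ring.
   Context: All rings are commutative. All direct systems are assumed to be filtered (indexed by a directed set). $\mathfrak{m}_\gamma$ is the maximal ideal of $A_\gamma$, and $\mathfrak{m}_\gamma A_\delta$ is the ideal of $A_\delta$ generated by the image of $\mathfrak{m}_\gamma$ under the transition map. *)

theory Defs
  imports "HOL-Algebra.Algebra" "HOL-Library.Extended_Nat"
begin

section \<open>Regular sequences, Krull dimension, Cohen--Macaulay rings\<close>

definition nonzerodivisor :: "('a, 'b) ring_scheme \<Rightarrow> 'a \<Rightarrow> bool" where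
  "nonzerodivisor R x \<longleftrightarrow>
     x \<in> carrier R \<and> (\<forall>z \<in> carrier R. x \<otimes>\<^bsub>R\<^esub> z = \<zero>\<^bsub>R\<^esub> \<longrightarrow> z = \<zero>\<^bsub>R\<^esub>)"

text \<open>
  A sequence \<open>x\<^sub>1, \<dots>, x\<^sub>n\<close> is regular on \<open>R\<close> if the image of \<open>x\<^sub>i\<close> in \<open>R/(x\<^sub>1, \<dots>, x\<^sub>i\<^sub>-\<^sub>1)\<close> is a
  nonzerodivisor for every \<open>i\<close>, and \<open>R/(x\<^sub>1, \<dots>, x\<^sub>n) \<noteq> 0\<close>. The empty sequence is regular on
  every nonzero ring.
\<close>

definition regular_sequence :: "('a, 'b) ring_scheme \<Rightarrow> 'a list \<Rightarrow> bool" where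
  "regular_sequence R xs \<longleftrightarrow>
     set xs \<subseteq> carrier R \<and>
     (\<forall>i < length xs.
        nonzerodivisor (R Quot (Idl\<^bsub>R\<^esub> (set (take i xs))))
          (Idl\<^bsub>R\<^esub> (set (take i xs)) +>\<^bsub>R\<^esub> xs ! i)) \<and>
     Idl\<^bsub>R\<^esub> (set xs) \<noteq> carrier R"

definition grade :: "('a, 'b) ring_scheme \<Rightarrow> 'a set \<Rightarrow> enat" where
  "grade R I = (SUP xs \<in> {xs. regular_sequence R xs \<and> set xs \<subseteq> I}. enat (length xs))"

text \<open>The chain \<open>P\<^sub>0 \<subset> \<dots> \<subset> P\<^sub>n\<close> is a list with \<open>n + 1\<close> entries, so its length is one less
  than the length of the list. (The zero ring, having no prime ideals, gets dimension 0 here.)\<close>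

definition krull_dim :: "('a, 'b) ring_scheme \<Rightarrow> enat" where
  "krull_dim R =
     (SUP Ps \<in> {Ps. Ps \<noteq> [] \<and> sorted_wrt (\<subset>) Ps \<and> (\<forall>P \<in> set Ps. primeideal P R)}.
        enat (length Ps - 1))"

locale local_ring = cring +
  assumes unique_maximalideal: "\<exists>!M. maximalideal M R"

definition max_ideal :: "('a, 'b) ring_scheme \<Rightarrow> 'a set" where
  "max_ideal R = (THE M. maximalideal M R)"

definition depth :: "('a, 'b) ring_scheme \<Rightarrow> enat" where
  "depth R = grade R (max_ideal R)"

locale cohen_macaulay_local_ring = local_ring + noetherian_ring +
  assumes depth_eq_dim: "depth R = krull_dim R"

text \<open>The localization \<open>S\<^sup>-\<^sup>1R\<close>, for \<open>S\<close> a multiplicatively closed subset containing \<open>1\<close>: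
  the fraction \<open>a/s\<close> is the equivalence class of \<open>(a, s)\<close>.\<close>

definition frac_rel :: "('a, 'b) ring_scheme \<Rightarrow> 'a set \<Rightarrow> (('a \<times> 'a) \<times> ('a \<times> 'a)) set" where
  "frac_rel R S =
     {((a, s), (b, t)). a \<in> carrier R \<and> s \<in> S \<and> b \<in> carrier R \<and> t \<in> S \<and>
        (\<exists>u \<in> S. u \<otimes>\<^bsub>R\<^esub> (t \<otimes>\<^bsub>R\<^esub> a) = u \<otimes>\<^bsub>R\<^esub> (s \<otimes>\<^bsub>R\<^esub> b))}"

definition localization :: "('a, 'b) ring_scheme \<Rightarrow> 'a set \<Rightarrow> ('a \<times> 'a) set ring" where
  "localization R S =
     \<lparr>carrier = (carrier R \<times> S) // frac_rel R S,
      monoid.mult = (\<lambda>U V. {w. \<exists>a s b t. (a, s) \<in> U \<and> (b, t) \<in> V \<and>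
                ((a \<otimes>\<^bsub>R\<^esub> b, s \<otimes>\<^bsub>R\<^esub> t), w) \<in> frac_rel R S}),
      monoid.one = {w. ((\<one>\<^bsub>R\<^esub>, \<one>\<^bsub>R\<^esub>), w) \<in> frac_rel R S},
      ring.zero = {w. ((\<zero>\<^bsub>R\<^esub>, \<one>\<^bsub>R\<^esub>), w) \<in> frac_rel R S},
      ring.add = (\<lambda>U V. {w. \<exists>a s b t. (a, s) \<in> U \<and> (b, t) \<in> V \<and>
               (((t \<otimes>\<^bsub>R\<^esub> a) \<oplus>\<^bsub>R\<^esub> (s \<otimes>\<^bsub>R\<^esub> b), s \<otimes>\<^bsub>R\<^esub> t), w) \<in> frac_rel R S})\<rparr>"

locale cohen_macaulay_ring = cring + noetherian_ring +
  assumes localization_cohen_macaulay: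
    "maximalideal M R \<Longrightarrow> cohen_macaulay_local_ring (localization R (carrier R - M))"


section \<open>Filtered direct systems of rings and their limits\<close>

text \<open>The relation \<open>r\<close> is the order of the index set: \<open>(\<gamma>, \<delta>) \<in> r\<close> means \<open>\<gamma> \<le> \<delta>\<close>.
  Antisymmetry is not required.\<close>

locale direct_system =
  fixes \<Gamma> :: "'i set" and r :: "('i \<times> 'i) set"
    and A :: "'i \<Rightarrow> ('a, 'b) ring_scheme" and f :: "'i \<Rightarrow> 'i \<Rightarrow> 'a \<Rightarrow> 'a"
  assumes preorder: "preorder_on \<Gamma> r"
    and nonempty: "\<Gamma> \<noteq> {}"
    and directed: "\<lbrakk>\<gamma> \<in> \<Gamma>; \<delta> \<in> \<Gamma>\<rbrakk> \<Longrightarrow> \<exists>\<epsilon> \<in> \<Gamma>. (\<gamma>, \<epsilon>) \<in> r \<and> (\<delta>, \<epsilon>) \<in> r"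
    and is_cring: "\<gamma> \<in> \<Gamma> \<Longrightarrow> cring (A \<gamma>)"
    and hom: "(\<gamma>, \<delta>) \<in> r \<Longrightarrow> f \<gamma> \<delta> \<in> ring_hom (A \<gamma>) (A \<delta>)"
    and hom_id: "\<lbrakk>\<gamma> \<in> \<Gamma>; x \<in> carrier (A \<gamma>)\<rbrakk> \<Longrightarrow> f \<gamma> \<gamma> x = x"
    and hom_comp: "\<lbrakk>(\<gamma>, \<delta>) \<in> r; (\<delta>, \<epsilon>) \<in> r; x \<in> carrier (A \<gamma>)\<rbrakk>
                     \<Longrightarrow> f \<delta> \<epsilon> (f \<gamma> \<delta> x) = f \<gamma> \<epsilon> x"

text \<open>The limit is the disjoint union of the \<open>A \<gamma>\<close>, modulo identifying two elements that become
  equal at a later stage. Sums and products are computed at any common later stage.\<close>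

definition limit_rel ::
  "'i set \<Rightarrow> ('i \<times> 'i) set \<Rightarrow> ('i \<Rightarrow> ('a, 'b) ring_scheme) \<Rightarrow> ('i \<Rightarrow> 'i \<Rightarrow> 'a \<Rightarrow> 'a)
     \<Rightarrow> (('i \<times> 'a) \<times> ('i \<times> 'a)) set" where
  "limit_rel \<Gamma> r A f =
     {((\<gamma>, x), (\<delta>, y)). \<gamma> \<in> \<Gamma> \<and> x \<in> carrier (A \<gamma>) \<and> \<delta> \<in> \<Gamma> \<and> y \<in> carrier (A \<delta>) \<and>
        (\<exists>\<epsilon> \<in> \<Gamma>. (\<gamma>, \<epsilon>) \<in> r \<and> (\<delta>, \<epsilon>) \<in> r \<and> f \<gamma> \<epsilon> x = f \<delta> \<epsilon> y)}"

definition direct_limit ::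
  "'i set \<Rightarrow> ('i \<times> 'i) set \<Rightarrow> ('i \<Rightarrow> ('a, 'b) ring_scheme) \<Rightarrow> ('i \<Rightarrow> 'i \<Rightarrow> 'a \<Rightarrow> 'a)
     \<Rightarrow> ('i \<times> 'a) set ring" where
  "direct_limit \<Gamma> r A f =
     \<lparr>carrier = (SIGMA \<gamma>:\<Gamma>. carrier (A \<gamma>)) // limit_rel \<Gamma> r A f,
      monoid.mult = (\<lambda>U V. {w. \<exists>\<gamma> x \<delta> y \<epsilon>. (\<gamma>, x) \<in> U \<and> (\<delta>, y) \<in> V \<and> (\<gamma>, \<epsilon>) \<in> r \<and> (\<delta>, \<epsilon>) \<in> r \<and>
                ((\<epsilon>, f \<gamma> \<epsilon> x \<otimes>\<^bsub>A \<epsilon>\<^esub> f \<delta> \<epsilon> y), w) \<in> limit_rel \<Gamma> r A f}),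
      monoid.one = {w. \<exists>\<gamma> \<in> \<Gamma>. ((\<gamma>, \<one>\<^bsub>A \<gamma>\<^esub>), w) \<in> limit_rel \<Gamma> r A f},
      ring.zero = {w. \<exists>\<gamma> \<in> \<Gamma>. ((\<gamma>, \<zero>\<^bsub>A \<gamma>\<^esub>), w) \<in> limit_rel \<Gamma> r A f},
      ring.add = (\<lambda>U V. {w. \<exists>\<gamma> x \<delta> y \<epsilon>. (\<gamma>, x) \<in> U \<and> (\<delta>, y) \<in> V \<and> (\<gamma>, \<epsilon>) \<in> r \<and> (\<delta>, \<epsilon>) \<in> r \<and>
               ((\<epsilon>, f \<gamma> \<epsilon> x \<oplus>\<^bsub>A \<epsilon>\<^esub> f \<delta> \<epsilon> y), w) \<in> limit_rel \<Gamma> r A f})\<rparr>"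

end

theory Submission
  imports Defs "HOL-Library.Ramsey" "HOL-Computational_Algebra.Primes"
begin

text \<open>
  Write \<open>S\<close> for the limit. Fix an index \<open>\<gamma>\<close> and finitely many generators of \<open>\<mm> \<gamma>\<close>. By the
  hypothesis \<open>\<mm> \<gamma> A\<^sub>\<delta> = \<mm> \<delta>\<close> their images generate the maximal ideal of every later \<open>A \<delta>\<close>, and
  hence also that of the local ring \<open>S\<close>. So all these rings can be compared through the monomials
  in one and the same finite set of elements.

  The monomials are well-ordered, and the ideals \<open>F\<^sub>n\<close> generated by the monomials from the \<open>n\<close>-th on
  form a filtration. The maximal ideal carries \<open>F\<^sub>n\<close> into \<open>F\<^bsub>n+1\<^esub>\<close>, so \<open>F\<^sub>n / F\<^bsub>n+1\<^esub>\<close> is spanned over the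
  residue field by the \<open>n\<close>-th monomial; call that monomial nonstandard if the quotient vanishes. The
  nonstandard monomials are closed under multiples, can only increase along the system, and those
  of \<open>S\<close> are the union of those of the \<open>A \<delta>\<close>. By Dickson's lemma the set for \<open>S\<close> is generated by
  finitely many monomials, so from some index on \<open>A \<delta>\<close> and \<open>S\<close> have the same nonstandard monomials.

  For such \<open>\<delta>\<close> the associated graded rings of \<open>A \<delta>\<close> and \<open>S\<close> agree up to the change of the residue
  field, and the map \<open>A \<delta> \<rightarrow> S\<close> behaves as a faithfully flat one. Two instances of this are proved
  directly, by descending through the filtration and using Krull's intersection theorem in the
  Noetherian ring \<open>A \<delta>\<close>: every ideal of \<open>A \<delta>\<close> is contracted from its extension to \<open>S\<close>
  (\<open>extension_contract\<close>), and the formation of colon ideals \<open>H : a\<close> commutes with the extension,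
  first up to \<open>F\<^sub>n\<close> for all \<open>n\<close> (\<open>extension_colon\<close>).

  The contraction property and Krull's theorem in the \<open>A \<delta>\<close> show that finitely generated ideals of \<open>S\<close>
  are closed for the filtration. A second use of Dickson's lemma gives, inside any ideal of \<open>S\<close>, a
  finitely generated ideal with the same leading monomials; being closed, it is the whole ideal.
  Thus \<open>S\<close> is Noetherian (\<open>noetherian_if_ideals_closed\<close>).

  The colon property says that a regular sequence of \<open>A \<delta>\<close> remains regular in \<open>S\<close>. A chain of primes
  of \<open>S\<close> contracts to a chain of the same length in \<open>A \<delta>\<close> for \<open>\<delta>\<close> large; the Cohen--Macaulay ring
  \<open>A \<delta>\<close> therefore contains a regular sequence at least as long, and so does \<open>S\<close>. Hence the dimension
  of \<open>S\<close> is at most its depth. The converse inequality holds in every local ring, because a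
  prime containing an element that is regular modulo a smaller ideal is not minimal over that ideal.

  All of this depends only on properties that determine the limit up to isomorphism, and so it
  applies equally to the localization of \<open>S\<close> at its maximal ideal.
\<close>

section \<open>Generated ideals\<close>

lemma (in cring) colon_ideal:
  assumes "ideal I R" "a \<in> carrier R"
  shows "ideal {c \<in> carrier R. c \<otimes> a \<in> I} R"
proof -
  interpret I: ideal I R by fact
  show ?thesis
  proof (rule idealI)
    show "ring R" by (rule ring_axioms)
    show "subgroup {c \<in> carrier R. c \<otimes> a \<in> I} (add_monoid R)"
    proof (rule add.subgroupI)
      show "{c \<in> carrier R. c \<otimes> a \<in> I} \<noteq> {}" using assms by auto
      show "\<And>b. b \<in> {c \<in> carrier R. c \<otimes> a \<in> I} \<Longrightarrow> \<ominus> b \<in> {c \<in> carrier R. c \<otimes> a \<in> I}"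
        using assms by (auto simp: l_minus)
    qed (use assms in \<open>auto simp: l_distr\<close>)
    fix c x assume c: "c \<in> {c \<in> carrier R. c \<otimes> a \<in> I}" and x: "x \<in> carrier R"
    then show *: "x \<otimes> c \<in> {c \<in> carrier R. c \<otimes> a \<in> I}"
      using assms by (auto simp: m_assoc I.I_l_closed)
    show "c \<otimes> x \<in> {c \<in> carrier R. c \<otimes> a \<in> I}"
      using * c x by (simp add: m_comm)
  qed
qed

lemma (in cring) image_mult_ideal:
  assumes "ideal I R" "a \<in> carrier R"
  shows "ideal ((\<lambda>c. c \<otimes> a) ` I) R"
proof -
  interpret I: ideal I R by fact
  show ?thesis
  proof (rule idealI[OF ring_axioms])
    show "subgroup ((\<lambda>c. c \<otimes> a) ` I) (add_monoid R)"
    proof (rule add.subgroupI)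
      show "(\<lambda>c. c \<otimes> a) ` I \<noteq> {}" using I.zero_closed by blast
    next
      fix b assume "b \<in> (\<lambda>c. c \<otimes> a) ` I"
      then obtain c where "c \<in> I" "b = c \<otimes> a" by blast
      then show "\<ominus> b \<in> (\<lambda>c. c \<otimes> a) ` I" using assms(2)
        by (auto intro!: rev_image_eqI[of "\<ominus> c"] simp: l_minus)
    next
      fix b b' assume "b \<in> (\<lambda>c. c \<otimes> a) ` I" "b' \<in> (\<lambda>c. c \<otimes> a) ` I"
      then obtain c c' where "c \<in> I" "b = c \<otimes> a" "c' \<in> I" "b' = c' \<otimes> a" by blast
      then show "b \<oplus> b' \<in> (\<lambda>c. c \<otimes> a) ` I" using assms(2)
        by (auto intro!: rev_image_eqI[of "c \<oplus> c'"] simp: l_distr)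
    qed (use assms(2) in auto)
    fix b y assume "b \<in> (\<lambda>c. c \<otimes> a) ` I" and y: "y \<in> carrier R"
    then obtain c where c: "c \<in> I" "b = c \<otimes> a" by blast
    then have "y \<otimes> b = (y \<otimes> c) \<otimes> a" using assms(2) y by (simp add: m_assoc)
    then show *: "y \<otimes> b \<in> (\<lambda>c. c \<otimes> a) ` I" using c y I.I_l_closed by blast
    show "b \<otimes> y \<in> (\<lambda>c. c \<otimes> a) ` I" using * c assms(2) y by (simp add: m_comm)
  qed
qed

text \<open>Zorn's lemma for ideals. It is applied to a multiplicative set \<open>T\<close> to find prime ideals, to
\<open>T = {\<one>}\<close> to find maximal ideals, and to a single element in Krull's intersection theorem.\<close>

lemma (in ring) ideal_maximal_avoiding:
  assumes I: "ideal I R" "I \<inter> T = {}"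
  obtains Q where "ideal Q R" "I \<subseteq> Q" "Q \<inter> T = {}"
    and "\<And>Y. \<lbrakk>ideal Y R; Q \<subseteq> Y; Y \<inter> T = {}\<rbrakk> \<Longrightarrow> Y = Q"
proof -
  define C where "C = {Q. ideal Q R \<and> I \<subseteq> Q \<and> Q \<inter> T = {}}"
  have "\<exists>M\<in>C. \<forall>Y\<in>C. M \<subseteq> Y \<longrightarrow> Y = M"
  proof (rule subset_Zorn_nonempty)
    show "C \<noteq> {}" using I C_def by blast
    fix CC assume ne: "CC \<noteq> {}" and ch: "subset.chain C CC"
    then have "subset.chain {I. ideal I R} CC" unfolding pred_on.chain_def C_def by auto
    then have "ideal (\<Union>CC) R" using chain_Union_is_ideal[of CC] ne by simp
    then show "\<Union>CC \<in> C" using ne ch unfolding pred_on.chain_def C_def by blast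
  qed
  then obtain Q where QC: "Q \<in> C" and max: "\<forall>Y\<in>C. Q \<subseteq> Y \<longrightarrow> Y = Q" by (rule bexE)
  have Q: "ideal Q R" "I \<subseteq> Q" "Q \<inter> T = {}" using QC by (simp_all add: C_def)
  show ?thesis by (rule that[OF Q]) (use max Q(2) in \<open>simp add: C_def\<close>)
qed

lemma (in ring) ideal_diff:
  assumes "ideal I R" "a \<in> I" "b \<in> I"
  shows "a \<ominus> b \<in> I"
  using assms by (simp add: a_minus_def ideal.axioms(1) additive_subgroup.a_closed
      additive_subgroup.a_inv_closed)

lemma (in ring) mem_set_add: "x \<in> I <+>\<^bsub>R\<^esub> J \<longleftrightarrow> (\<exists>i\<in>I. \<exists>j\<in>J. x = i \<oplus> j)"
  by (auto simp: set_add_def')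

lemma (in ring) ideal_subset: "ideal I R \<Longrightarrow> I \<subseteq> carrier R"
  by (rule subsetI) (rule ideal.Icarr)

lemma (in ring)
  assumes "ideal I R" "ideal J R"
  shows ideal_add_left: "I \<subseteq> I <+>\<^bsub>R\<^esub> J" and ideal_add_right: "J \<subseteq> I <+>\<^bsub>R\<^esub> J"
  using genideal_self[of "I \<union> J"] ideal_subset[OF assms(1)] ideal_subset[OF assms(2)]
  unfolding union_genideal[OF assms] by auto

lemma (in ring) ideal_add_minimal:
  assumes "ideal I R" "ideal J R" "ideal K R" "I \<subseteq> K" "J \<subseteq> K"
  shows "I <+>\<^bsub>R\<^esub> J \<subseteq> K"
  unfolding union_genideal[OF assms(1,2), symmetric] using assms by (intro genideal_minimal) auto

lemma (in cring) mem_genideal_insert: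
  assumes "A \<subseteq> carrier R" "a \<in> carrier R" "x \<in> Idl (insert a A)"
  obtains c y where "c \<in> carrier R" "y \<in> Idl A" "x = c \<otimes> a \<oplus> y"
proof -
  have i: "ideal (PIdl a) R" "ideal (Idl A) R"
    using assms by (auto intro: cgenideal_ideal genideal_ideal)
  have "Idl (insert a A) \<subseteq> PIdl a <+>\<^bsub>R\<^esub> Idl A"
    using ideal_add_left[OF i] ideal_add_right[OF i] genideal_self[OF assms(1)]
      cgenideal_self[OF assms(2)]
    by (intro genideal_minimal add_ideals i) auto
  then have "x \<in> PIdl a <+>\<^bsub>R\<^esub> Idl A" using assms by blast
  then show ?thesis using that unfolding mem_set_add cgenideal_def by blast
qed

text \<open>The elements that multiply \<open>a\<close> into \<open>I\<close> form an ideal, so that products can be tested on generators.\<close>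

lemma (in cring) genideal_mult_mem:
  assumes "ideal I R" "a \<in> carrier R" "A \<subseteq> carrier R"
    and "\<And>y. y \<in> A \<Longrightarrow> y \<otimes> a \<in> I" "x \<in> Idl A"
  shows "x \<otimes> a \<in> I"
proof -
  have "Idl A \<subseteq> {c \<in> carrier R. c \<otimes> a \<in> I}"
    using assms by (intro genideal_minimal colon_ideal) auto
  then show ?thesis using assms by blast
qed

lemma ring_hom_genideal:
  assumes "ring R" "ring S" "h \<in> ring_hom R S" "A \<subseteq> carrier R" "x \<in> Idl\<^bsub>R\<^esub> A"
  shows "h x \<in> Idl\<^bsub>S\<^esub> (h ` A)"
proof -
  interpret ring_hom_ring R S h by (rule ring_hom_ringI2) fact+
  have hA: "h ` A \<subseteq> carrier S" using assms(4) by auto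
  have "Idl\<^bsub>R\<^esub> A \<subseteq> {r \<in> carrier R. h r \<in> Idl\<^bsub>S\<^esub> (h ` A)}"
    using assms(4) S.genideal_self[OF hA] by (intro R.genideal_minimal ideal_vimage S.genideal_ideal hA) auto
  then show ?thesis using assms(5) by blast
qed

lemma genideal_image_genideal:
  assumes "ring R" "ring S" "h \<in> ring_hom R S" "A \<subseteq> carrier R"
  shows "Idl\<^bsub>S\<^esub> (h ` (Idl\<^bsub>R\<^esub> A)) = Idl\<^bsub>S\<^esub> (h ` A)"
proof -
  interpret ring_hom_ring R S h by (rule ring_hom_ringI2) fact+
  have hA: "h ` A \<subseteq> carrier S" using assms(4) by auto
  have I: "ideal (Idl\<^bsub>R\<^esub> A) R" using assms(4) by (rule R.genideal_ideal)
  have hI: "h ` (Idl\<^bsub>R\<^esub> A) \<subseteq> carrier S" using R.ideal_subset[OF I] by auto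
  show ?thesis
  proof
    show "Idl\<^bsub>S\<^esub> (h ` (Idl\<^bsub>R\<^esub> A)) \<subseteq> Idl\<^bsub>S\<^esub> (h ` A)"
      using ring_hom_genideal[OF assms] by (intro S.genideal_minimal S.genideal_ideal hA) auto
    show "Idl\<^bsub>S\<^esub> (h ` A) \<subseteq> Idl\<^bsub>S\<^esub> (h ` (Idl\<^bsub>R\<^esub> A))"
      by (rule S.subset_Idl_subset[OF hI]) (use R.genideal_self[OF assms(4)] in blast)
  qed
qed

section \<open>Dickson's lemma\<close>

text \<open>Numbers composed of the primes in \<open>P\<close> are exponent vectors, and divisibility is their componentwise
order. The minimal elements generate; suppose that there are infinitely many. Of two minimal elements
\<open>x < y\<close> the first does not divide the second, so the exponent of some prime drops from \<open>x\<close> to \<open>y\<close>.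
By Ramsey's theorem an infinite subset has drops at one and the same prime for all its pairs, which is
an infinite descent.\<close>

lemma dickson:
  fixes T :: "nat set"
  assumes P: "finite P" "\<And>p. p \<in> P \<Longrightarrow> Factorial_Ring.prime p"
    and T: "\<And>n p. n \<in> T \<Longrightarrow> Factorial_Ring.prime p \<Longrightarrow> p dvd n \<Longrightarrow> p \<in> P" "0 \<notin> T"
  obtains B where "finite B" "B \<subseteq> T" "\<And>n. n \<in> T \<Longrightarrow> \<exists>b\<in>B. b dvd n"
proof -
  define B where "B = {b \<in> T. \<forall>b'\<in>T. b' dvd b \<longrightarrow> b' = b}"
  have gen: "\<exists>b\<in>B. b dvd n" if "n \<in> T" for n
    using that
  proof (induction n rule: less_induct)
    case (less n)
    show ?case
    proof (cases "n \<in> B")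
      case False
      then obtain b' where b': "b' \<in> T" "b' dvd n" "b' \<noteq> n" using less.prems B_def by blast
      then have "b' < n" using less.prems T(2) by (metis dvd_imp_le gr0I le_neq_implies_less)
      then show ?thesis using less.IH b' dvd_trans by blast
    next
      case True
      then show ?thesis using dvd_refl by metis
    qed
  qed
  have "finite B"
  proof (rule ccontr)
    assume inf: "infinite B"
    obtain e where e: "bij_betw e P {..<card P}" using P(1) finite_same_card_bij[of P "{..<card P}"] by auto
    \<comment> \<open>The colour of a pair is the number of a prime at which the exponent drops; the colour \<open>card P\<close> stands for no drop.\<close>
    define g where "g W = (if \<exists>p\<in>P. multiplicity p (Max W) < multiplicity p (Min W)
        then e (SOME p. p \<in> P \<and> multiplicity p (Max W) < multiplicity p (Min W)) else card P)" for W
    have g1: "g {x, y} < Suc (card P)" for x y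
    proof (cases "\<exists>p\<in>P. multiplicity p (Max {x,y}) < multiplicity p (Min {x,y})")
      case True
      then have "(SOME p. p \<in> P \<and> multiplicity p (Max {x,y}) < multiplicity p (Min {x,y})) \<in> P"
        by (metis (mono_tags, lifting) someI_ex)
      then show ?thesis unfolding g_def using True e bij_betw_apply by fastforce
    qed (simp add: g_def)
    obtain Y t where Y: "Y \<subseteq> B" "infinite Y" "\<forall>x\<in>Y. \<forall>y\<in>Y. x \<noteq> y \<longrightarrow> g {x, y} = t"
      using Ramsey2[OF inf, of g "Suc (card P)"] g1 by blast
    have Tn: "n > 0" if "n \<in> T" for n using that T(2) by (cases n) auto
    have ex: "\<exists>p\<in>P. multiplicity p y < multiplicity p x" if "x \<in> Y" "y \<in> Y" "x < y" for x y
    proof (rule ccontr)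
      assume "\<not> ?thesis"
      then have le: "\<And>p. p \<in> P \<Longrightarrow> multiplicity p x \<le> multiplicity p y" by force
      have xy: "x \<in> T" "y \<in> T" using that Y(1) B_def by auto
      have "x dvd y"
      proof (rule multiplicity_le_imp_dvd)
        show "x \<noteq> 0" using Tn xy(1) by blast
        fix p :: nat assume "Factorial_Ring.prime p"
        then show "multiplicity p x \<le> multiplicity p y"
          using le T(1)[OF xy(1)] by (metis le0 not_dvd_imp_multiplicity_0)
      qed
      then show False using that Y(1) B_def xy by auto
    qed
    have ge: "t = e p \<longrightarrow> p \<in> P \<longrightarrow> multiplicity p y < multiplicity p x" if "x \<in> Y" "y \<in> Y" "x < y" for x y p
    proof (intro impI)
      assume p: "t = e p" "p \<in> P"
      let ?q = "SOME p. p \<in> P \<and> multiplicity p y < multiplicity p x"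
      have mm: "Max {x, y} = y" "Min {x, y} = x" using that by auto
      have q: "?q \<in> P \<and> multiplicity ?q y < multiplicity ?q x"
        using someI_ex[of "\<lambda>p. p \<in> P \<and> multiplicity p y < multiplicity p x"] ex[OF that] by blast
      have "g {x, y} = e ?q" using ex[OF that] unfolding g_def mm by simp
      then have "e ?q = e p" using Y(3) that p by auto
      then have "?q = p" using q p(2) e by (meson bij_betw_def inj_onD)
      then show "multiplicity p y < multiplicity p x" using q by simp
    qed
    obtain p where p: "p \<in> P" "t = e p"
    proof -
      obtain x where x: "x \<in> Y" using Y(2) by fastforce
      obtain y where y: "y \<in> Y" "x < y" using Y(2) x by (meson infinite_nat_iff_unbounded)
      have mm: "Max {x, y} = y" "Min {x, y} = x" using y by auto
      have "(SOME p. p \<in> P \<and> multiplicity p y < multiplicity p x) \<in> P"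
        using someI_ex[of "\<lambda>p. p \<in> P \<and> multiplicity p y < multiplicity p x"] ex[OF x y] by blast
      moreover have "g {x, y} = e (SOME p. p \<in> P \<and> multiplicity p y < multiplicity p x)"
        using ex[OF x y] unfolding g_def mm by simp
      ultimately show ?thesis using that Y(3) x y by auto
    qed
    have "inj_on (multiplicity p) Y"
      by (rule linorder_inj_onI) (use ge p in fastforce)+
    moreover have "multiplicity p y \<le> multiplicity p (Min' )" if "Min' = (LEAST x. x \<in> Y)" "y \<in> Y" for y Min'
    proof (cases "y = Min'")
      case False
      moreover have "Min' \<in> Y" "Min' \<le> y" using that by (auto intro: LeastI Least_le)
      ultimately show ?thesis using ge[of Min' y p] that p by auto
    qed simp
    then have "multiplicity p ` Y \<subseteq> {..multiplicity p (LEAST x. x \<in> Y)}" by auto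
    ultimately show False using Y(2) finite_imageD finite_subset by blast
  qed
  then show ?thesis using that[of B] gen B_def by blast
qed

section \<open>The monomial filtration of a local ring\<close>

text \<open>The monomials in finitely many elements, indexed by positive integers: the elements are the
values at the primes in \<open>P\<close>, and all other primes are sent to zero. Multiplication of monomials
is multiplication of indices, and the usual order of the integers becomes a monomial order (by
weight, where the variable at the prime \<open>p\<close> has weight \<open>log p\<close>) with only finitely many monomials below each one.
The index \<open>0\<close> has no meaning.\<close>

locale monomial_map = cring R for R (structure) +
  fixes \<mu> :: "nat \<Rightarrow> 'a" and P :: "nat set"
  assumes mu_closed [simp, intro]: "\<mu> n \<in> carrier R"
    and mu_one: "\<mu> 1 = \<one>"
    and mu_mult: "\<lbrakk>0 < k; 0 < l\<rbrakk> \<Longrightarrow> \<mu> (k * l) = \<mu> k \<otimes> \<mu> l"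
    and finite_P: "finite P"
    and prime_P: "p \<in> P \<Longrightarrow> Factorial_Ring.prime p"
    and mu_prime_zero: "\<lbrakk>Factorial_Ring.prime p; p \<notin> P\<rbrakk> \<Longrightarrow> \<mu> p = \<zero>"

lemma (in monomial_map) monomial_map_image:
  assumes S: "cring S" and h: "h \<in> ring_hom R S"
  shows "monomial_map S (h \<circ> \<mu>) P"
proof -
  interpret S: cring S by fact
  have zero: "h \<zero> = \<zero>\<^bsub>S\<^esub>" by (rule ring_hom_zero[OF h ring_axioms S.ring_axioms])
  show ?thesis
  proof (intro monomial_map.intro S monomial_map_axioms.intro)
    show "(h \<circ> \<mu>) n \<in> carrier S" for n using ring_hom_closed[OF h mu_closed] by simp
    show "(h \<circ> \<mu>) 1 = \<one>\<^bsub>S\<^esub>" using ring_hom_one[OF h] mu_one by simp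
    show "(h \<circ> \<mu>) (k * l) = (h \<circ> \<mu>) k \<otimes>\<^bsub>S\<^esub> (h \<circ> \<mu>) l" if "0 < k" "0 < l" for k l
      using ring_hom_mult[OF h mu_closed mu_closed] mu_mult[OF that] by simp
    show "(h \<circ> \<mu>) p = \<zero>\<^bsub>S\<^esub>" if "Factorial_Ring.prime p" "p \<notin> P" for p
      using mu_prime_zero[OF that] zero by simp
  qed (fact finite_P, fact prime_P)
qed

text \<open>The condition \<open>\<mm> = Idl (\<mu> ` {2..})\<close> says that the chosen elements generate the maximal ideal, since
every integer from \<open>2\<close> on has a prime factor.\<close>

locale monomial_local_ring = monomial_map R \<mu> P
  for R (structure) and \<mm> and \<mu> and P +
  assumes m_ideal: "ideal \<mm> R"
    and one_notin_m: "\<one> \<notin> \<mm>"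
    and notin_m_Units: "\<lbrakk>c \<in> carrier R; c \<notin> \<mm>\<rbrakk> \<Longrightarrow> c \<in> Units R"
    and m_generated: "Idl (\<mu> ` {2..}) = \<mm>"
begin

definition tail :: "nat \<Rightarrow> 'a set" where
  "tail n = Idl (\<mu> ` {n..})"

text \<open>A nonstandard monomial is redundant in the filtration: \<open>tail n = tail (Suc n)\<close>. Every nonstandard
index is a leading index of every ideal, witnessed by the element zero.\<close>

definition nonstandard :: "nat set" where
  "nonstandard = {n. 0 < n \<and> \<mu> n \<in> tail (Suc n)}"

definition leading :: "'a set \<Rightarrow> nat set" where
  "leading J = {n. 0 < n \<and> (\<exists>j\<in>J. j \<ominus> \<mu> n \<in> tail (Suc n))}"

lemma mu_image: "\<mu> ` A \<subseteq> carrier R" by auto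

lemma tail_ideal: "ideal (tail n) R"
  unfolding tail_def by (rule genideal_ideal[OF mu_image])

lemma tail_closed: "x \<in> tail n \<Longrightarrow> x \<in> carrier R"
  using ideal.Icarr[OF tail_ideal] .

lemma m_carr: "x \<in> \<mm> \<Longrightarrow> x \<in> carrier R"
  using ideal.Icarr[OF m_ideal] .

lemma mu_tail: "n \<le> k \<Longrightarrow> \<mu> k \<in> tail n"
  unfolding tail_def using genideal_self[OF mu_image[of "{n..}"]] by auto

lemma tail_minimal: "ideal I R \<Longrightarrow> (\<And>k. n \<le> k \<Longrightarrow> \<mu> k \<in> I) \<Longrightarrow> tail n \<subseteq> I"
  unfolding tail_def by (rule genideal_minimal) auto

lemma tail_antimono: "n \<le> k \<Longrightarrow> tail k \<subseteq> tail n"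
  by (rule tail_minimal[OF tail_ideal]) (simp add: mu_tail)

lemma tail_one: "tail 1 = carrier R"
  using ideal.one_imp_carrier[OF tail_ideal] mu_tail[of 1 1] mu_one by simp

lemma tail_two: "tail 2 = \<mm>"
  unfolding tail_def by (rule m_generated)

lemma mu_zero_of_prime_dvd:
  assumes "0 < n" "Factorial_Ring.prime p" "p dvd n" "p \<notin> P"
  shows "\<mu> n = \<zero>"
proof -
  obtain l where l: "n = p * l" using assms(3) by blast
  have "0 < p" "0 < l" using l assms(1) by auto
  then show ?thesis using l mu_mult mu_prime_zero[OF assms(2,4)] by simp
qed

lemma tail_split:
  assumes "x \<in> tail n"
  obtains c y where "c \<in> carrier R" "y \<in> tail (Suc n)" "x = c \<otimes> \<mu> n \<oplus> y"
proof -
  have "{n..} = insert n {Suc n..}" by auto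
  then have "x \<in> Idl (insert (\<mu> n) (\<mu> ` {Suc n..}))"
    using assms unfolding tail_def by simp
  then show ?thesis using that mem_genideal_insert[OF mu_image mu_closed] unfolding tail_def by metis
qed

lemma mu_tail_mult:
  assumes "0 < l" "0 < k" "x \<in> tail k"
  shows "x \<otimes> \<mu> l \<in> tail (k * l)"
proof (rule genideal_mult_mem[OF tail_ideal mu_closed mu_image _ assms(3)[unfolded tail_def]])
  fix y assume "y \<in> \<mu> ` {k..}"
  then obtain j where j: "y = \<mu> j" "k \<le> j" by auto
  then have "y \<otimes> \<mu> l = \<mu> (j * l)" using mu_mult assms by simp
  then show "y \<otimes> \<mu> l \<in> tail (k * l)" using j by (simp add: mu_tail)
qed

text \<open>A generator has index \<open>j \<ge> 2\<close>, so it moves \<open>tail k\<close> into \<open>tail (k * j)\<close>, and \<open>k * j > k\<close>.\<close>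

lemma m_mult_tail:
  assumes "c \<in> \<mm>" "x \<in> tail k" "0 < k"
  shows "c \<otimes> x \<in> tail (Suc k)"
proof (rule genideal_mult_mem[OF tail_ideal _ mu_image _ assms(1)[folded m_generated]])
  show x: "x \<in> carrier R" using assms(2) by (rule tail_closed)
  fix y assume "y \<in> \<mu> ` {2..}"
  then obtain j where j: "y = \<mu> j" "2 \<le> j" by auto
  have "x \<otimes> y \<in> tail (k * j)" unfolding j(1) by (rule mu_tail_mult) (use assms j in auto)
  moreover have "Suc k \<le> k * 2" "k * 2 \<le> k * j" using assms(3) j(2) by auto
  then have "tail (k * j) \<subseteq> tail (Suc k)" by (intro tail_antimono) linarith
  moreover have "x \<otimes> y = y \<otimes> x" using x j by (simp add: m_comm)
  ultimately show "y \<otimes> x \<in> tail (Suc k)" by auto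
qed

text \<open>Compatibility of the order with multiplication: \<open>(n + 1) * l > n * l\<close>.\<close>

lemma nonstandard_mult:
  assumes "n \<in> nonstandard" "0 < l"
  shows "n * l \<in> nonstandard"
proof -
  have n: "0 < n" "\<mu> n \<in> tail (Suc n)" using assms(1) by (auto simp: nonstandard_def)
  have "\<mu> (n * l) = \<mu> n \<otimes> \<mu> l" using mu_mult n assms by simp
  also have "\<dots> \<in> tail (Suc n * l)" by (rule mu_tail_mult) (use n assms in auto)
  finally have "\<mu> (n * l) \<in> tail (Suc n * l)" .
  moreover have "Suc (n * l) \<le> Suc n * l" using assms by simp
  ultimately have "\<mu> (n * l) \<in> tail (Suc (n * l))" using tail_antimono[of "Suc (n * l)" "Suc n * l"] by auto
  then show ?thesis using n assms by (simp add: nonstandard_def)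
qed

lemma nonstandard_of_prime_dvd:
  assumes "0 < n" "Factorial_Ring.prime p" "p dvd n" "p \<notin> P"
  shows "n \<in> nonstandard"
  using mu_zero_of_prime_dvd[OF assms] assms(1) additive_subgroup.zero_closed[OF ideal.axioms(1)[OF tail_ideal]]
  by (simp add: nonstandard_def)

lemma tail_nonstandard: "n \<in> nonstandard \<Longrightarrow> tail n = tail (Suc n)"
proof
  assume n: "n \<in> nonstandard"
  show "tail n \<subseteq> tail (Suc n)"
  proof (rule tail_minimal[OF tail_ideal])
    fix k assume "n \<le> k"
    then show "\<mu> k \<in> tail (Suc n)" using n mu_tail[of "Suc n" k]
      by (cases "k = n") (auto simp: nonstandard_def)
  qed
qed (simp add: tail_antimono)

lemma leading_mult:
  assumes "ideal J R" "n \<in> leading J" "0 < l"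
  shows "n * l \<in> leading J"
proof -
  obtain j where j: "0 < n" "j \<in> J" "j \<ominus> \<mu> n \<in> tail (Suc n)"
    using assms(2) by (auto simp: leading_def)
  have jc: "j \<in> carrier R" using j(2) ideal.Icarr[OF assms(1)] by blast
  have "(j \<ominus> \<mu> n) \<otimes> \<mu> l \<in> tail (Suc n * l)" by (rule mu_tail_mult) (use j assms in auto)
  moreover have "(j \<ominus> \<mu> n) \<otimes> \<mu> l = j \<otimes> \<mu> l \<ominus> \<mu> (n * l)"
    using jc j(1) assms(3) by (simp add: mu_mult a_minus_def l_distr l_minus)
  moreover have "tail (Suc n * l) \<subseteq> tail (Suc (n * l))"
    using assms by (intro tail_antimono) simp
  moreover have "j \<otimes> \<mu> l \<in> J" using ideal.I_r_closed[OF assms(1) j(2)] by simp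
  ultimately show ?thesis using j(1) assms(3) unfolding leading_def by auto
qed

lemma leading_of_prime_dvd:
  assumes "ideal J R" "0 < n" "Factorial_Ring.prime p" "p dvd n" "p \<notin> P"
  shows "n \<in> leading J"
proof -
  have z: "\<zero> \<in> J" "\<zero> \<in> tail (Suc n)"
    using additive_subgroup.zero_closed[OF ideal.axioms(1)] assms(1) tail_ideal by auto
  have "\<mu> n = \<zero>" by (rule mu_zero_of_prime_dvd) fact+
  then show ?thesis using assms(2) z unfolding leading_def by (auto intro!: bexI[of _ \<zero>] simp: a_minus_def)
qed

lemma leading_of_unit:
  assumes "ideal J R" "0 < n" "c \<in> Units R" "y \<in> tail (Suc n)" "c \<otimes> \<mu> n \<oplus> y \<in> J"
  shows "n \<in> leading J"
proof -
  have c: "c \<in> carrier R" "inv c \<in> carrier R" "inv c \<otimes> c = \<one>" using assms(3) by auto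
  have y: "y \<in> carrier R" using assms(4) by (rule tail_closed)
  have "inv c \<otimes> (c \<otimes> \<mu> n \<oplus> y) = \<mu> n \<oplus> inv c \<otimes> y"
    using c y by (simp add: r_distr m_assoc[symmetric])
  moreover have "inv c \<otimes> (c \<otimes> \<mu> n \<oplus> y) \<in> J" using ideal.I_l_closed[OF assms(1,5) c(2)] .
  ultimately have "\<mu> n \<oplus> inv c \<otimes> y \<in> J" by simp
  moreover have "(\<mu> n \<oplus> inv c \<otimes> y) \<ominus> \<mu> n = inv c \<otimes> y" using c(2) y mu_closed[of n] by algebra
  moreover have "inv c \<otimes> y \<in> tail (Suc n)" using ideal.I_l_closed[OF tail_ideal assms(4) c(2)] .
  ultimately have "\<exists>j\<in>J. j \<ominus> \<mu> n \<in> tail (Suc n)" by metis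
  then show ?thesis using assms(2) unfolding leading_def by auto
qed

text \<open>A leading coefficient in \<open>\<mm>\<close> moves its term into the next tail; any other one is a unit and can be divided out.\<close>

lemma reduce_step:
  assumes J: "ideal J R" and n: "0 < n" and x: "x \<in> J" "x \<in> tail n"
  shows "x \<in> tail (Suc n) \<or> n \<in> leading J"
proof -
  obtain c y where c: "c \<in> carrier R" "y \<in> tail (Suc n)" "x = c \<otimes> \<mu> n \<oplus> y"
    using tail_split[OF x(2)] by blast
  show ?thesis
  proof (cases "c \<in> \<mm>")
    case True
    have "c \<otimes> \<mu> n \<in> tail (Suc n)" by (rule m_mult_tail[OF True mu_tail n]) simp
    then show ?thesis using c additive_subgroup.a_closed[OF ideal.axioms(1)[OF tail_ideal]] by blast
  next
    case False
    then show ?thesis using leading_of_unit[OF J n notin_m_Units[OF c(1)] c(2)] c x by blast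
  qed
qed

text \<open>One step of the division algorithm: the leading term of \<open>x\<close> is cancelled by a multiple of \<open>j\<close>.\<close>

lemma reduce_by:
  assumes n: "0 < n" and j: "j \<in> carrier R" "j \<ominus> \<mu> n \<in> tail (Suc n)" and x: "x \<in> tail n"
  obtains c where "c \<in> carrier R" "x \<ominus> c \<otimes> j \<in> tail (Suc n)"
proof -
  obtain c y where c: "c \<in> carrier R" "y \<in> tail (Suc n)" "x = c \<otimes> \<mu> n \<oplus> y"
    using tail_split[OF x] by blast
  have y: "y \<in> carrier R" using c(2) by (rule tail_closed)
  have eq: "x \<ominus> c \<otimes> j = y \<ominus> c \<otimes> (j \<ominus> \<mu> n)"
    unfolding c(3) using c(1) y j(1) mu_closed[of n] by algebra
  have "x \<ominus> c \<otimes> j \<in> tail (Suc n)" unfolding eq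
    by (intro ideal_diff[OF tail_ideal] c ideal.I_l_closed[OF tail_ideal] j)
  then show ?thesis using that c(1) by blast
qed

lemma reduce_leading:
  assumes K: "ideal K R" and n: "n \<in> leading K" and x: "x \<in> tail n"
  obtains k where "k \<in> K" "x \<ominus> k \<in> tail (Suc n)"
proof -
  obtain j where j: "0 < n" "j \<in> K" "j \<ominus> \<mu> n \<in> tail (Suc n)"
    using n by (auto simp: leading_def)
  obtain c where c: "c \<in> carrier R" "x \<ominus> c \<otimes> j \<in> tail (Suc n)"
    using reduce_by[OF j(1) ideal.Icarr[OF K j(2)] j(3) x] by blast
  show ?thesis by (rule that[OF ideal.I_l_closed[OF K j(2) c(1)] c(2)])
qed

text \<open>Krull's intersection theorem for the topology given by the tails. If \<open>x \<notin> I\<close>, then \<open>x\<close> is not in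
\<open>I + \<mm>x\<close> either, by Nakayama. Choose \<open>Q\<close> maximal among the ideals that contain \<open>I + \<mm>x\<close> but not \<open>x\<close>.
Then \<open>Q\<close> contains a power of each \<open>t \<in> \<mm>\<close>: the chain of ideals \<open>Q : t\<^sup>e\<close> becomes stationary, and if
\<open>t\<^sup>e\<close> were not in \<open>Q\<close> for such an \<open>e\<close>, maximality would give \<open>x = q + r t\<^sup>e\<close> with \<open>q \<in> Q\<close>; from
\<open>tx \<in> Q\<close> we would get \<open>r t\<^bsup>e+1\<^esup> \<in> Q\<close>, hence \<open>r t\<^sup>e \<in> Q\<close> and \<open>x \<in> Q\<close>. So all but finitely
many indices have their monomial in \<open>Q\<close>, and \<open>Q\<close> contains a tail, which contradicts \<open>x \<in> I + tail n\<close>.\<close>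

lemma krull_intersection:
  assumes N: "noetherian_ring R" and I: "ideal I R" and x: "x \<in> carrier R"
    and all: "\<And>n. x \<in> I <+>\<^bsub>R\<^esub> tail (Suc n)"
  shows "x \<in> I"
proof (rule ccontr)
  assume nx: "x \<notin> I"
  interpret N: noetherian_ring R by fact
  define mx where "mx = (\<lambda>c. c \<otimes> x) ` \<mm>"
  define I0 where "I0 = I <+>\<^bsub>R\<^esub> mx"
  have mx_ideal: "ideal mx R" unfolding mx_def by (rule image_mult_ideal[OF m_ideal x])
  have I0: "ideal I0 R" unfolding I0_def by (intro add_ideals I mx_ideal)
  have xI0: "x \<notin> I0"
  proof
    assume "x \<in> I0"
    then obtain i y where iy: "i \<in> I" "y \<in> mx" "x = i \<oplus> y"
      unfolding I0_def mem_set_add by blast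
    then obtain c where c: "c \<in> \<mm>" "y = c \<otimes> x" unfolding mx_def by blast
    note ic = iy(1) c(1) iy(3)[unfolded c(2)]
    have cc: "c \<in> carrier R" "i \<in> carrier R" using m_carr[OF ic(2)] ideal.Icarr[OF I ic(1)] by auto
    have "\<one> \<ominus> c \<notin> \<mm>"
    proof
      assume "\<one> \<ominus> c \<in> \<mm>"
      then have "(\<one> \<ominus> c) \<oplus> c \<in> \<mm>" using ic additive_subgroup.a_closed[OF ideal.axioms(1)[OF m_ideal]] by blast
      moreover have "(\<one> \<ominus> c) \<oplus> c = \<one>" using cc by algebra
      ultimately show False using one_notin_m by simp
    qed
    then have u: "\<one> \<ominus> c \<in> Units R" using notin_m_Units cc by simp
    have "(\<one> \<ominus> c) \<otimes> x = x \<ominus> c \<otimes> x" using x cc by algebra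
    also have "\<dots> = (i \<oplus> c \<otimes> x) \<ominus> c \<otimes> x" by (rule arg_cong[OF ic(3)])
    also have "\<dots> = i" using x cc by algebra
    finally have "inv (\<one> \<ominus> c) \<otimes> ((\<one> \<ominus> c) \<otimes> x) \<in> I"
      using ideal.I_l_closed[OF I ic(1)] u by simp
    moreover have "inv (\<one> \<ominus> c) \<otimes> ((\<one> \<ominus> c) \<otimes> x) = x"
      using u x cc by (simp add: m_assoc[symmetric])
    ultimately show False using nx by simp
  qed
  have "I0 \<inter> {x} = {}" using xI0 by simp
  then obtain Q where Q: "ideal Q R" "I0 \<subseteq> Q" "Q \<inter> {x} = {}"
    and max: "\<And>Y. \<lbrakk>ideal Y R; Q \<subseteq> Y; Y \<inter> {x} = {}\<rbrakk> \<Longrightarrow> Y = Q"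
    using ideal_maximal_avoiding[OF I0] by metis
  have xQ: "x \<notin> Q" using Q(3) by simp
  have Qmax: "Y = Q" if "ideal Y R" "Q \<subseteq> Y" "x \<notin> Y" for Y
    using max that by simp
  have mxQ: "c \<otimes> x \<in> Q" if "c \<in> \<mm>" for c
  proof -
    have "c \<otimes> x \<in> mx" unfolding mx_def using that by (rule imageI)
    then show ?thesis using Q(2) ideal_add_right[OF I mx_ideal] unfolding I0_def by blast
  qed
  have pow: "\<exists>e. t [^] (e::nat) \<in> Q" if t: "t \<in> \<mm>" for t
  proof -
    have tc: "t \<in> carrier R" using t by (rule m_carr)
    define D where "D e = {r \<in> carrier R. r \<otimes> t [^] (e::nat) \<in> Q}" for e
    have D: "ideal (D e) R" for e unfolding D_def by (rule colon_ideal[OF Q(1)]) (simp add: tc)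
    have Dmono: "D e \<subseteq> D (Suc e)" for e
    proof
      fix r assume "r \<in> D e"
      then have r: "r \<in> carrier R" "r \<otimes> t [^] e \<in> Q" by (auto simp: D_def)
      have "(r \<otimes> t [^] e) \<otimes> t \<in> Q" by (rule ideal.I_r_closed[OF Q(1) r(2) tc])
      then show "r \<in> D (Suc e)" using r(1) tc by (simp add: D_def m_assoc)
    qed
    have "\<Union>(range D) \<in> range D"
    proof (rule N.ideal_chain_is_trivial)
      have "D i \<subseteq> D j \<or> D j \<subseteq> D i" for i j
        using lift_Suc_mono_le[of D i j, OF Dmono] lift_Suc_mono_le[of D j i, OF Dmono] by linarith
      then show "subset.chain {I. ideal I R} (range D)" unfolding pred_on.chain_def using D by blast
    qed auto
    then obtain e where e: "\<Union>(range D) = D e" by auto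
    show ?thesis
    proof (rule exI[of _ e], rule ccontr)
      assume nQ: "t [^] e \<notin> Q"
      let ?Y = "Q <+>\<^bsub>R\<^esub> PIdl (t [^] e)"
      have te: "t [^] e \<in> carrier R" using tc by simp
      have Y: "ideal ?Y R" "Q \<subseteq> ?Y" "PIdl (t [^] e) \<subseteq> ?Y"
        using add_ideals ideal_add_left ideal_add_right Q(1) cgenideal_ideal[OF te] by auto
      then have "x \<in> ?Y" using Qmax[OF Y(1,2)] cgenideal_self[OF te] nQ by blast
      then obtain q r where qr: "q \<in> Q" "r \<in> carrier R" "x = q \<oplus> r \<otimes> t [^] e"
        unfolding mem_set_add cgenideal_def by blast
      have q: "q \<in> carrier R" using qr(1) ideal.Icarr[OF Q(1)] by blast
      have "r \<otimes> t [^] Suc e = t \<otimes> x \<ominus> t \<otimes> q" using qr(2,3) q tc te by (simp, algebra)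
      also have "\<dots> \<in> Q" using mxQ[OF t] ideal.I_l_closed[OF Q(1) qr(1) tc] ideal_diff[OF Q(1)] by blast
      finally have "r \<in> D (Suc e)" using qr(2) by (simp add: D_def)
      then have "r \<in> D e" using e by blast
      then have "q \<oplus> r \<otimes> t [^] e \<in> Q"
        using additive_subgroup.a_closed[OF ideal.axioms(1)[OF Q(1)] qr(1)] by (simp add: D_def)
      then show False using qr(3) xQ by simp
    qed
  qed
  have prime_m: "\<mu> p \<in> \<mm>" if "p \<in> P" for p
    using prime_P[OF that] prime_ge_2_nat mu_tail[of 2 p] tail_two by blast
  define ex where "ex p = (SOME e::nat. \<mu> p [^] e \<in> Q)" for p
  have ex: "\<mu> p [^] ex p \<in> Q" if "p \<in> P" for p
    unfolding ex_def using someI_ex[OF pow[OF prime_m[OF that]]] .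
  \<comment> \<open>A nonzero monomial outside \<open>Q\<close> has exponent less than \<open>ex p\<close> at each \<open>p\<close>, so its index divides \<open>M\<close>.\<close>
  define M where "M = (\<Prod>p\<in>P. p ^ ex p)"
  have mu_pow: "\<mu> (p ^ e) = \<mu> p [^] e" if "p \<in> P" for p e
    using prime_gt_0_nat[OF prime_P[OF that]]
    by (induction e) (simp_all add: mu_mult mu_one[unfolded One_nat_def] m_comm)
  have "M > 0" unfolding M_def using prime_gt_0_nat[OF prime_P] by (simp add: prod_pos)
  have "tail (Suc M) \<subseteq> Q"
  proof (rule tail_minimal[OF Q(1)])
    fix k assume k: "Suc M \<le> k"
    show "\<mu> k \<in> Q"
    proof (cases "\<exists>p\<in>P. p ^ ex p dvd k")
      case True
      then obtain p l where p: "p \<in> P" "k = p ^ ex p * l" by blast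
      have "0 < p ^ ex p" using prime_gt_0_nat[OF prime_P[OF p(1)]] by simp
      moreover have "0 < l" using p(2) k by (cases l) auto
      ultimately have "\<mu> k = \<mu> p [^] ex p \<otimes> \<mu> l" using p mu_mult mu_pow by simp
      then show ?thesis using ideal.I_r_closed[OF Q(1) ex[OF p(1)]] by simp
    next
      case nd: False
      show ?thesis
      proof (cases "\<exists>p. Factorial_Ring.prime p \<and> p dvd k \<and> p \<notin> P")
        case True
        then show ?thesis using mu_zero_of_prime_dvd[of k] k
            additive_subgroup.zero_closed[OF ideal.axioms(1)[OF Q(1)]] by auto
      next
        case False
        have "k dvd M"
        proof (rule multiplicity_le_imp_dvd)
          show "k \<noteq> 0" using k by simp
          fix p :: nat assume p: "Factorial_Ring.prime p"
          show "multiplicity p k \<le> multiplicity p M"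
          proof (cases "p dvd k")
            case True
            then have pP: "p \<in> P" using False p by blast
            have "multiplicity p k < ex p"
              using nd pP p k by (metis Suc_leD \<open>k \<noteq> 0\<close> multiplicity_dvd' not_less)
            moreover have "p ^ ex p dvd M" unfolding M_def using finite_P pP by (rule dvd_prodI)
            then have "ex p \<le> multiplicity p M"
              using \<open>M > 0\<close> p by (intro multiplicity_geI) (auto simp: not_prime_unit)
            ultimately show ?thesis by simp
          qed (simp add: not_dvd_imp_multiplicity_0)
        qed
        then have "k \<le> M" using \<open>M > 0\<close> by (rule dvd_imp_le)
        then show ?thesis using k by simp
      qed
    qed
  qed
  moreover have "I \<subseteq> Q" using Q(2) ideal_add_left[OF I mx_ideal] unfolding I0_def by (rule subset_trans[rotated])
  ultimately have "I <+>\<^bsub>R\<^esub> tail (Suc M) \<subseteq> Q" by (intro ideal_add_minimal I tail_ideal Q(1))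
  then have "x \<in> Q" using all[of M] by (rule subsetD)
  with xQ show False by (rule notE)
qed

end

section \<open>Homomorphisms that create no new nonstandard monomials\<close>

text \<open>Here \<open>\<phi>\<close> maps nonstandard monomials of \<open>R\<close> to nonstandard ones in any case; the assumption is that no
others become nonstandard. This is the substitute for flatness of \<open>\<phi>\<close>.\<close>

locale monomial_hom =
  R?: monomial_local_ring R mR \<mu>R P + S?: monomial_local_ring S mS \<mu>S P
  for R :: "('a, 'c) ring_scheme" (structure) and mR \<mu>R
    and S :: "('b, 'd) ring_scheme" (structure) and mS \<mu>S and P +
  fixes \<phi> :: "'a \<Rightarrow> 'b"
  assumes hom: "\<phi> \<in> ring_hom R S"
    and hom_mu: "0 < n \<Longrightarrow> \<phi> (\<mu>R n) = \<mu>S n"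
    and nonstandard_reflect: "S.nonstandard \<subseteq> R.nonstandard"
    and noetherian: "noetherian_ring R"
begin

sublocale H: ring_hom_cring R S \<phi>
  by unfold_locales (rule hom)

definition extension :: "'a set \<Rightarrow> 'b set" where
  "extension H = Idl\<^bsub>S\<^esub> (\<phi> ` H)"

lemma image_closed: "H \<subseteq> carrier R \<Longrightarrow> \<phi> ` H \<subseteq> carrier S"
  by auto

lemma extension_ideal: "ideal H R \<Longrightarrow> ideal (extension H) S"
  unfolding extension_def by (intro S.genideal_ideal image_closed R.ideal_subset)

lemma extension_mem: "ideal H R \<Longrightarrow> h \<in> H \<Longrightarrow> \<phi> h \<in> extension H"
  unfolding extension_def using S.genideal_self[OF image_closed[OF R.ideal_subset]] by blast

lemma extension_minimal: "ideal I S \<Longrightarrow> (\<And>h. h \<in> H \<Longrightarrow> \<phi> h \<in> I) \<Longrightarrow> extension H \<subseteq> I"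
  unfolding extension_def by (rule S.genideal_minimal) auto

lemma extension_mono: "ideal H R \<Longrightarrow> ideal K R \<Longrightarrow> H \<subseteq> K \<Longrightarrow> extension H \<subseteq> extension K"
  by (rule extension_minimal[OF extension_ideal]) (auto intro: extension_mem)

lemma extension_genideal: "A \<subseteq> carrier R \<Longrightarrow> extension (Idl\<^bsub>R\<^esub> A) = Idl\<^bsub>S\<^esub> (\<phi> ` A)"
  unfolding extension_def by (rule genideal_image_genideal[OF R.ring_axioms S.ring_axioms hom])

lemma extension_tail:
  assumes "0 < n"
  shows "extension (R.tail n) = S.tail n"
proof -
  have "\<phi> ` \<mu>R ` {n..} = \<mu>S ` {n..}"
    using assms by (auto simp: hom_mu image_image)
  then show ?thesis
    unfolding R.tail_def S.tail_def by (simp add: extension_genideal R.mu_image)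
qed

lemma hom_tail: "0 < n \<Longrightarrow> x \<in> R.tail n \<Longrightarrow> \<phi> x \<in> S.tail n"
  using extension_mem[OF R.tail_ideal, of x n] by (simp add: extension_tail)

lemma hom_m: "x \<in> mR \<Longrightarrow> \<phi> x \<in> mS"
  using hom_tail[of 2] by (simp add: R.tail_two S.tail_two)

lemma extension_m: "extension mR = mS"
  using extension_tail[of 2] by (simp add: R.tail_two S.tail_two)

lemma hom_minus:
  assumes "x \<in> carrier R" "y \<in> carrier R"
  shows "\<phi> (x \<ominus> y) = \<phi> x \<ominus>\<^bsub>S\<^esub> \<phi> y"
  using assms by (simp add: a_minus_def)

lemma m_mult_extension:
  assumes "t \<in> mS" "ideal K R" "a \<in> carrier R" "\<And>c. c \<in> mR \<Longrightarrow> c \<otimes> a \<in> K"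
  shows "t \<otimes>\<^bsub>S\<^esub> \<phi> a \<in> extension K"
proof (rule S.genideal_mult_mem[OF extension_ideal[OF assms(2)], of _ "\<phi> ` mR"])
  show "t \<in> Idl\<^bsub>S\<^esub> (\<phi> ` mR)" using assms(1) extension_m by (simp add: extension_def)
  show "\<phi> ` mR \<subseteq> carrier S" by (intro image_closed R.ideal_subset R.m_ideal)
  fix y assume "y \<in> \<phi> ` mR"
  then obtain c where c: "c \<in> mR" "y = \<phi> c" by blast
  have "\<phi> (c \<otimes> a) \<in> extension K" by (rule extension_mem[OF assms(2) assms(4)[OF c(1)]])
  then show "y \<otimes>\<^bsub>S\<^esub> \<phi> a \<in> extension K" using c(2) R.m_carr[OF c(1)] assms(3) by simp
qed (use assms(3) in auto)

text \<open>For \<open>k\<close> standard, let \<open>h \<in> H \<inter> tail k\<close> have leading monomial \<open>k\<close>. Elements of the extension of \<open>H \<inter> tail k\<close> are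
\<open>t \<phi>(h) + w\<close> with \<open>w\<close> in the extension of \<open>H \<inter> tail (k + 1)\<close>. If such an element lies in
\<open>tail (k + 1)\<close> and \<open>t\<close> is a unit, the \<open>k\<close>-th monomial becomes nonstandard in \<open>S\<close>; so \<open>t \<in> mS\<close>,
and \<open>\<mm> h\<close> lies in the next tail. In the remaining cases the two intersections with \<open>H\<close> are equal.\<close>

lemma extension_inter_tail_step:
  assumes H: "ideal H R" and k: "0 < k"
  shows "extension (H \<inter> R.tail k) \<inter> S.tail (Suc k) \<subseteq> extension (H \<inter> R.tail (Suc k))"
proof (cases "k \<in> R.leading (H \<inter> R.tail k) \<and> k \<notin> R.nonstandard")
  case False
  have Hk: "ideal (H \<inter> R.tail k) R" by (rule R.i_intersect[OF H R.tail_ideal])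
  have "H \<inter> R.tail k \<subseteq> R.tail (Suc k)"
  proof (cases "k \<in> R.nonstandard")
    case True
    then show ?thesis using R.tail_nonstandard by blast
  next
    case nk: False
    show ?thesis
    proof
      fix x assume x: "x \<in> H \<inter> R.tail k"
      show "x \<in> R.tail (Suc k)" using R.reduce_step[OF Hk k x] x False nk by blast
    qed
  qed
  then have "H \<inter> R.tail k = H \<inter> R.tail (Suc k)" using R.tail_antimono[of k "Suc k"] by auto
  then show ?thesis by simp
next
  case True
  have Hk: "ideal (H \<inter> R.tail k) R" by (rule R.i_intersect[OF H R.tail_ideal])
  have Hk': "ideal (H \<inter> R.tail (Suc k)) R" by (rule R.i_intersect[OF H R.tail_ideal])
  obtain h where h: "h \<in> H" "h \<in> R.tail k" "h \<ominus> \<mu>R k \<in> R.tail (Suc k)"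
    using True by (auto simp: R.leading_def)
  have hc: "h \<in> carrier R" using h(2) by (rule R.tail_closed)
  have Hk'S: "ideal (extension (H \<inter> R.tail (Suc k))) S" by (rule extension_ideal[OF Hk'])
  have PS: "ideal (PIdl\<^bsub>S\<^esub> (\<phi> h)) S" by (rule S.cgenideal_ideal) (simp add: hc)
  define J where "J = PIdl\<^bsub>S\<^esub> (\<phi> h) <+>\<^bsub>S\<^esub> extension (H \<inter> R.tail (Suc k))"
  have J: "ideal J S" unfolding J_def by (rule S.add_ideals[OF PS Hk'S])
  have Jl: "t \<otimes>\<^bsub>S\<^esub> \<phi> h \<in> J" if "t \<in> carrier S" for t
    using S.ideal_add_left[OF PS Hk'S] that unfolding J_def cgenideal_def by blast
  have Jr: "\<phi> z \<in> J" if "z \<in> H \<inter> R.tail (Suc k)" for z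
    unfolding J_def by (rule subsetD[OF S.ideal_add_right[OF PS Hk'S] extension_mem[OF Hk' that]])
  have "extension (H \<inter> R.tail k) \<subseteq> J"
  proof (rule extension_minimal[OF J])
    fix x assume x: "x \<in> H \<inter> R.tail k"
    obtain c where c: "c \<in> carrier R" "x \<ominus> c \<otimes> h \<in> R.tail (Suc k)"
      using R.reduce_by[OF k hc h(3)] x by blast
    have xc: "x \<in> carrier R" using x R.tail_closed by blast
    have "x \<ominus> c \<otimes> h \<in> H" using x by (intro R.ideal_diff[OF H] ideal.I_l_closed[OF H h(1) c(1)]) auto
    then have "\<phi> (x \<ominus> c \<otimes> h) \<in> J" using c(2) Jr by simp
    then have "\<phi> c \<otimes>\<^bsub>S\<^esub> \<phi> h \<oplus>\<^bsub>S\<^esub> \<phi> (x \<ominus> c \<otimes> h) \<in> J"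
      using Jl[of "\<phi> c"] c(1) by (intro additive_subgroup.a_closed[OF ideal.axioms(1)[OF J]]) auto
    moreover have "c \<otimes> h \<oplus> (x \<ominus> c \<otimes> h) = x" using c(1) hc xc by algebra
    then have "\<phi> (c \<otimes> h) \<oplus>\<^bsub>S\<^esub> \<phi> (x \<ominus> c \<otimes> h) = \<phi> x"
      using c(1) hc xc by (metis H.hom_add R.m_closed R.minus_closed)
    ultimately show "\<phi> x \<in> J" using c(1) hc by simp
  qed
  show ?thesis
  proof
    fix y assume y: "y \<in> extension (H \<inter> R.tail k) \<inter> S.tail (Suc k)"
    then have "y \<in> J" using \<open>extension (H \<inter> R.tail k) \<subseteq> J\<close> by blast
    then obtain t w where tw: "t \<in> carrier S" "w \<in> extension (H \<inter> R.tail (Suc k))"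
      "y = t \<otimes>\<^bsub>S\<^esub> \<phi> h \<oplus>\<^bsub>S\<^esub> w"
      unfolding J_def S.mem_set_add cgenideal_def by blast
    have wc: "w \<in> carrier S" using ideal.Icarr[OF Hk'S tw(2)] .
    have "t \<in> mS"
    proof (rule ccontr)
      assume "t \<notin> mS"
      then have t: "t \<in> Units S" using S.notin_m_Units tw(1) by blast
      have phc: "\<phi> h \<in> carrier S" using hc by simp
      have "extension (H \<inter> R.tail (Suc k)) \<subseteq> S.tail (Suc k)"
        using extension_mono[OF Hk' R.tail_ideal[of "Suc k"]] by (simp add: extension_tail)
      then have "w \<in> S.tail (Suc k)" using tw(2) by blast
      then have "y \<ominus>\<^bsub>S\<^esub> w \<in> S.tail (Suc k)" using y by (intro S.ideal_diff[OF S.tail_ideal]) auto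
      moreover have "y \<ominus>\<^bsub>S\<^esub> w = t \<otimes>\<^bsub>S\<^esub> \<phi> h" unfolding tw(3) using tw(1) wc phc by algebra
      ultimately have "inv\<^bsub>S\<^esub> t \<otimes>\<^bsub>S\<^esub> (t \<otimes>\<^bsub>S\<^esub> \<phi> h) \<in> S.tail (Suc k)"
        using t by (auto intro!: ideal.I_l_closed[OF S.tail_ideal])
      moreover have "inv\<^bsub>S\<^esub> t \<otimes>\<^bsub>S\<^esub> (t \<otimes>\<^bsub>S\<^esub> \<phi> h) = \<phi> h"
        using t phc tw(1) by (simp add: S.m_assoc[symmetric])
      ultimately have "\<phi> h \<in> S.tail (Suc k)" by simp
      moreover have "\<phi> (h \<ominus> \<mu>R k) \<in> S.tail (Suc k)" using h(3) by (intro hom_tail) auto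
      ultimately have "\<phi> h \<ominus>\<^bsub>S\<^esub> \<phi> (h \<ominus> \<mu>R k) \<in> S.tail (Suc k)"
        by (rule S.ideal_diff[OF S.tail_ideal])
      moreover have "\<phi> h \<ominus>\<^bsub>S\<^esub> (\<phi> h \<ominus>\<^bsub>S\<^esub> \<mu>S k) = \<mu>S k"
        using phc S.mu_closed[of k] by algebra
      ultimately have "\<mu>S k \<in> S.tail (Suc k)"
        using hc k by (simp add: hom_minus hom_mu)
      then show False using True k nonstandard_reflect by (auto simp: S.nonstandard_def)
    qed
    then have "t \<otimes>\<^bsub>S\<^esub> \<phi> h \<in> extension (H \<inter> R.tail (Suc k))"
      using ideal.I_l_closed[OF H h(1)] R.m_carr R.m_mult_tail[OF _ h(2) k]
      by (intro m_mult_extension[OF _ Hk' hc]) auto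
    then show "y \<in> extension (H \<inter> R.tail (Suc k))"
      unfolding tw(3) using tw(2) by (rule additive_subgroup.a_closed[OF ideal.axioms(1)[OF Hk'S]])
  qed
qed

lemma extension_inter_tail:
  assumes H: "ideal H R"
  shows "extension H \<inter> S.tail (Suc n) \<subseteq> extension (H \<inter> R.tail (Suc n))"
proof (induction n)
  case 0
  have "H \<inter> R.tail (Suc 0) = H" using R.tail_one R.ideal_subset[OF H] by auto
  then show ?case by simp
next
  case (Suc n)
  have "S.tail (Suc (Suc n)) \<subseteq> S.tail (Suc n)" by (rule S.tail_antimono) simp
  moreover have "extension (H \<inter> R.tail (Suc n)) \<inter> S.tail (Suc (Suc n)) \<subseteq> extension (H \<inter> R.tail (Suc (Suc n)))"
    by (rule extension_inter_tail_step[OF H]) simp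
  ultimately show ?case using Suc by blast
qed

text \<open>By Krull's theorem in \<open>R\<close> it suffices to approximate \<open>g\<close> by elements of \<open>H\<close>. If the remainder
\<open>z \<in> tail n\<close> cannot be reduced by \<open>H\<close>, then \<open>H \<inter> tail n = H \<inter> tail (n + 1)\<close>, and the preceding lemma puts \<open>\<phi> z\<close>
into \<open>tail (n + 1)\<close>; since no monomial became nonstandard, \<open>z\<close> is in \<open>tail (n + 1)\<close> already.\<close>

lemma extension_contract:
  assumes H: "ideal H R" and g: "g \<in> carrier R" "\<phi> g \<in> extension H"
  shows "g \<in> H"
proof (rule R.krull_intersection[OF noetherian H g(1)])
  show "g \<in> H <+>\<^bsub>R\<^esub> R.tail (Suc n)" for n
  proof (induction n)
    case 0
    have "H <+>\<^bsub>R\<^esub> R.tail 1 \<supseteq> R.tail 1" by (rule R.ideal_add_right[OF H R.tail_ideal])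
    then show ?case using g(1) R.tail_one by auto
  next
    case (Suc n)
    let ?n = "Suc n"
    obtain h z where hz: "h \<in> H" "z \<in> R.tail ?n" "g = h \<oplus> z"
      using Suc unfolding R.mem_set_add by blast
    have c: "h \<in> carrier R" "z \<in> carrier R" using ideal.Icarr[OF H] hz R.tail_closed by auto
    have "z = g \<ominus> h" unfolding hz(3) using c by algebra
    then have "\<phi> z = \<phi> g \<ominus>\<^bsub>S\<^esub> \<phi> h" using hom_minus g(1) c(1) by simp
    then have "\<phi> z \<in> extension H"
      using S.ideal_diff[OF extension_ideal[OF H] g(2) extension_mem[OF H hz(1)]] by simp
    moreover have "\<phi> z \<in> S.tail ?n" using hz(2) by (intro hom_tail) auto
    ultimately have z: "\<phi> z \<in> extension (H \<inter> R.tail ?n)" using extension_inter_tail[OF H, of n] by blast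
    have Hn: "ideal (H \<inter> R.tail ?n) R" by (rule R.i_intersect[OF H R.tail_ideal])
    obtain k where k: "k \<in> H" "z \<ominus> k \<in> R.tail (Suc ?n)"
    proof (cases "?n \<in> R.leading H")
      case True
      then show ?thesis using R.reduce_leading[OF H _ hz(2)] that by blast
    next
      case False
      have z0: "\<zero> \<in> H" using additive_subgroup.zero_closed[OF ideal.axioms(1)[OF H]] .
      have "H \<inter> R.tail ?n \<subseteq> R.tail (Suc ?n)" using R.reduce_step[OF H, of ?n] False by blast
      then have "extension (H \<inter> R.tail ?n) \<subseteq> S.tail (Suc ?n)"
        using extension_mono[OF Hn R.tail_ideal[of "Suc ?n"]] by (simp add: extension_tail)
      then have zt: "\<phi> z \<in> S.tail (Suc ?n)" using z by blast
      have "z \<in> R.tail (Suc ?n)"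
      proof (rule ccontr)
        assume nz: "z \<notin> R.tail (Suc ?n)"
        obtain d y where d: "d \<in> carrier R" "y \<in> R.tail (Suc ?n)" "z = d \<otimes> \<mu>R ?n \<oplus> y"
          using R.tail_split[OF hz(2)] by blast
        have dm: "d \<notin> mR"
        proof
          assume "d \<in> mR"
          then have "d \<otimes> \<mu>R ?n \<in> R.tail (Suc ?n)" by (intro R.m_mult_tail R.mu_tail) auto
          then show False using nz d additive_subgroup.a_closed[OF ideal.axioms(1)[OF R.tail_ideal]] by blast
        qed
        then have du: "d \<in> Units R" using R.notin_m_Units d(1) by blast
        have pd: "\<phi> d \<in> carrier S" "\<phi> (inv d) \<in> carrier S" "\<phi> (inv d) \<otimes>\<^bsub>S\<^esub> \<phi> d = \<one>\<^bsub>S\<^esub>"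
          using du d(1) by (auto simp flip: H.hom_mult)
        have yc: "y \<in> carrier R" by (rule R.tail_closed[OF d(2)])
        have "\<phi> z \<ominus>\<^bsub>S\<^esub> \<phi> y \<in> S.tail (Suc ?n)"
          by (intro S.ideal_diff[OF S.tail_ideal zt] hom_tail d(2)) simp
        moreover have "z \<ominus> y = d \<otimes> \<mu>R ?n" unfolding d(3) using d(1) yc R.mu_closed[of ?n] by algebra
        then have "\<phi> z \<ominus>\<^bsub>S\<^esub> \<phi> y = \<phi> d \<otimes>\<^bsub>S\<^esub> \<mu>S ?n"
          using hom_minus[OF c(2) yc] d(1) by (simp add: hom_mu)
        ultimately have "\<phi> (inv d) \<otimes>\<^bsub>S\<^esub> (\<phi> d \<otimes>\<^bsub>S\<^esub> \<mu>S ?n) \<in> S.tail (Suc ?n)"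
          using ideal.I_l_closed[OF S.tail_ideal _ pd(2)] by metis
        then have "\<mu>S ?n \<in> S.tail (Suc ?n)" using pd by (simp add: S.m_assoc[symmetric])
        then have "?n \<in> R.nonstandard" using nonstandard_reflect by (auto simp: S.nonstandard_def)
        then show False using R.tail_nonstandard hz(2) nz by blast
      qed
      then show ?thesis using that[OF z0] c(2) by (simp add: a_minus_def)
    qed
    have kc: "k \<in> carrier R" using ideal.Icarr[OF H k(1)] .
    have "g = (h \<oplus> k) \<oplus> (z \<ominus> k)" unfolding hz(3) using c kc by algebra
    then show ?case
      unfolding R.mem_set_add
      using k(2) additive_subgroup.a_closed[OF ideal.axioms(1)[OF H] hz(1) k(1)] by blast
  qed
qed

text \<open>The same descent, for \<open>s\<close> in \<open>S\<close>. A remainder with unit leading coefficient \<open>t\<close> at the monomial \<open>m\<close> gives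
\<open>a m\<close> in the extension of \<open>H + a tail (n + 1)\<close>, hence in that ideal itself by contraction. This yields
\<open>m - v \<in> (H : a)\<close> with \<open>v\<close> in the next tail, and \<open>t (m - v)\<close> cancels the leading term.\<close>

lemma extension_colon:
  assumes H: "ideal H R" and a: "a \<in> carrier R" and s: "s \<in> carrier S"
    and as: "s \<otimes>\<^bsub>S\<^esub> \<phi> a \<in> extension H"
  defines "G \<equiv> {c \<in> carrier R. c \<otimes> a \<in> H}"
  shows "s \<in> extension G <+>\<^bsub>S\<^esub> S.tail (Suc n)"
proof (induction n)
  case 0
  have G: "ideal G R" unfolding G_def by (rule R.colon_ideal[OF H a])
  have "extension G <+>\<^bsub>S\<^esub> S.tail 1 \<supseteq> S.tail 1" by (rule S.ideal_add_right[OF extension_ideal[OF G] S.tail_ideal])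
  then show ?case using s S.tail_one by auto
next
  case (Suc n)
  let ?n = "Suc n"
  have G: "ideal G R" unfolding G_def by (rule R.colon_ideal[OF H a])
  have Ga: "c \<otimes> a \<in> H" if "c \<in> G" for c using that by (simp add: G_def)
  note addS = additive_subgroup.a_closed[OF ideal.axioms(1)]
  obtain g z where gz: "g \<in> extension G" "z \<in> S.tail ?n" "s = g \<oplus>\<^bsub>S\<^esub> z"
    using Suc unfolding S.mem_set_add by blast
  obtain t w where tw: "t \<in> carrier S" "w \<in> S.tail (Suc ?n)" "z = t \<otimes>\<^bsub>S\<^esub> \<mu>S ?n \<oplus>\<^bsub>S\<^esub> w"
    using S.tail_split[OF gz(2)] by blast
  have c: "g \<in> carrier S" "z \<in> carrier S" "w \<in> carrier S" "\<phi> a \<in> carrier S"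
    using ideal.Icarr[OF extension_ideal[OF G] gz(1)] S.tail_closed gz(2) tw(2) a by auto
  show ?case
  proof (cases "t \<in> mS")
    case True
    then have "t \<otimes>\<^bsub>S\<^esub> \<mu>S ?n \<in> S.tail (Suc ?n)" by (intro S.m_mult_tail S.mu_tail) auto
    then have "z \<in> S.tail (Suc ?n)" unfolding tw(3) using tw(2) by (rule addS[OF S.tail_ideal])
    then show ?thesis using gz unfolding S.mem_set_add by blast
  next
    case False
    then have t: "t \<in> Units S" using S.notin_m_Units tw(1) by blast
    define J where "J = (\<lambda>v. v \<otimes> a) ` R.tail (Suc ?n)"
    have J: "ideal J R" unfolding J_def by (rule R.image_mult_ideal[OF R.tail_ideal a])
    define K where "K = H <+>\<^bsub>R\<^esub> J"
    have K: "ideal K R" unfolding K_def by (rule R.add_ideals[OF H J])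
    have HK: "H \<subseteq> K" "J \<subseteq> K" unfolding K_def by (rule R.ideal_add_left[OF H J], rule R.ideal_add_right[OF H J])
    have extHK: "extension H \<subseteq> extension K" by (rule extension_mono[OF H K HK(1)])
    have ga: "g \<otimes>\<^bsub>S\<^esub> \<phi> a \<in> extension K"
    proof (rule S.genideal_mult_mem[OF extension_ideal[OF K] c(4) _ _ gz(1)[unfolded extension_def]])
      show "\<phi> ` G \<subseteq> carrier S" by (intro image_closed R.ideal_subset G)
      fix y assume "y \<in> \<phi> ` G"
      then obtain d where d: "d \<in> G" "y = \<phi> d" by blast
      have "\<phi> (d \<otimes> a) \<in> extension K" using extension_mem[OF K] Ga[OF d(1)] HK by blast
      then show "y \<otimes>\<^bsub>S\<^esub> \<phi> a \<in> extension K" using d(2) ideal.Icarr[OF G d(1)] a by simp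
    qed
    have wext: "w \<in> Idl\<^bsub>S\<^esub> (\<phi> ` R.tail (Suc ?n))"
      using tw(2) extension_tail[of "Suc ?n"] by (simp add: extension_def)
    have wa: "w \<otimes>\<^bsub>S\<^esub> \<phi> a \<in> extension K"
    proof (rule S.genideal_mult_mem[OF extension_ideal[OF K] c(4) _ _ wext])
      show "\<phi> ` R.tail (Suc ?n) \<subseteq> carrier S" by (intro image_closed R.ideal_subset R.tail_ideal)
      fix y assume "y \<in> \<phi> ` R.tail (Suc ?n)"
      then obtain d where d: "d \<in> R.tail (Suc ?n)" "y = \<phi> d" by blast
      have "d \<otimes> a \<in> J" unfolding J_def using d(1) by (rule imageI)
      then have "\<phi> (d \<otimes> a) \<in> extension K" using extension_mem[OF K] HK by blast
      then show "y \<otimes>\<^bsub>S\<^esub> \<phi> a \<in> extension K" using d(2) R.tail_closed[OF d(1)] a by simp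
    qed
    have ti: "inv\<^bsub>S\<^esub> t \<in> carrier S" "inv\<^bsub>S\<^esub> t \<otimes>\<^bsub>S\<^esub> t = \<one>\<^bsub>S\<^esub>" using t by auto
    have mc: "\<mu>S ?n \<in> carrier S" by simp
    have "s \<otimes>\<^bsub>S\<^esub> \<phi> a \<ominus>\<^bsub>S\<^esub> g \<otimes>\<^bsub>S\<^esub> \<phi> a \<ominus>\<^bsub>S\<^esub> w \<otimes>\<^bsub>S\<^esub> \<phi> a \<in> extension K"
      using as extHK ga wa by (intro S.ideal_diff[OF extension_ideal[OF K]]) auto
    moreover have "s \<otimes>\<^bsub>S\<^esub> \<phi> a \<ominus>\<^bsub>S\<^esub> g \<otimes>\<^bsub>S\<^esub> \<phi> a \<ominus>\<^bsub>S\<^esub> w \<otimes>\<^bsub>S\<^esub> \<phi> a = t \<otimes>\<^bsub>S\<^esub> (\<mu>S ?n \<otimes>\<^bsub>S\<^esub> \<phi> a)"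
      unfolding gz(3) tw(3) using c tw(1) mc by algebra
    ultimately have "inv\<^bsub>S\<^esub> t \<otimes>\<^bsub>S\<^esub> (t \<otimes>\<^bsub>S\<^esub> (\<mu>S ?n \<otimes>\<^bsub>S\<^esub> \<phi> a)) \<in> extension K"
      using ideal.I_l_closed[OF extension_ideal[OF K] _ ti(1)] by metis
    moreover have "inv\<^bsub>S\<^esub> t \<otimes>\<^bsub>S\<^esub> (t \<otimes>\<^bsub>S\<^esub> (\<mu>S ?n \<otimes>\<^bsub>S\<^esub> \<phi> a)) = \<mu>S ?n \<otimes>\<^bsub>S\<^esub> \<phi> a"
      using ti tw(1) mc c(4) by (simp add: S.m_assoc[symmetric])
    ultimately have "\<phi> (\<mu>R ?n \<otimes> a) \<in> extension K" using a by (simp add: hom_mu)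
    then have "\<mu>R ?n \<otimes> a \<in> K" using a by (intro extension_contract[OF K]) auto
    then obtain h v where hv: "h \<in> H" "v \<in> R.tail (Suc ?n)" "\<mu>R ?n \<otimes> a = h \<oplus> v \<otimes> a"
      unfolding K_def J_def R.mem_set_add by blast
    have vc: "v \<in> carrier R" "h \<in> carrier R" using R.tail_closed[OF hv(2)] ideal.Icarr[OF H hv(1)] by auto
    have "(\<mu>R ?n \<ominus> v) \<otimes> a = \<mu>R ?n \<otimes> a \<ominus> v \<otimes> a" using vc a R.mu_closed[of ?n] by algebra
    also have "\<dots> = h" unfolding hv(3) using vc a by algebra
    finally have uG: "\<mu>R ?n \<ominus> v \<in> G" using hv(1) vc by (simp add: G_def)
    have "t \<otimes>\<^bsub>S\<^esub> \<phi> (\<mu>R ?n \<ominus> v) \<in> extension G"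
      by (rule ideal.I_l_closed[OF extension_ideal[OF G] extension_mem[OF G uG] tw(1)])
    then have 1: "g \<oplus>\<^bsub>S\<^esub> t \<otimes>\<^bsub>S\<^esub> \<phi> (\<mu>R ?n \<ominus> v) \<in> extension G" using gz(1) by (intro addS[OF extension_ideal[OF G]])
    have "t \<otimes>\<^bsub>S\<^esub> \<phi> v \<in> S.tail (Suc ?n)"
      using hv(2) tw(1) by (intro ideal.I_l_closed[OF S.tail_ideal] hom_tail) auto
    then have 2: "t \<otimes>\<^bsub>S\<^esub> \<phi> v \<oplus>\<^bsub>S\<^esub> w \<in> S.tail (Suc ?n)" using tw(2) by (intro addS[OF S.tail_ideal])
    have vS: "\<phi> v \<in> carrier S" using vc by simp
    have "s = (g \<oplus>\<^bsub>S\<^esub> t \<otimes>\<^bsub>S\<^esub> (\<mu>S ?n \<ominus>\<^bsub>S\<^esub> \<phi> v)) \<oplus>\<^bsub>S\<^esub> (t \<otimes>\<^bsub>S\<^esub> \<phi> v \<oplus>\<^bsub>S\<^esub> w)"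
      unfolding gz(3) tw(3) using c(1,3) tw(1) mc vS by algebra
    moreover have "\<phi> (\<mu>R ?n \<ominus> v) = \<mu>S ?n \<ominus>\<^bsub>S\<^esub> \<phi> v" using vc by (simp add: hom_minus hom_mu)
    ultimately show ?thesis unfolding S.mem_set_add using 1 2 by metis
  qed
qed

end

section \<open>Closed ideals and Noetherian rings\<close>

context monomial_local_ring
begin

text \<open>Dickson's lemma selects finitely many elements of \<open>J\<close> whose leading monomials divide all leading
monomials of \<open>J\<close>. Reduction by these elements approximates every element of \<open>J\<close> to any order, and
closedness makes the approximation exact.\<close>

lemma noetherian_if_ideals_closed:
  assumes closed: "\<And>A y. \<lbrakk>finite A; A \<subseteq> carrier R; y \<in> carrier R;
      \<And>n. y \<in> Idl A <+>\<^bsub>R\<^esub> tail (Suc n)\<rbrakk> \<Longrightarrow> y \<in> Idl A"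
  shows "noetherian_ring R"
proof (rule noetherian_ringI)
  fix J assume J: "ideal J R"
  \<comment> \<open>Indices with a prime factor outside \<open>P\<close> belong to zero monomials and are leading for every ideal.\<close>
  define T where "T = {n \<in> leading J. \<forall>p. Factorial_Ring.prime p \<longrightarrow> p dvd n \<longrightarrow> p \<in> P}"
  have "0 \<notin> T" by (simp add: T_def leading_def)
  moreover have "p \<in> P" if "n \<in> T" "Factorial_Ring.prime p" "p dvd n" for n p
    using that by (simp add: T_def)
  ultimately obtain B where B: "finite B" "B \<subseteq> T" "\<And>n. n \<in> T \<Longrightarrow> \<exists>b\<in>B. b dvd n"
    using dickson[of P T] finite_P prime_P by metis
  have "\<exists>j\<in>J. j \<ominus> \<mu> b \<in> tail (Suc b)" if "b \<in> B" for b
    using B(2) that by (auto simp: T_def leading_def)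
  then obtain j where j: "\<And>b. b \<in> B \<Longrightarrow> j b \<in> J" "\<And>b. b \<in> B \<Longrightarrow> j b \<ominus> \<mu> b \<in> tail (Suc b)"
    by metis
  define A where "A = j ` B"
  have A: "finite A" "A \<subseteq> J" "A \<subseteq> carrier R"
    using B(1) j(1) ideal_subset[OF J] by (auto simp: A_def)
  have K: "ideal (Idl A) R" by (rule genideal_ideal[OF A(3)])
  have KJ: "Idl A \<subseteq> J" by (rule genideal_minimal[OF J A(2)])
  have AK: "A \<subseteq> Idl A" by (rule genideal_self[OF A(3)])
  have lead: "n \<in> leading (Idl A)" if n: "n \<in> leading J" for n
  proof (cases "n \<in> T")
    case True
    then obtain b l where b: "b \<in> B" "n = b * l" using B(3) by blast
    have n0: "0 < n" using n by (simp add: leading_def)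
    have "j b \<in> Idl A" using AK b(1) by (auto simp: A_def)
    then have "b \<in> leading (Idl A)" using j(2)[OF b(1)] n0 b(2) by (auto simp: leading_def)
    then show ?thesis unfolding b(2) using n0 b(2) by (intro leading_mult[OF K]) auto
  next
    case False
    then obtain p where "Factorial_Ring.prime p" "p dvd n" "p \<notin> P" using n by (auto simp: T_def)
    then show ?thesis using n by (intro leading_of_prime_dvd[OF K]) (auto simp: leading_def)
  qed
  have "J \<subseteq> Idl A"
  proof
    fix y assume y: "y \<in> J"
    have yc: "y \<in> carrier R" using ideal.Icarr[OF J y] .
    show "y \<in> Idl A"
    proof (rule closed[OF A(1,3) yc])
      show "y \<in> Idl A <+>\<^bsub>R\<^esub> tail (Suc n)" for n
      proof (induction n)
        case 0
        show ?case using ideal_add_right[OF K tail_ideal, of 1] yc tail_one by auto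
      next
        case (Suc n)
        obtain k z where kz: "k \<in> Idl A" "z \<in> tail (Suc n)" "y = k \<oplus> z"
          using Suc unfolding mem_set_add by blast
        have kc: "k \<in> carrier R" "z \<in> carrier R" using ideal.Icarr[OF K kz(1)] tail_closed[OF kz(2)] by auto
        have "z = y \<ominus> k" unfolding kz(3) using kc by algebra
        then have zJ: "z \<in> J" using ideal_diff[OF J y] KJ kz(1) by auto
        obtain k' where k': "k' \<in> Idl A" "z \<ominus> k' \<in> tail (Suc (Suc n))"
        proof (cases "z \<in> tail (Suc (Suc n))")
          case True
          then show ?thesis using that[of \<zero>] kc(2) additive_subgroup.zero_closed[OF ideal.axioms(1)[OF K]]
            by (simp add: a_minus_def)
        next
          case False
          then have "Suc n \<in> leading J" using reduce_step[OF J _ zJ kz(2)] by blast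
          then show ?thesis using reduce_leading[OF K lead kz(2)] that by blast
        qed
        have k'c: "k' \<in> carrier R" using ideal.Icarr[OF K k'(1)] .
        have "y = (k \<oplus> k') \<oplus> (z \<ominus> k')" unfolding kz(3) using kc k'c by algebra
        then show ?case unfolding mem_set_add
          using k'(2) additive_subgroup.a_closed[OF ideal.axioms(1)[OF K] kz(1) k'(1)] by blast
      qed
    qed
  qed
  then show "\<exists>A\<subseteq>carrier R. finite A \<and> J = Idl A" using A KJ by blast
qed

lemma maximalideal_m: "maximalideal \<mm> R"
proof (rule maximalidealI[OF m_ideal])
  show "carrier R \<noteq> \<mm>" using one_notin_m by auto
  fix J assume J: "ideal J R" "\<mm> \<subseteq> J" "J \<subseteq> carrier R"
  show "J = \<mm> \<or> J = carrier R"
  proof (cases "J \<subseteq> \<mm>")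
    case False
    then obtain c where c: "c \<in> J" "c \<notin> \<mm>" by blast
    then have "c \<in> Units R" using J(3) notin_m_Units by blast
    then have "\<one> \<in> J" using ideal.I_l_closed[OF J(1) c(1), of "inv c"] by simp
    then show ?thesis using ideal.one_imp_carrier[OF J(1)] by blast
  qed (use J in auto)
qed

lemma proper_ideal_le_m:
  assumes "ideal J R" "J \<noteq> carrier R"
  shows "J \<subseteq> \<mm>"
proof
  fix c assume c: "c \<in> J"
  show "c \<in> \<mm>"
  proof (rule ccontr)
    assume "c \<notin> \<mm>"
    then have "c \<in> Units R" using ideal.Icarr[OF assms(1) c] notin_m_Units by blast
    then have "\<one> \<in> J" using ideal.I_l_closed[OF assms(1) c, of "inv c"] by simp
    then show False using ideal.one_imp_carrier[OF assms(1)] assms(2) by blast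
  qed
qed

lemma maximalideal_unique: "maximalideal M R \<Longrightarrow> M = \<mm>"
  using proper_ideal_le_m[of M] maximalideal.I_notcarr[of M R] maximalideal.I_maximal[of M R \<mm>]
    m_ideal ideal_subset[OF m_ideal] one_notin_m maximalideal.axioms(1)[of M R] by (metis one_closed)

lemma local_ring: "local_ring R"
  by (unfold_locales) (use maximalideal_m maximalideal_unique in blast)

lemma max_ideal_eq: "max_ideal R = \<mm>"
  unfolding max_ideal_def using maximalideal_m maximalideal_unique by (rule the_equality)

end

section \<open>Regular sequences and chains of primes\<close>

context cring
begin

lemma nonzerodivisor_quot_iff:
  assumes I: "ideal I R" and x: "x \<in> carrier R"
  shows "nonzerodivisor (R Quot I) (I +> x) \<longleftrightarrow> (\<forall>z\<in>carrier R. z \<otimes> x \<in> I \<longrightarrow> z \<in> I)"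
proof -
  interpret I: ideal I R by fact
  have carr: "carrier (R Quot I) = (\<lambda>z. I +> z) ` carrier R"
    by (auto simp: FactRing_def A_RCOSETS_def' )
  have zero: "\<zero>\<^bsub>R Quot I\<^esub> = I" by (simp add: FactRing_def)
  have eq: "I +> z = I \<longleftrightarrow> z \<in> I" if "z \<in> carrier R" for z
    using that I.a_rcos_const I.a_rcos_self by blast
  have mult: "(I +> x) \<otimes>\<^bsub>R Quot I\<^esub> (I +> z) = I +> (z \<otimes> x)" if "z \<in> carrier R" for z
    using that x I.rcoset_mult_add[of x z] by (simp add: FactRing_def m_comm)
  show ?thesis unfolding nonzerodivisor_def carr zero using x eq mult by auto
qed

lemma regular_sequence_iff:
  assumes "set xs \<subseteq> carrier R"
  shows "regular_sequence R xs \<longleftrightarrow>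
    (\<forall>i<length xs. \<forall>z\<in>carrier R. z \<otimes> xs ! i \<in> Idl (set (take i xs)) \<longrightarrow> z \<in> Idl (set (take i xs))) \<and>
    Idl (set xs) \<noteq> carrier R"
proof -
  have "nonzerodivisor (R Quot (Idl (set (take i xs)))) (Idl (set (take i xs)) +> xs ! i) \<longleftrightarrow>
    (\<forall>z\<in>carrier R. z \<otimes> xs ! i \<in> Idl (set (take i xs)) \<longrightarrow> z \<in> Idl (set (take i xs)))"
    if "i < length xs" for i
    using that assms set_take_subset[of i xs] by (intro nonzerodivisor_quot_iff genideal_ideal) auto
  then show ?thesis unfolding regular_sequence_def using assms by auto
qed

text \<open>No element \<open>t x\<^sup>n\<close> with \<open>t \<notin> Pr\<close> lies in \<open>I\<close>, because \<open>x\<close> can be cancelled modulo \<open>I\<close>. These elements form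
a multiplicative set, so an ideal maximal among those that contain \<open>I\<close> and avoid it is prime; it is
contained in \<open>Pr\<close> (take \<open>n = 0\<close>) and does not contain \<open>x\<close> (take \<open>t = \<one>\<close>).\<close>

lemma smaller_prime:
  assumes Pr: "primeideal Pr R" and I: "ideal I R" "I \<subseteq> Pr" and x: "x \<in> Pr"
    and reg: "\<And>z. \<lbrakk>z \<in> carrier R; z \<otimes> x \<in> I\<rbrakk> \<Longrightarrow> z \<in> I"
  obtains Q where "primeideal Q R" "I \<subseteq> Q" "Q \<subset> Pr"
proof -
  interpret Pr: primeideal Pr R by fact
  have xc: "x \<in> carrier R" using x Pr.Icarr by blast
  have one: "\<one> \<notin> Pr" using Pr.one_imp_carrier Pr.I_notcarr by blast
  define T where "T = {t \<otimes> x [^] n | t n. t \<in> carrier R \<and> t \<notin> Pr \<and> (n::nat) \<in> UNIV}"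
  have TI: "t \<in> Pr" if "t \<in> carrier R" "t \<otimes> x [^] (n::nat) \<in> I" for t n
    using that
  proof (induction n)
    case 0
    then show ?case using I(2) by auto
  next
    case (Suc n)
    have "(t \<otimes> x [^] n) \<otimes> x \<in> I" using Suc.prems xc by (simp add: m_assoc)
    then have "t \<otimes> x [^] n \<in> I" using reg Suc.prems(1) xc by simp
    then show ?case using Suc by blast
  qed
  have "I \<inter> T = {}" using TI by (auto simp: T_def)
  then obtain Q where Q: "ideal Q R" "I \<subseteq> Q" "Q \<inter> T = {}"
    and max: "\<And>Y. \<lbrakk>ideal Y R; Q \<subseteq> Y; Y \<inter> T = {}\<rbrakk> \<Longrightarrow> Y = Q"
    using ideal_maximal_avoiding[OF I(1)] by metis
  have T1: "t \<in> T" if "t \<in> carrier R" "t \<notin> Pr" for t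
    unfolding T_def using that by (auto intro!: exI[of _ t] exI[of _ 0])
  have T2: "x \<in> T"
    unfolding T_def using xc one by (auto intro!: exI[of _ \<one>] exI[of _ 1])
  have meets: "\<exists>q\<in>Q. \<exists>r\<in>carrier R. \<exists>t n. t \<in> carrier R \<and> t \<notin> Pr \<and> q \<oplus> r \<otimes> a = t \<otimes> x [^] (n::nat)"
    if a: "a \<in> carrier R" "a \<notin> Q" for a
  proof -
    have pa: "ideal (PIdl a) R" by (rule cgenideal_ideal[OF a(1)])
    let ?Y = "Q <+>\<^bsub>R\<^esub> PIdl a"
    have Y: "ideal ?Y R" "Q \<subseteq> ?Y" "PIdl a \<subseteq> ?Y"
      using add_ideals[OF Q(1) pa] ideal_add_left[OF Q(1) pa] ideal_add_right[OF Q(1) pa] by auto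
    have "a \<in> ?Y" using Y(3) cgenideal_self[OF a(1)] by blast
    then have "?Y \<inter> T \<noteq> {}" using max[OF Y(1,2)] a(2) by blast
    then obtain y where "y \<in> ?Y" "y \<in> T" by blast
    moreover from this obtain q r where "q \<in> Q" "r \<in> carrier R" "y = q \<oplus> r \<otimes> a"
      unfolding mem_set_add cgenideal_def by blast
    moreover from \<open>y \<in> T\<close> obtain t n where "t \<in> carrier R" "t \<notin> Pr" "y = t \<otimes> x [^] (n::nat)"
      unfolding T_def by blast
    ultimately show ?thesis by metis
  qed
  have "primeideal Q R"
  proof (rule primeidealI[OF Q(1) is_cring])
    show "carrier R \<noteq> Q" using Q(3) T1[OF one_closed one] by blast
    fix a b assume a: "a \<in> carrier R" and b: "b \<in> carrier R" and ab: "a \<otimes> b \<in> Q"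
    show "a \<in> Q \<or> b \<in> Q"
    proof (rule ccontr)
      assume "\<not> ?thesis"
      then have "a \<notin> Q" "b \<notin> Q" by auto
      obtain q r t n where 1: "q \<in> Q" "r \<in> carrier R" "t \<in> carrier R" "t \<notin> Pr" "q \<oplus> r \<otimes> a = t \<otimes> x [^] (n::nat)"
        using meets[OF a \<open>a \<notin> Q\<close>] by metis
      obtain q' r' t' n' where 2: "q' \<in> Q" "r' \<in> carrier R" "t' \<in> carrier R" "t' \<notin> Pr" "q' \<oplus> r' \<otimes> b = t' \<otimes> x [^] (n'::nat)"
        using meets[OF b \<open>b \<notin> Q\<close>] by metis
      have qc: "q \<in> carrier R" "q' \<in> carrier R" using 1(1) 2(1) ideal.Icarr[OF Q(1)] by auto
      have xn: "x [^] n \<in> carrier R" "x [^] n' \<in> carrier R" using xc by auto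
      have "(t \<otimes> t') \<otimes> x [^] (n + n') = (t \<otimes> x [^] n) \<otimes> (t' \<otimes> x [^] n')"
        unfolding nat_pow_mult[OF xc, symmetric] using 1(3) 2(3) xn by algebra
      also have "\<dots> = (q \<oplus> r \<otimes> a) \<otimes> (q' \<oplus> r' \<otimes> b)" by (simp only: 1(5) 2(5))
      also have "\<dots> = ((q' \<oplus> r' \<otimes> b) \<otimes> q \<oplus> (r \<otimes> a) \<otimes> q') \<oplus> (r \<otimes> r') \<otimes> (a \<otimes> b)"
        using qc 1(2) 2(2) a b by algebra
      also have "\<dots> \<in> Q"
        using qc 1(2) 2(2) a b
        by (intro additive_subgroup.a_closed[OF ideal.axioms(1)[OF Q(1)]] ideal.I_l_closed[OF Q(1)] 1(1) 2(1) ab) auto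
      finally have "(t \<otimes> t') \<otimes> x [^] (n + n') \<in> Q" .
      moreover have "t \<otimes> t' \<notin> Pr" using Pr.I_prime 1(3,4) 2(3,4) by blast
      then have "(t \<otimes> t') \<otimes> x [^] (n + n') \<in> T" unfolding T_def using 1(3) 2(3) by blast
      ultimately show False using Q(3) by blast
    qed
  qed
  moreover have "Q \<subset> Pr" using T1 T2 Q(3) x ideal_subset[OF Q(1)] by blast
  ultimately show ?thesis using that Q(2) by blast
qed

text \<open>Each element of the sequence allows a descent to a strictly smaller prime, which still contains the preceding elements.\<close>

lemma regular_sequence_prime_chain:
  assumes xs: "regular_sequence R xs" and n: "n \<le> length xs"
    and Pr: "primeideal Pr R" "set (take n xs) \<subseteq> Pr"
  shows "\<exists>Ps. length Ps = Suc n \<and> sorted_wrt (\<subset>) Ps \<and> (\<forall>Q\<in>set Ps. primeideal Q R \<and> Q \<subseteq> Pr)"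
  using n Pr
proof (induction n arbitrary: Pr)
  case 0
  then show ?case by (intro exI[of _ "[Pr]"]) simp
next
  case (Suc n)
  have xc: "set xs \<subseteq> carrier R" using xs by (simp add: regular_sequence_def)
  have n: "n < length xs" using Suc.prems by simp
  have tk: "set (take (Suc n) xs) = insert (xs ! n) (set (take n xs))"
    using n by (simp add: take_Suc_conv_app_nth)
  have tc: "set (take n xs) \<subseteq> carrier R" using xc set_take_subset[of n xs] by blast
  have I: "ideal (Idl (set (take n xs))) R" by (rule genideal_ideal[OF tc])
  have IP: "Idl (set (take n xs)) \<subseteq> Pr"
    using Suc.prems(3) tk by (intro genideal_minimal primeideal.axioms(1) Suc.prems) auto
  have reg: "z \<in> Idl (set (take n xs))" if "z \<in> carrier R" "z \<otimes> xs ! n \<in> Idl (set (take n xs))" for z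
    using xs that n unfolding regular_sequence_iff[OF xc] by blast
  obtain Q where Q: "primeideal Q R" "Idl (set (take n xs)) \<subseteq> Q" "Q \<subset> Pr"
    using smaller_prime[OF Suc.prems(2) I IP _ reg] Suc.prems(3) tk by auto
  have "set (take n xs) \<subseteq> Q" using Q(2) genideal_self[OF tc] by blast
  then obtain Ps where Ps: "length Ps = Suc n" "sorted_wrt (\<subset>) Ps" "\<forall>Q'\<in>set Ps. primeideal Q' R \<and> Q' \<subseteq> Q"
    using Suc.IH[OF _ Q(1)] n by auto
  show ?case
  proof (intro exI[of _ "Ps @ [Pr]"] conjI ballI)
    show "sorted_wrt (\<subset>) (Ps @ [Pr])" using Ps(2,3) Q(3) by (auto simp: sorted_wrt_append)
    fix Q' assume "Q' \<in> set (Ps @ [Pr])"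
    then consider "Q' \<in> set Ps" | "Q' = Pr" by auto
    then show "primeideal Q' R" "Q' \<subseteq> Pr"
      using Ps(3) Q(3) Suc.prems(2) by (cases, blast, simp)+
  qed (use Ps(1) in simp)
qed

lemma regular_sequence_le_krull_dim:
  assumes xs: "regular_sequence R xs" and M: "maximalideal M R" "set xs \<subseteq> M"
  shows "enat (length xs) \<le> krull_dim R"
proof -
  obtain Ps where Ps: "length Ps = Suc (length xs)" "sorted_wrt (\<subset>) Ps" "\<forall>Q\<in>set Ps. primeideal Q R"
    using regular_sequence_prime_chain[OF xs order_refl maximalideal_prime[OF M(1)]] M(2) by auto
  then show ?thesis unfolding krull_dim_def by (intro SUP_upper2[of Ps]) auto
qed

end

section \<open>Cohen--Macaulay rings by approximation\<close>

context monomial_hom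
begin

text \<open>Regularity of \<open>x\<close> modulo \<open>H\<close> is the equation \<open>H : x = H\<close>, which is preserved by the extension.\<close>

lemma regular_sequence_image:
  assumes closed: "\<And>A y. \<lbrakk>finite A; A \<subseteq> carrier S; y \<in> carrier S;
      \<And>n. y \<in> Idl\<^bsub>S\<^esub> A <+>\<^bsub>S\<^esub> S.tail (Suc n)\<rbrakk> \<Longrightarrow> y \<in> Idl\<^bsub>S\<^esub> A"
    and xs: "regular_sequence R xs" "set xs \<subseteq> mR"
  shows "regular_sequence S (map \<phi> xs)" "set (map \<phi> xs) \<subseteq> mS"
proof -
  have xc: "set xs \<subseteq> carrier R" using xs(1) by (simp add: regular_sequence_def)
  show m: "set (map \<phi> xs) \<subseteq> mS" using xs(2) hom_m by auto
  have pxc: "set (map \<phi> xs) \<subseteq> carrier S" using xc by auto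
  have "Idl\<^bsub>S\<^esub> (set (map \<phi> xs)) \<subseteq> mS" by (rule S.genideal_minimal[OF S.m_ideal m])
  then have "Idl\<^bsub>S\<^esub> (set (map \<phi> xs)) \<noteq> carrier S" using S.one_notin_m by auto
  moreover have "s \<in> Idl\<^bsub>S\<^esub> (set (take i (map \<phi> xs)))"
    if i: "i < length xs" and s: "s \<in> carrier S"
      and sx: "s \<otimes>\<^bsub>S\<^esub> map \<phi> xs ! i \<in> Idl\<^bsub>S\<^esub> (set (take i (map \<phi> xs)))" for i s
  proof -
    define H where "H = Idl\<^bsub>R\<^esub> (set (take i xs))"
    have tc: "set (take i xs) \<subseteq> carrier R" using xc set_take_subset[of i xs] by blast
    have H: "ideal H R" unfolding H_def by (rule R.genideal_ideal[OF tc])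
    have eH: "Idl\<^bsub>S\<^esub> (set (take i (map \<phi> xs))) = extension H"
      unfolding H_def extension_genideal[OF tc] by (simp add: take_map)
    have a: "xs ! i \<in> carrier R" using xc i by auto
    have "{c \<in> carrier R. c \<otimes> xs ! i \<in> H} = H"
      using xs(1) i R.ideal_subset[OF H] ideal.I_r_closed[OF H _ a]
      unfolding R.regular_sequence_iff[OF xc] H_def by blast
    then have "s \<in> extension H <+>\<^bsub>S\<^esub> S.tail (Suc n)" for n
      using extension_colon[OF H a s, of n] sx i by (simp add: eH)
    then show ?thesis using closed[OF _ _ s, of "set (take i (map \<phi> xs))"] pxc set_take_subset[of i "map \<phi> xs"]
      unfolding eH by blast
  qed
  ultimately show "regular_sequence S (map \<phi> xs)"
    unfolding S.regular_sequence_iff[OF pxc] by auto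
qed

lemma prime_vimage:
  assumes "primeideal Q S"
  shows "primeideal {r \<in> carrier R. \<phi> r \<in> Q} R"
proof -
  interpret Q: primeideal Q S by fact
  show ?thesis
  proof (rule primeidealI)
    show "ideal {r \<in> carrier R. \<phi> r \<in> Q} R" 
      by (rule ring_hom_ring.ideal_vimage[OF ring_hom_ringI2[OF R.ring_axioms S.ring_axioms hom] Q.is_ideal])
    show "cring R" by (rule R.is_cring)
    have "\<one>\<^bsub>S\<^esub> \<notin> Q" using Q.one_imp_carrier Q.I_notcarr by blast
    then show "carrier R \<noteq> {r \<in> carrier R. \<phi> r \<in> Q}" using H.hom_one R.one_closed by force
    fix a b assume "a \<in> carrier R" "b \<in> carrier R" "a \<otimes> b \<in> {r \<in> carrier R. \<phi> r \<in> Q}"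
    then show "a \<in> {r \<in> carrier R. \<phi> r \<in> Q} \<or> b \<in> {r \<in> carrier R. \<phi> r \<in> Q}"
      using Q.I_prime[of "\<phi> a" "\<phi> b"] by auto
  qed
qed

end

text \<open>Closedness of finitely generated ideals and inequalities between lengths of chains involve only
finitely many elements of \<open>S\<close> at a time, so they can be checked in the rings \<open>R\<close>. A chain of primes in \<open>S\<close> stays strict in \<open>R\<close> as soon as the image of \<open>R\<close> contains elements that separate its members.\<close>

theorem cohen_macaulay_by_approximation:
  fixes S :: "('b, 'd) ring_scheme"
  assumes "monomial_local_ring S mS \<mu>S P"
    and approx: "\<And>A. \<lbrakk>finite A; A \<subseteq> carrier S\<rbrakk> \<Longrightarrow>
      \<exists>(R :: ('a, 'c) ring_scheme) mR \<mu>R \<phi>. monomial_hom R mR \<mu>R S mS \<mu>S P \<phi> \<and>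
        A \<subseteq> \<phi> ` carrier R \<and> depth R = krull_dim R"
  shows "cohen_macaulay_local_ring S"
proof -
  interpret S: monomial_local_ring S mS \<mu>S P by fact
  have closed: "y \<in> Idl\<^bsub>S\<^esub> A"
    if A: "finite A" "A \<subseteq> carrier S" and y: "y \<in> carrier S" "\<And>n. y \<in> Idl\<^bsub>S\<^esub> A <+>\<^bsub>S\<^esub> S.tail (Suc n)"
    for A y
  proof -
    obtain R :: "('a, 'c) ring_scheme" and mR \<mu>R \<phi>
      where mh: "monomial_hom R mR \<mu>R S mS \<mu>S P \<phi>" and sub: "insert y A \<subseteq> \<phi> ` carrier R"
      using approx[of "insert y A"] A y(1) by blast
    interpret mh: monomial_hom R mR \<mu>R S mS \<mu>S P \<phi> by (rule mh)
    obtain y' where y': "y' \<in> carrier R" "y = \<phi> y'" using sub by blast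
    obtain A' where A': "A' \<subseteq> carrier R" "A = \<phi> ` A'" using sub by (meson insert_subset subset_imageE)
    define H where "H = Idl\<^bsub>R\<^esub> A'"
    have H: "ideal H R" unfolding H_def by (rule mh.R.genideal_ideal[OF A'(1)])
    have eH: "mh.extension H = Idl\<^bsub>S\<^esub> A" unfolding H_def mh.extension_genideal[OF A'(1)] A'(2) ..
    have "y' \<in> H"
    proof (rule mh.R.krull_intersection[OF mh.noetherian H y'(1)])
      fix n
      have t: "ideal (mh.R.tail (Suc n)) R" by (rule mh.R.tail_ideal)
      have K: "ideal (H <+>\<^bsub>R\<^esub> mh.R.tail (Suc n)) R" by (rule mh.R.add_ideals[OF H t])
      have "mh.extension H \<subseteq> mh.extension (H <+>\<^bsub>R\<^esub> mh.R.tail (Suc n))"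
        by (rule mh.extension_mono[OF H K mh.R.ideal_add_left[OF H t]])
      moreover have "S.tail (Suc n) \<subseteq> mh.extension (H <+>\<^bsub>R\<^esub> mh.R.tail (Suc n))"
        using mh.extension_mono[OF t K mh.R.ideal_add_right[OF H t]] mh.extension_tail[of "Suc n"] by simp
      ultimately have "mh.extension H <+>\<^bsub>S\<^esub> S.tail (Suc n) \<subseteq> mh.extension (H <+>\<^bsub>R\<^esub> mh.R.tail (Suc n))"
        by (intro S.ideal_add_minimal mh.extension_ideal H K S.tail_ideal)
      then have "\<phi> y' \<in> mh.extension (H <+>\<^bsub>R\<^esub> mh.R.tail (Suc n))" using y(2)[of n] y'(2) eH by auto
      then show "y' \<in> H <+>\<^bsub>R\<^esub> mh.R.tail (Suc n)" by (rule mh.extension_contract[OF K y'(1)])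
    qed
    then show ?thesis using mh.extension_mem[OF H] y'(2) eH by metis
  qed
  have "depth S \<le> krull_dim S"
    unfolding depth_def grade_def S.max_ideal_eq
    by (rule SUP_least) (auto intro: S.regular_sequence_le_krull_dim S.maximalideal_m)
  moreover have "krull_dim S \<le> depth S"
    unfolding krull_dim_def
  proof (rule SUP_least)
    fix Ps assume "Ps \<in> {Ps. Ps \<noteq> [] \<and> sorted_wrt (\<subset>) Ps \<and> (\<forall>Q\<in>set Ps. primeideal Q S)}"
    then have Ps: "Ps \<noteq> []" "sorted_wrt (\<subset>) Ps" "\<And>Q. Q \<in> set Ps \<Longrightarrow> primeideal Q S" by auto
    show "enat (length Ps - 1) \<le> depth S"
    proof (cases "length Ps - 1")
      case (Suc n)
      have less: "Ps ! i \<subset> Ps ! j" if "i < j" "j < length Ps" for i j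
        using Ps(2) that by (simp add: sorted_wrt_iff_nth_less)
      have "\<exists>s. s \<in> Ps ! Suc i \<and> s \<notin> Ps ! i" if "i < Suc n" for i
      proof -
        have "Suc i < length Ps" using that Suc by simp
        then have "Ps ! i \<subset> Ps ! Suc i" using less[of i "Suc i"] by simp
        then show ?thesis by blast
      qed
      then obtain s where s: "\<And>i. i < Suc n \<Longrightarrow> s i \<in> Ps ! Suc i \<and> s i \<notin> Ps ! i" by metis
      have Pc: "Ps ! i \<subseteq> carrier S" if "i < length Ps" for i
        using S.ideal_subset[OF primeideal.axioms(1)[OF Ps(3)[OF nth_mem[OF that]]]] .
      have "s i \<in> carrier S" if i: "i < Suc n" for i
      proof -
        have "Suc i < length Ps" using i Suc by simp
        then show ?thesis using Pc s[OF i] by blast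
      qed
      then have "s ` {..<Suc n} \<subseteq> carrier S" by auto
      then obtain R :: "('a, 'c) ring_scheme" and mR \<mu>R \<phi>
        where mh: "monomial_hom R mR \<mu>R S mS \<mu>S P \<phi>" and sub: "s ` {..<Suc n} \<subseteq> \<phi> ` carrier R"
          and CM: "depth R = krull_dim R"
        using approx[of "s ` {..<Suc n}"] by blast
      interpret mh: monomial_hom R mR \<mu>R S mS \<mu>S P \<phi> by (rule mh)
      define Qs where "Qs = map (\<lambda>Q. {r \<in> carrier R. \<phi> r \<in> Q}) Ps"
      have "sorted_wrt (\<subset>) Qs"
        unfolding sorted_wrt_iff_nth_less
      proof (intro allI impI)
        fix i j assume ij: "i < j" "j < length Qs"
        then have ij': "i < j" "j < length Ps" by (auto simp: Qs_def)
        then have i: "i < Suc n" using Suc by simp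
        obtain r where r: "r \<in> carrier R" "\<phi> r = s i" using sub i by (metis image_eqI imageE lessThan_iff subsetD)
        have "Ps ! Suc i \<subseteq> Ps ! j" using less[of "Suc i" j] ij' by (cases "Suc i = j") auto
        then have "s i \<in> Ps ! j" "s i \<notin> Ps ! i" using s[OF i] by auto
        then have "r \<in> Qs ! j" "r \<notin> Qs ! i" using r ij' by (auto simp: Qs_def)
        moreover have "Qs ! i \<subseteq> Qs ! j" using less[OF ij'] ij' by (auto simp: Qs_def)
        ultimately show "Qs ! i \<subset> Qs ! j" by blast
      qed
      moreover have "\<forall>Q\<in>set Qs. primeideal Q R" using Ps(3) mh.prime_vimage by (auto simp: Qs_def)
      moreover have "Qs \<noteq> []" "length Qs = length Ps" using Ps(1) by (auto simp: Qs_def)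
      ultimately have "enat (length Ps - 1) \<le> krull_dim R"
        unfolding krull_dim_def by (intro SUP_upper2[of Qs]) auto
      then have "enat (Suc n) \<le> grade R mR" using CM Suc by (simp add: depth_def mh.R.max_ideal_eq)
      then have "enat n < grade R mR" using Suc_ile_eq by blast
      then have "\<exists>xs\<in>{xs. regular_sequence R xs \<and> set xs \<subseteq> mR}. enat n < enat (length xs)"
        unfolding grade_def by (simp only: less_SUP_iff)
      then obtain xs where "xs \<in> {xs. regular_sequence R xs \<and> set xs \<subseteq> mR}" "n < length xs"
        unfolding enat_ord_simps by (rule bexE)
      then have xs: "regular_sequence R xs" "set xs \<subseteq> mR" "Suc n \<le> length xs" by simp_all
      have "regular_sequence S (map \<phi> xs)"
        by (rule mh.regular_sequence_image(1)[OF _ xs(1,2)]) (rule closed; blast)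
      moreover have "set (map \<phi> xs) \<subseteq> mS"
        by (rule mh.regular_sequence_image(2)[OF _ xs(1,2)]) (rule closed; blast)
      ultimately have "enat (length (map \<phi> xs)) \<le> depth S"
        unfolding depth_def grade_def S.max_ideal_eq by (intro SUP_upper) simp
      then show ?thesis using xs(3) Suc order_trans[of "enat (Suc n)" "enat (length xs)"] by simp
    qed (simp add: zero_enat_def[symmetric])
  qed
  ultimately have "depth S = krull_dim S" by (rule antisym)
  moreover have "noetherian_ring S" by (rule S.noetherian_if_ideals_closed) (rule closed; blast)
  ultimately show ?thesis
    using S.local_ring by (intro cohen_macaulay_local_ring.intro cohen_macaulay_local_ring_axioms.intro)
qed

section \<open>Monomials in a finite set of generators\<close>

lemma (in cring) ideal_in_maximalideal:
  assumes I: "ideal I R" "I \<noteq> carrier R"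
  obtains M where "maximalideal M R" "I \<subseteq> M"
proof -
  have 1: "\<one> \<in> J \<longleftrightarrow> J = carrier R" if "ideal J R" for J
    using ideal.one_imp_carrier[OF that] by auto
  have "I \<inter> {\<one>} = {}" using 1 I by auto
  then obtain M where M: "ideal M R" "I \<subseteq> M" "M \<inter> {\<one>} = {}"
    and max: "\<And>Y. \<lbrakk>ideal Y R; M \<subseteq> Y; Y \<inter> {\<one>} = {}\<rbrakk> \<Longrightarrow> Y = M"
    using ideal_maximal_avoiding[OF I(1)] by metis
  have "maximalideal M R"
  proof (rule maximalidealI[OF M(1)])
    show "carrier R \<noteq> M" using M(3) by auto
    fix J assume J: "ideal J R" "M \<subseteq> J" "J \<subseteq> carrier R"
    show "J = M \<or> J = carrier R" using max[OF J(1,2)] 1[OF J(1)] by auto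
  qed
  then show ?thesis using that M(2) by blast
qed

lemma local_ring_Units:
  fixes R (structure)
  assumes "local_ring R" "maximalideal M R" "c \<in> carrier R" "c \<notin> M"
  shows "c \<in> Units R"
proof -
  interpret local_ring R by fact
  have I: "ideal (PIdl c) R" by (rule cgenideal_ideal[OF assms(3)])
  have "PIdl c = carrier R"
  proof (rule ccontr)
    assume "PIdl c \<noteq> carrier R"
    then obtain M' where M': "maximalideal M' R" "PIdl c \<subseteq> M'" using ideal_in_maximalideal[OF I] by blast
    then have "M' = M" using unique_maximalideal assms(2) by blast
    then show False using M'(2) cgenideal_self[OF assms(3)] assms(4) by blast
  qed
  then have "\<one> \<in> PIdl c" by simp
  then obtain d where d: "d \<in> carrier R" "d \<otimes> c = \<one>"
    unfolding cgenideal_def by auto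
  then have "c \<otimes> d = \<one>" using assms(3) by (simp add: m_comm)
  then show ?thesis unfolding Units_def using assms(3) d by blast
qed

text \<open>One prime is assigned to each of the given generators.\<close>

lemma (in cring) monomial_map_exists:
  assumes A: "finite A" "A \<subseteq> carrier R"
  obtains \<mu> P where "monomial_map R \<mu> P" "Idl (\<mu> ` {2..}) = Idl A"
proof -
  obtain P :: "nat set" where P: "finite P" "card P = card A" "P \<subseteq> {p. Factorial_Ring.prime p}"
    using infinite_arbitrarily_large[OF primes_infinite, of "card A"] by blast
  obtain g where g: "bij_betw g P A" using finite_same_card_bij[OF P(1) A(1) P(2)] by blast
  define h where "h p = (if p \<in> P then g p else \<zero>)" for p
  have hc: "h p \<in> carrier R" for p using g A(2) by (auto simp: h_def dest: bij_betwE)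
  define D where "D n = {p :: nat. Factorial_Ring.prime p \<and> p dvd n}" for n
  have Dfin: "finite (D n)" if "0 < n" for n
    using that by (auto simp: D_def intro: finite_subset[OF _ finite_divisors_nat[OF that]])
  define \<mu> where "\<mu> n = (\<Otimes>p\<in>D n. h p [^] multiplicity p n)" for n
  have mc: "\<mu> n \<in> carrier R" for n unfolding \<mu>_def by (rule finprod_closed) (simp add: hc)
  have mmult: "\<mu> (k * l) = \<mu> k \<otimes> \<mu> l" if "0 < k" "0 < l" for k l
  proof -
    have extension: "\<mu> n = (\<Otimes>p\<in>D (k * l). h p [^] multiplicity p n)" if "D n \<subseteq> D (k * l)" for n
      unfolding \<mu>_def
    proof (rule finprod_mono_neutral_cong_left)
      show "finite (D (k * l))" using \<open>0 < k\<close> \<open>0 < l\<close> by (intro Dfin) simp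
      fix p assume "p \<in> D (k * l) - D n"
      then have "\<not> p dvd n" by (simp add: D_def)
      then show "h p [^] multiplicity p n = \<one>" by (simp add: not_dvd_imp_multiplicity_0)
    qed (use that hc in auto)
    have "\<mu> (k * l) = (\<Otimes>p\<in>D (k * l). h p [^] multiplicity p k \<otimes> h p [^] multiplicity p l)"
      unfolding \<mu>_def[of "k * l"]
    proof (rule finprod_cong')
      fix p assume "p \<in> D (k * l)"
      then have "multiplicity p (k * l) = multiplicity p k + multiplicity p l"
        using that by (intro prime_elem_multiplicity_mult_distrib) (auto simp: D_def)
      then show "h p [^] multiplicity p (k * l) = h p [^] multiplicity p k \<otimes> h p [^] multiplicity p l"
        by (simp add: nat_pow_mult hc)
    qed (auto simp: hc)
    also have "\<dots> = (\<Otimes>p\<in>D (k * l). h p [^] multiplicity p k) \<otimes> (\<Otimes>p\<in>D (k * l). h p [^] multiplicity p l)"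
      by (rule finprod_multf) (auto simp: hc)
    also have "\<dots> = \<mu> k \<otimes> \<mu> l"
    proof -
      have "D k \<subseteq> D (k * l)" "D l \<subseteq> D (k * l)" by (auto simp: D_def)
      then show ?thesis by (simp only: extension)
    qed
    finally show ?thesis .
  qed
  have mprime: "\<mu> p = h p" if p: "Factorial_Ring.prime p" for p
  proof -
    have "D p = {p}" using p by (auto simp: D_def dest: primes_dvd_imp_eq)
    moreover have "multiplicity p p = 1" using p by (intro multiplicity_self) (auto simp: not_prime_unit)
    ultimately show ?thesis unfolding \<mu>_def by (simp add: hc)
  qed
  have m1: "\<mu> 1 = \<one>"
  proof -
    have "D 1 = {}" by (auto simp: D_def)
    then show ?thesis by (simp add: \<mu>_def)
  qed
  have "Idl (\<mu> ` {2..}) = Idl A"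
  proof
    have IA: "ideal (Idl A) R" by (rule genideal_ideal[OF A(2)])
    show "Idl (\<mu> ` {2..}) \<subseteq> Idl A"
    proof (rule genideal_minimal[OF IA], rule image_subsetI)
      fix n :: nat assume n: "n \<in> {2..}"
      then obtain p l where p: "Factorial_Ring.prime p" "n = p * l"
        using prime_factor_nat[of n] by (auto elim: dvdE)
      have "h p \<in> Idl A"
      proof (cases "p \<in> P")
        case True
        then have "h p \<in> A" using g by (auto simp: h_def dest: bij_betwE)
        then show ?thesis using genideal_self[OF A(2)] by blast
      next
        case False
        then show ?thesis using additive_subgroup.zero_closed[OF ideal.axioms(1)[OF IA]] by (simp add: h_def)
      qed
      moreover have "\<mu> n = h p \<otimes> \<mu> l"
        using mmult[of p l] mprime[OF p(1)] p n by (cases "l = 0") (auto simp: prime_gt_0_nat)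
      ultimately show "\<mu> n \<in> Idl A" using ideal.I_r_closed[OF IA _ mc] by simp
    qed
    show "Idl A \<subseteq> Idl (\<mu> ` {2..})"
    proof (rule subset_Idl_subset)
      show "A \<subseteq> \<mu> ` {2..}"
      proof
        fix a assume "a \<in> A"
        then obtain p where p: "p \<in> P" "a = g p" using g by (metis bij_betw_imp_surj_on imageE)
        then have "Factorial_Ring.prime p" using P(3) by blast
        then have "\<mu> p = a" "2 \<le> p" using p mprime prime_ge_2_nat by (auto simp: h_def)
        then show "a \<in> \<mu> ` {2..}" by force
      qed
    qed (use mc in auto)
  qed
  moreover have "\<mu> p = \<zero>" if "Factorial_Ring.prime p" "p \<notin> P" for p
    using mprime[OF that(1)] that(2) by (simp add: h_def)
  then have "monomial_map R \<mu> P"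
    by unfold_locales (use P mc m1 mmult in auto)
  ultimately show ?thesis using that by blast
qed

section \<open>Limits of systems of local rings\<close>

context direct_system
begin

lemma r_index: "(\<gamma>, \<delta>) \<in> r \<Longrightarrow> \<gamma> \<in> \<Gamma>" "(\<gamma>, \<delta>) \<in> r \<Longrightarrow> \<delta> \<in> \<Gamma>"
  using preorder by (auto simp: preorder_on_def)

lemma r_refl: "\<gamma> \<in> \<Gamma> \<Longrightarrow> (\<gamma>, \<gamma>) \<in> r"
  using preorder by (simp add: preorder_on_def refl_on_def)

lemma r_trans: "\<lbrakk>(\<gamma>, \<delta>) \<in> r; (\<delta>, \<epsilon>) \<in> r\<rbrakk> \<Longrightarrow> (\<gamma>, \<epsilon>) \<in> r"
  using preorder unfolding preorder_on_def trans_def by blast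

lemma A_ring: "\<gamma> \<in> \<Gamma> \<Longrightarrow> ring (A \<gamma>)"
  using is_cring cring.axioms(1) by blast

lemma f_closed: "\<lbrakk>(\<gamma>, \<delta>) \<in> r; x \<in> carrier (A \<gamma>)\<rbrakk> \<Longrightarrow> f \<gamma> \<delta> x \<in> carrier (A \<delta>)"
  using hom ring_hom_closed by metis

lemma upper_bound:
  assumes "finite D" "D \<subseteq> \<Gamma>"
  shows "\<exists>\<epsilon>\<in>\<Gamma>. \<forall>\<delta>\<in>D. (\<delta>, \<epsilon>) \<in> r"
  using assms
proof (induction D rule: finite_induct)
  case empty
  then show ?case using nonempty by blast
next
  case (insert d D)
  then obtain \<epsilon> where e: "\<epsilon> \<in> \<Gamma>" "\<forall>\<delta>\<in>D. (\<delta>, \<epsilon>) \<in> r" by blast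
  obtain \<eta> where "\<eta> \<in> \<Gamma>" "(\<epsilon>, \<eta>) \<in> r" "(d, \<eta>) \<in> r" using directed[of \<epsilon> d] e(1) insert.prems by blast
  then show ?case using e(2) r_trans by blast
qed

end

text \<open>The properties that characterize a direct limit up to isomorphism. They are stated for an arbitrary
ring \<open>S\<close>, so that they can be used both for the concrete limit and for a localization of it.\<close>

locale limit_cocone = direct_system \<Gamma> r A f
  for \<Gamma> :: "'i set" and r and A :: "'i \<Rightarrow> ('a, 'c) ring_scheme" and f +
  fixes S :: "('s, 'd) ring_scheme" and \<phi> :: "'i \<Rightarrow> 'a \<Rightarrow> 's"
  assumes limit_cring: "cring S"
    and cocone_hom: "\<gamma> \<in> \<Gamma> \<Longrightarrow> \<phi> \<gamma> \<in> ring_hom (A \<gamma>) S"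
    and cocone_comp: "\<lbrakk>(\<gamma>, \<delta>) \<in> r; x \<in> carrier (A \<gamma>)\<rbrakk> \<Longrightarrow> \<phi> \<delta> (f \<gamma> \<delta> x) = \<phi> \<gamma> x"
    and cocone_surj: "s \<in> carrier S \<Longrightarrow> \<exists>\<gamma>\<in>\<Gamma>. \<exists>x\<in>carrier (A \<gamma>). s = \<phi> \<gamma> x"
    and cocone_eq: "\<lbrakk>\<gamma> \<in> \<Gamma>; x \<in> carrier (A \<gamma>); y \<in> carrier (A \<gamma>); \<phi> \<gamma> x = \<phi> \<gamma> y\<rbrakk>
      \<Longrightarrow> \<exists>\<delta>. (\<gamma>, \<delta>) \<in> r \<and> f \<gamma> \<delta> x = f \<gamma> \<delta> y"
begin

sublocale S: cring S by (rule limit_cring)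

lemma cocone_closed: "\<lbrakk>\<gamma> \<in> \<Gamma>; x \<in> carrier (A \<gamma>)\<rbrakk> \<Longrightarrow> \<phi> \<gamma> x \<in> carrier S"
  using cocone_hom ring_hom_closed by metis

lemma directed_union_ideal:
  assumes \<gamma>: "\<gamma> \<in> \<Gamma>"
    and J: "\<And>\<delta>. (\<gamma>, \<delta>) \<in> r \<Longrightarrow> ideal (J \<delta>) (A \<delta>)"
    and push: "\<And>\<delta> \<epsilon> z. \<lbrakk>(\<gamma>, \<delta>) \<in> r; (\<delta>, \<epsilon>) \<in> r; z \<in> J \<delta>\<rbrakk> \<Longrightarrow> f \<delta> \<epsilon> z \<in> J \<epsilon>"
  shows "ideal {s. \<exists>\<delta>. (\<gamma>, \<delta>) \<in> r \<and> s \<in> \<phi> \<delta> ` J \<delta>} S" (is "ideal ?U S")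
proof -
  have Jc: "z \<in> carrier (A \<delta>)" if "(\<gamma>, \<delta>) \<in> r" "z \<in> J \<delta>" for \<delta> z
    using ideal.Icarr[OF J[OF that(1)] that(2)] .
  have UI: "\<phi> \<delta> z \<in> ?U" if "(\<gamma>, \<delta>) \<in> r" "z \<in> J \<delta>" for \<delta> z using that by blast
  have later: "\<exists>z'\<in>J \<epsilon>. s = \<phi> \<epsilon> z'" if "(\<gamma>, \<delta>) \<in> r" "(\<delta>, \<epsilon>) \<in> r" "z \<in> J \<delta>" "s = \<phi> \<delta> z" for \<delta> \<epsilon> z s
    using that push[of \<delta> \<epsilon> z] cocone_comp[OF that(2) Jc[OF that(1,3)]] by metis
  have lmult: "x \<otimes>\<^bsub>S\<^esub> a \<in> ?U" if a: "a \<in> ?U" and x: "x \<in> carrier S" for a x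
  proof -
    obtain \<delta> z where z: "(\<gamma>, \<delta>) \<in> r" "z \<in> J \<delta>" "a = \<phi> \<delta> z" using a by blast
    obtain \<eta> y where y: "\<eta> \<in> \<Gamma>" "y \<in> carrier (A \<eta>)" "x = \<phi> \<eta> y" using cocone_surj[OF x] by blast
    obtain \<epsilon> where e: "(\<delta>, \<epsilon>) \<in> r" "(\<eta>, \<epsilon>) \<in> r" using directed[of \<delta> \<eta>] r_index(2)[OF z(1)] y(1) by blast
    have ge: "(\<gamma>, \<epsilon>) \<in> r" using r_trans z(1) e(1) by blast
    have eG: "\<epsilon> \<in> \<Gamma>" using r_index(2)[OF ge] .
    obtain z' where z': "z' \<in> J \<epsilon>" "a = \<phi> \<epsilon> z'" using later[OF z(1) e(1) z(2,3)] by blast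
    have y': "f \<eta> \<epsilon> y \<in> carrier (A \<epsilon>)" "x = \<phi> \<epsilon> (f \<eta> \<epsilon> y)" using f_closed cocone_comp e(2) y by auto
    have "x \<otimes>\<^bsub>S\<^esub> a = \<phi> \<epsilon> (f \<eta> \<epsilon> y \<otimes>\<^bsub>A \<epsilon>\<^esub> z')"
      using ring_hom_mult[OF cocone_hom[OF eG] y'(1) Jc[OF ge z'(1)]] y'(2) z'(2) by simp
    then show ?thesis using UI[OF ge ideal.I_l_closed[OF J[OF ge] z'(1) y'(1)]] by simp
  qed
  show ?thesis
  proof (rule idealI[OF S.ring_axioms])
    show "subgroup ?U (add_monoid S)"
    proof (rule S.add.subgroupI)
      show "?U \<subseteq> carrier S" using Jc cocone_closed r_index by blast
      have "\<zero>\<^bsub>A \<gamma>\<^esub> \<in> J \<gamma>"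
        using additive_subgroup.zero_closed[OF ideal.axioms(1)[OF J[OF r_refl[OF \<gamma>]]]] .
      then show "?U \<noteq> {}" using r_refl[OF \<gamma>] by blast
    next
      fix a assume a: "a \<in> ?U"
      have "(\<ominus>\<^bsub>S\<^esub> \<one>\<^bsub>S\<^esub>) \<otimes>\<^bsub>S\<^esub> a \<in> ?U" by (rule lmult[OF a]) simp
      moreover have "a \<in> carrier S" using a Jc cocone_closed r_index by blast
      ultimately show "\<ominus>\<^bsub>S\<^esub> a \<in> ?U" by (simp add: S.l_minus)
    next
      fix a b assume a: "a \<in> ?U" and b: "b \<in> ?U"
      obtain \<delta> z where z: "(\<gamma>, \<delta>) \<in> r" "z \<in> J \<delta>" "a = \<phi> \<delta> z" using a by blast
      obtain \<eta> y where y: "(\<gamma>, \<eta>) \<in> r" "y \<in> J \<eta>" "b = \<phi> \<eta> y" using b by blast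
      obtain \<epsilon> where e: "(\<delta>, \<epsilon>) \<in> r" "(\<eta>, \<epsilon>) \<in> r" using directed[of \<delta> \<eta>] r_index(2) z(1) y(1) by metis
      have ge: "(\<gamma>, \<epsilon>) \<in> r" using r_trans z(1) e(1) by blast
      have eG: "\<epsilon> \<in> \<Gamma>" using r_index(2)[OF ge] .
      obtain z' where z': "z' \<in> J \<epsilon>" "a = \<phi> \<epsilon> z'" using later[OF z(1) e(1) z(2,3)] by blast
      obtain y' where y': "y' \<in> J \<epsilon>" "b = \<phi> \<epsilon> y'" using later[OF y(1) e(2) y(2,3)] by blast
      have "a \<oplus>\<^bsub>S\<^esub> b = \<phi> \<epsilon> (z' \<oplus>\<^bsub>A \<epsilon>\<^esub> y')"
        using ring_hom_add[OF cocone_hom[OF eG] Jc[OF ge z'(1)] Jc[OF ge y'(1)]] y'(2) z'(2) by simp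
      then show "a \<oplus>\<^bsub>S\<^esub> b \<in> ?U"
        using UI[OF ge additive_subgroup.a_closed[OF ideal.axioms(1)[OF J[OF ge]] z'(1) y'(1)]] by simp
    qed
    fix a x assume a: "a \<in> ?U" and x: "x \<in> carrier S"
    show "x \<otimes>\<^bsub>S\<^esub> a \<in> ?U" by (rule lmult[OF a x])
    moreover have "a \<in> carrier S" using a Jc cocone_closed r_index by blast
    ultimately show "a \<otimes>\<^bsub>S\<^esub> x \<in> ?U" using x by (simp add: S.m_comm)
  qed
qed

lemma genideal_push:
  assumes "(\<gamma>, \<delta>) \<in> r" "(\<delta>, \<epsilon>) \<in> r" "Y \<subseteq> carrier (A \<gamma>)" "z \<in> Idl\<^bsub>A \<delta>\<^esub> (f \<gamma> \<delta> ` Y)"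
  shows "f \<delta> \<epsilon> z \<in> Idl\<^bsub>A \<epsilon>\<^esub> (f \<gamma> \<epsilon> ` Y)"
proof -
  have "f \<delta> \<epsilon> ` f \<gamma> \<delta> ` Y = f \<gamma> \<epsilon> ` Y"
    unfolding image_image by (rule image_cong[OF refl], rule hom_comp[OF assms(1,2)]) (rule subsetD[OF assms(3)])
  moreover have "f \<gamma> \<delta> ` Y \<subseteq> carrier (A \<delta>)" using f_closed[OF assms(1)] assms(3) by blast
  ultimately show ?thesis
    using ring_hom_genideal[OF A_ring A_ring hom[OF assms(2)] _ assms(4)] r_index assms(1,2) by metis
qed

text \<open>A linear combination in \<open>S\<close> involves finitely many elements and one equation, so it already exists at
some index. Formally, the elements that come from the ideals at the indices \<open>\<delta> \<ge> \<gamma>\<close> form an ideal of \<open>S\<close>.\<close>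

lemma genideal_reflect:
  assumes \<gamma>: "\<gamma> \<in> \<Gamma>" and Y: "Y \<subseteq> carrier (A \<gamma>)" and x: "x \<in> carrier (A \<gamma>)"
    and mem: "\<phi> \<gamma> x \<in> Idl\<^bsub>S\<^esub> (\<phi> \<gamma> ` Y)"
  shows "\<exists>\<delta>. (\<gamma>, \<delta>) \<in> r \<and> f \<gamma> \<delta> x \<in> Idl\<^bsub>A \<delta>\<^esub> (f \<gamma> \<delta> ` Y)"
proof -
  define J where "J \<delta> = Idl\<^bsub>A \<delta>\<^esub> (f \<gamma> \<delta> ` Y)" for \<delta>
  have fY: "f \<gamma> \<delta> ` Y \<subseteq> carrier (A \<delta>)" if "(\<gamma>, \<delta>) \<in> r" for \<delta> using f_closed[OF that] Y by blast
  have J: "ideal (J \<delta>) (A \<delta>)" if "(\<gamma>, \<delta>) \<in> r" for \<delta>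
    unfolding J_def using fY[OF that] A_ring[OF r_index(2)[OF that]] by (rule ring.genideal_ideal[rotated])
  have push: "f \<delta> \<epsilon> z \<in> J \<epsilon>" if "(\<gamma>, \<delta>) \<in> r" "(\<delta>, \<epsilon>) \<in> r" "z \<in> J \<delta>" for \<delta> \<epsilon> z
    using genideal_push[OF that(1,2) Y] that(3) by (simp add: J_def)
  have U: "ideal {s. \<exists>\<delta>. (\<gamma>, \<delta>) \<in> r \<and> s \<in> \<phi> \<delta> ` J \<delta>} S"
    by (rule directed_union_ideal[OF \<gamma> J push])
  have "\<phi> \<gamma> y \<in> \<phi> \<gamma> ` J \<gamma>" if "y \<in> Y" for y
  proof -
    have "f \<gamma> \<gamma> y \<in> J \<gamma>"
      unfolding J_def using ring.genideal_self[OF A_ring[OF \<gamma>] fY[OF r_refl[OF \<gamma>]]] that by blast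
    then show ?thesis using hom_id[OF \<gamma>, of y] that Y by auto
  qed
  then have "Idl\<^bsub>S\<^esub> (\<phi> \<gamma> ` Y) \<subseteq> {s. \<exists>\<delta>. (\<gamma>, \<delta>) \<in> r \<and> s \<in> \<phi> \<delta> ` J \<delta>}"
    using r_refl[OF \<gamma>] by (intro S.genideal_minimal[OF U]) blast
  then obtain \<delta> z where z: "(\<gamma>, \<delta>) \<in> r" "z \<in> J \<delta>" "\<phi> \<gamma> x = \<phi> \<delta> z" using mem by blast
  have zc: "z \<in> carrier (A \<delta>)" using ideal.Icarr[OF J[OF z(1)] z(2)] .
  have "\<phi> \<delta> (f \<gamma> \<delta> x) = \<phi> \<delta> z" using cocone_comp[OF z(1) x] z(3) by simp
  then obtain \<epsilon> where e: "(\<delta>, \<epsilon>) \<in> r" "f \<delta> \<epsilon> (f \<gamma> \<delta> x) = f \<delta> \<epsilon> z"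
    using cocone_eq[OF r_index(2)[OF z(1)] f_closed[OF z(1) x] zc] by blast
  have "f \<gamma> \<epsilon> x = f \<delta> \<epsilon> z" using e hom_comp[OF z(1) e(1) x] by simp
  then show ?thesis using push[OF z(1) e(1) z(2)] r_trans[OF z(1) e(1)] unfolding J_def by metis
qed

end

locale local_limit_cocone = limit_cocone \<Gamma> r A f S \<phi>
  for \<Gamma> :: "'i set" and r and A :: "'i \<Rightarrow> ('a, 'c) ring_scheme" and f
    and S :: "('s, 'd) ring_scheme" and \<phi> +
  fixes \<mm> :: "'i \<Rightarrow> 'a set"
  assumes A_local: "\<gamma> \<in> \<Gamma> \<Longrightarrow> local_ring (A \<gamma>)"
    and A_noetherian: "\<gamma> \<in> \<Gamma> \<Longrightarrow> noetherian_ring (A \<gamma>)"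
    and m_maximal: "\<gamma> \<in> \<Gamma> \<Longrightarrow> maximalideal (\<mm> \<gamma>) (A \<gamma>)"
    and m_generates: "(\<gamma>, \<delta>) \<in> r \<Longrightarrow> (\<delta>, \<gamma>) \<notin> r \<Longrightarrow> Idl\<^bsub>A \<delta>\<^esub> (f \<gamma> \<delta> ` \<mm> \<gamma>) = \<mm> \<delta>"
begin

lemma mI: "\<gamma> \<in> \<Gamma> \<Longrightarrow> ideal (\<mm> \<gamma>) (A \<gamma>)"
  using m_maximal maximalideal.axioms(1) by blast

lemma m_carrier: "\<gamma> \<in> \<Gamma> \<Longrightarrow> \<mm> \<gamma> \<subseteq> carrier (A \<gamma>)"
  using ideal.Icarr[OF mI] by blast

lemma m_Units: "\<lbrakk>\<gamma> \<in> \<Gamma>; c \<in> carrier (A \<gamma>); c \<notin> \<mm> \<gamma>\<rbrakk> \<Longrightarrow> c \<in> Units (A \<gamma>)"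
  using local_ring_Units[OF A_local m_maximal] by blast

lemma one_notin_m: "\<gamma> \<in> \<Gamma> \<Longrightarrow> \<one>\<^bsub>A \<gamma>\<^esub> \<notin> \<mm> \<gamma>"
  using ideal.one_imp_carrier[OF mI] maximalideal.I_notcarr[OF m_maximal] by metis

lemma Units_notin_m:
  assumes "\<gamma> \<in> \<Gamma>" "c \<in> carrier (A \<gamma>)" "d \<in> carrier (A \<gamma>)" "c \<otimes>\<^bsub>A \<gamma>\<^esub> d = \<one>\<^bsub>A \<gamma>\<^esub>"
  shows "c \<notin> \<mm> \<gamma>"
  using ideal.I_r_closed[OF mI[OF assms(1)] _ assms(3), of c] assms(4) one_notin_m[OF assms(1)] by metis

lemma f_Units:
  assumes "(\<gamma>, \<delta>) \<in> r" "c \<in> carrier (A \<gamma>)" "c \<notin> \<mm> \<gamma>"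
  shows "f \<gamma> \<delta> c \<notin> \<mm> \<delta>"
proof -
  have "c \<in> Units (A \<gamma>)" using m_Units[OF r_index(1)] assms by blast
  then obtain d where d: "d \<in> carrier (A \<gamma>)" "c \<otimes>\<^bsub>A \<gamma>\<^esub> d = \<one>\<^bsub>A \<gamma>\<^esub>" unfolding Units_def by blast
  have "f \<gamma> \<delta> c \<otimes>\<^bsub>A \<delta>\<^esub> f \<gamma> \<delta> d = \<one>\<^bsub>A \<delta>\<^esub>"
    using ring_hom_mult[OF hom[OF assms(1)] assms(2) d(1)] d(2) ring_hom_one[OF hom[OF assms(1)]] by simp
  then show ?thesis using Units_notin_m[OF r_index(2)] assms(1,2) d(1) f_closed by metis
qed

text \<open>If \<open>\<gamma>\<close> and \<open>\<delta>\<close> precede each other in the preorder, the transition maps are inverse isomorphisms and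
exchange the maximal ideals.\<close>

lemma m_generates_later:
  assumes gd: "(\<gamma>, \<delta>) \<in> r"
  shows "Idl\<^bsub>A \<delta>\<^esub> (f \<gamma> \<delta> ` \<mm> \<gamma>) = \<mm> \<delta>"
proof (cases "(\<delta>, \<gamma>) \<in> r")
  case False
  then show ?thesis using m_generates gd by blast
next
  case dg: True
  note idx = r_index[OF gd]
  have inv1: "f \<delta> \<gamma> (f \<gamma> \<delta> x) = x" if "x \<in> carrier (A \<gamma>)" for x
    using hom_comp[OF gd dg that] hom_id[OF idx(1) that] by simp
  have inv2: "f \<gamma> \<delta> (f \<delta> \<gamma> x) = x" if "x \<in> carrier (A \<delta>)" for x
    using hom_comp[OF dg gd that] hom_id[OF idx(2) that] by simp
  have 1: "f \<gamma> \<delta> ` \<mm> \<gamma> \<subseteq> \<mm> \<delta>"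
  proof (rule image_subsetI, rule ccontr)
    fix x assume x: "x \<in> \<mm> \<gamma>" "f \<gamma> \<delta> x \<notin> \<mm> \<delta>"
    have xc: "x \<in> carrier (A \<gamma>)" using x(1) m_carrier[OF idx(1)] by blast
    show False using f_Units[OF dg f_closed[OF gd xc] x(2)] inv1[OF xc] x(1) by simp
  qed
  have 2: "\<mm> \<delta> \<subseteq> f \<gamma> \<delta> ` \<mm> \<gamma>"
  proof
    fix y assume y: "y \<in> \<mm> \<delta>"
    have yc: "y \<in> carrier (A \<delta>)" using y m_carrier[OF idx(2)] by blast
    have "f \<delta> \<gamma> y \<in> \<mm> \<gamma>"
      using f_Units[OF gd f_closed[OF dg yc]] inv2[OF yc] y by auto
    then show "y \<in> f \<gamma> \<delta> ` \<mm> \<gamma>" using inv2[OF yc] by force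
  qed
  have "f \<gamma> \<delta> ` \<mm> \<gamma> = \<mm> \<delta>" using 1 2 by blast
  then show ?thesis
    using ring.genideal_minimal[OF A_ring[OF idx(2)] mI[OF idx(2)], of "\<mm> \<delta>"]
      ring.genideal_self[OF A_ring[OF idx(2)] m_carrier[OF idx(2)]] by auto
qed

lemma f_m: "(\<gamma>, \<delta>) \<in> r \<Longrightarrow> x \<in> \<mm> \<gamma> \<Longrightarrow> f \<gamma> \<delta> x \<in> \<mm> \<delta>"
  using m_generates_later[of \<gamma> \<delta>] ring.genideal_self[OF A_ring, of \<delta> "f \<gamma> \<delta> ` \<mm> \<gamma>"]
    f_closed[of \<gamma> \<delta>] m_carrier[of \<gamma>] r_index[of \<gamma> \<delta>] by blast

text \<open>It remains to find the index from which on no new nonstandard monomials appear. Each nonstandard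
monomial of \<open>S\<close> is nonstandard at some index, and by Dickson's lemma finitely many of them generate all.\<close>

theorem limit_cohen_macaulay:
  assumes CM: "\<And>\<gamma>. \<gamma> \<in> \<Gamma> \<Longrightarrow> depth (A \<gamma>) = krull_dim (A \<gamma>)"
  shows "cohen_macaulay_local_ring S"
proof -
  obtain \<gamma>0 where g0: "\<gamma>0 \<in> \<Gamma>" using nonempty by blast
  interpret A0: cring "A \<gamma>0" by (rule is_cring[OF g0])
  obtain G where G: "finite G" "G \<subseteq> carrier (A \<gamma>0)" "\<mm> \<gamma>0 = Idl\<^bsub>A \<gamma>0\<^esub> G"
    using noetherian_ring.finetely_gen[OF A_noetherian[OF g0] mI[OF g0]] by blast
  obtain \<mu> P where M0: "monomial_map (A \<gamma>0) \<mu> P" and mu_m: "Idl\<^bsub>A \<gamma>0\<^esub> (\<mu> ` {2..}) = \<mm> \<gamma>0"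
    using A0.monomial_map_exists[OF G(1,2)] unfolding G(3) by metis
  interpret M0: monomial_map "A \<gamma>0" \<mu> P by (rule M0)
  note mu = M0.mu_closed M0.mu_one M0.mu_mult M0.mu_prime_zero mu_m
  have muc: "\<mu> ` B \<subseteq> carrier (A \<gamma>0)" for B using mu(1) by blast
  have A_monomial: "monomial_local_ring (A \<delta>) (\<mm> \<delta>) (f \<gamma>0 \<delta> \<circ> \<mu>) P" if d: "(\<gamma>0, \<delta>) \<in> r" for \<delta>
  proof -
    note dG = r_index(2)[OF d]
    interpret Ad: cring "A \<delta>" by (rule is_cring[OF dG])
    have "Idl\<^bsub>A \<delta>\<^esub> ((f \<gamma>0 \<delta> \<circ> \<mu>) ` {2..}) = \<mm> \<delta>"
      using genideal_image_genideal[OF A_ring[OF g0] A_ring[OF dG] hom[OF d] muc[of "{2..}"]]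
      unfolding mu(5) m_generates_later[OF d] by (simp add: image_comp)
    then show ?thesis
      using M0.monomial_map_image[OF Ad.is_cring hom[OF d]] mI[OF dG] one_notin_m[OF dG] m_Units[OF dG]
      by (intro monomial_local_ring.intro monomial_local_ring_axioms.intro)
  qed
  define mS where "mS = {s. \<exists>\<delta>. (\<gamma>0, \<delta>) \<in> r \<and> s \<in> \<phi> \<delta> ` \<mm> \<delta>}"
  have mS: "ideal mS S"
    unfolding mS_def by (rule directed_union_ideal[OF g0]) (auto intro: mI r_index f_m)
  have rep: "\<exists>\<delta>. (\<gamma>0, \<delta>) \<in> r \<and> (\<exists>x\<in>carrier (A \<delta>). s = \<phi> \<delta> x)" if s: "s \<in> carrier S" for s
  proof -
    obtain \<gamma> x where x: "\<gamma> \<in> \<Gamma>" "x \<in> carrier (A \<gamma>)" "s = \<phi> \<gamma> x" using cocone_surj[OF s] by blast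
    obtain \<delta> where d: "(\<gamma>0, \<delta>) \<in> r" "(\<gamma>, \<delta>) \<in> r" using directed[OF g0 x(1)] by blast
    then show ?thesis using f_closed[OF d(2) x(2)] cocone_comp[OF d(2) x(2)] x(3) by metis
  qed
  have S_monomial: "monomial_local_ring S mS (\<phi> \<gamma>0 \<circ> \<mu>) P"
  proof -
    have "Idl\<^bsub>S\<^esub> ((\<phi> \<gamma>0 \<circ> \<mu>) ` {2..}) = Idl\<^bsub>S\<^esub> (\<phi> \<gamma>0 ` \<mm> \<gamma>0)"
      using genideal_image_genideal[OF A_ring[OF g0] S.ring_axioms cocone_hom[OF g0] muc[of "{2..}"]]
      unfolding mu(5) by (simp add: image_comp)
    also have "\<dots> = mS"
    proof
      show "Idl\<^bsub>S\<^esub> (\<phi> \<gamma>0 ` \<mm> \<gamma>0) \<subseteq> mS"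
        using r_refl[OF g0] by (intro S.genideal_minimal[OF mS]) (auto simp: mS_def)
      show "mS \<subseteq> Idl\<^bsub>S\<^esub> (\<phi> \<gamma>0 ` \<mm> \<gamma>0)"
      proof
        fix s assume "s \<in> mS"
        then obtain \<delta> x where x: "(\<gamma>0, \<delta>) \<in> r" "x \<in> \<mm> \<delta>" "s = \<phi> \<delta> x" unfolding mS_def by blast
        note dG = r_index(2)[OF x(1)]
        have fm: "f \<gamma>0 \<delta> ` \<mm> \<gamma>0 \<subseteq> carrier (A \<delta>)" using f_closed[OF x(1)] m_carrier[OF g0] by blast
        have "x \<in> Idl\<^bsub>A \<delta>\<^esub> (f \<gamma>0 \<delta> ` \<mm> \<gamma>0)" using x(2) m_generates_later[OF x(1)] by simp
        then have "\<phi> \<delta> x \<in> Idl\<^bsub>S\<^esub> (\<phi> \<delta> ` f \<gamma>0 \<delta> ` \<mm> \<gamma>0)"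
          by (rule ring_hom_genideal[OF A_ring[OF dG] S.ring_axioms cocone_hom[OF dG] fm])
        moreover have "\<phi> \<delta> ` f \<gamma>0 \<delta> ` \<mm> \<gamma>0 = \<phi> \<gamma>0 ` \<mm> \<gamma>0"
          unfolding image_image by (rule image_cong[OF refl], rule cocone_comp[OF x(1)]) (rule subsetD[OF m_carrier[OF g0]])
        ultimately show "s \<in> Idl\<^bsub>S\<^esub> (\<phi> \<gamma>0 ` \<mm> \<gamma>0)" using x(3) by simp
      qed
    qed
    finally have gen: "Idl\<^bsub>S\<^esub> ((\<phi> \<gamma>0 \<circ> \<mu>) ` {2..}) = mS" .
    have one: "\<one>\<^bsub>S\<^esub> \<notin> mS"
    proof
      assume "\<one>\<^bsub>S\<^esub> \<in> mS"
      then obtain \<delta> x where x: "(\<gamma>0, \<delta>) \<in> r" "x \<in> \<mm> \<delta>" "\<one>\<^bsub>S\<^esub> = \<phi> \<delta> x"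
        unfolding mS_def by blast
      note dG = r_index(2)[OF x(1)]
      interpret Ad: cring "A \<delta>" by (rule is_cring[OF dG])
      have xc: "x \<in> carrier (A \<delta>)" using x(2) m_carrier[OF dG] by blast
      have "\<phi> \<delta> x = \<phi> \<delta> \<one>\<^bsub>A \<delta>\<^esub>" using x(3) ring_hom_one[OF cocone_hom[OF dG]] by simp
      then obtain \<epsilon> where e: "(\<delta>, \<epsilon>) \<in> r" "f \<delta> \<epsilon> x = f \<delta> \<epsilon> \<one>\<^bsub>A \<delta>\<^esub>"
        using cocone_eq[OF dG xc Ad.one_closed] by blast
      then have "f \<delta> \<epsilon> x = \<one>\<^bsub>A \<epsilon>\<^esub>" using ring_hom_one[OF hom[OF e(1)]] by simp
      then show False using f_m[OF e(1) x(2)] one_notin_m[OF r_index(2)[OF e(1)]] by simp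
    qed
    have units: "c \<in> Units S" if c: "c \<in> carrier S" "c \<notin> mS" for c
    proof -
      obtain \<delta> x where x: "(\<gamma>0, \<delta>) \<in> r" "x \<in> carrier (A \<delta>)" "c = \<phi> \<delta> x" using rep[OF c(1)] by blast
      note dG = r_index(2)[OF x(1)]
      have "x \<notin> \<mm> \<delta>" using c(2) x unfolding mS_def by blast
      then have "x \<in> Units (A \<delta>)" using m_Units[OF dG x(2)] by blast
      then obtain d where d: "d \<in> carrier (A \<delta>)" "d \<otimes>\<^bsub>A \<delta>\<^esub> x = \<one>\<^bsub>A \<delta>\<^esub>" unfolding Units_def by blast
      have "\<phi> \<delta> d \<otimes>\<^bsub>S\<^esub> c = \<one>\<^bsub>S\<^esub>"
        using ring_hom_mult[OF cocone_hom[OF dG] d(1) x(2)] d(2) ring_hom_one[OF cocone_hom[OF dG]] x(3) by simp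
      then show ?thesis using c(1) cocone_closed[OF dG d(1)] S.m_comm unfolding Units_def by force
    qed
    show ?thesis
      using M0.monomial_map_image[OF S.is_cring cocone_hom[OF g0]] mS one units gen
      by (intro monomial_local_ring.intro monomial_local_ring_axioms.intro)
  qed
  interpret SM: monomial_local_ring S mS "\<phi> \<gamma>0 \<circ> \<mu>" P by (rule S_monomial)
  have reach: "\<exists>\<delta>. (\<gamma>0, \<delta>) \<in> r \<and> f \<gamma>0 \<delta> (\<mu> n) \<in> Idl\<^bsub>A \<delta>\<^esub> (f \<gamma>0 \<delta> ` \<mu> ` {Suc n..})"
    if "n \<in> SM.nonstandard" for n
  proof (rule genideal_reflect[OF g0 muc mu(1)])
    show "\<phi> \<gamma>0 (\<mu> n) \<in> Idl\<^bsub>S\<^esub> (\<phi> \<gamma>0 ` \<mu> ` {Suc n..})"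
      using that by (simp add: SM.nonstandard_def SM.tail_def image_comp)
  qed
  define T where "T = {n \<in> SM.nonstandard. \<forall>p. Factorial_Ring.prime p \<longrightarrow> p dvd n \<longrightarrow> p \<in> P}"
  have "0 \<notin> T" by (simp add: T_def SM.nonstandard_def)
  moreover have "p \<in> P" if "n \<in> T" "Factorial_Ring.prime p" "p dvd n" for n p
    using that by (simp add: T_def)
  ultimately obtain B where B: "finite B" "B \<subseteq> T" "\<And>n. n \<in> T \<Longrightarrow> \<exists>b\<in>B. b dvd n"
    using dickson[of P T] M0.finite_P M0.prime_P by metis
  have "\<exists>\<delta>. (\<gamma>0, \<delta>) \<in> r \<and> f \<gamma>0 \<delta> (\<mu> b) \<in> Idl\<^bsub>A \<delta>\<^esub> (f \<gamma>0 \<delta> ` \<mu> ` {Suc b..})" if "b \<in> B" for b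
    using reach B(2) that by (auto simp: T_def)
  then obtain D where D: "\<And>b. b \<in> B \<Longrightarrow> (\<gamma>0, D b) \<in> r"
    "\<And>b. b \<in> B \<Longrightarrow> f \<gamma>0 (D b) (\<mu> b) \<in> Idl\<^bsub>A (D b)\<^esub> (f \<gamma>0 (D b) ` \<mu> ` {Suc b..})" by metis
  \<comment> \<open>Beyond the indices \<open>D b\<close> the finitely many generators, and so all their multiples, are nonstandard.\<close>
  have stable: "monomial_hom (A \<epsilon>) (\<mm> \<epsilon>) (f \<gamma>0 \<epsilon> \<circ> \<mu>) S mS (\<phi> \<gamma>0 \<circ> \<mu>) P (\<phi> \<epsilon>)"
    if e0: "(\<gamma>0, \<epsilon>) \<in> r" and e: "\<And>b. b \<in> B \<Longrightarrow> (D b, \<epsilon>) \<in> r" for \<epsilon>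
  proof -
    note eG = r_index(2)[OF e0]
    interpret AM: monomial_local_ring "A \<epsilon>" "\<mm> \<epsilon>" "f \<gamma>0 \<epsilon> \<circ> \<mu>" P by (rule A_monomial[OF e0])
    have B_ns: "b \<in> AM.nonstandard" if b: "b \<in> B" for b
    proof -
      have "0 < b" using b B(2) by (auto simp: T_def SM.nonstandard_def)
      have "f (D b) \<epsilon> (f \<gamma>0 (D b) (\<mu> b)) \<in> Idl\<^bsub>A \<epsilon>\<^esub> (f \<gamma>0 \<epsilon> ` \<mu> ` {Suc b..})"
        by (rule genideal_push[OF D(1)[OF b] e[OF b] muc D(2)[OF b]])
      then show ?thesis
        using hom_comp[OF D(1)[OF b] e[OF b] mu(1)] \<open>0 < b\<close>
        by (simp add: AM.nonstandard_def AM.tail_def image_comp)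
    qed
    have "SM.nonstandard \<subseteq> AM.nonstandard"
    proof
      fix n assume n: "n \<in> SM.nonstandard"
      then have n0: "0 < n" by (simp add: SM.nonstandard_def)
      show "n \<in> AM.nonstandard"
      proof (cases "n \<in> T")
        case True
        then obtain b l where "b \<in> B" "n = b * l" using B(3) by blast
        then show ?thesis using AM.nonstandard_mult[OF B_ns] n0 by auto
      next
        case False
        then show ?thesis using n n0 AM.nonstandard_of_prime_dvd by (auto simp: T_def)
      qed
    qed
    then show ?thesis
      by (intro monomial_hom.intro monomial_hom_axioms.intro A_monomial[OF e0] S_monomial)
        (use cocone_hom[OF eG] cocone_comp[OF e0 mu(1)] A_noetherian[OF eG] in auto)
  qed
  show ?thesis
  proof (rule cohen_macaulay_by_approximation[OF S_monomial])
    fix Y assume Y: "finite Y" "Y \<subseteq> carrier S"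
    obtain E x where E: "\<And>y. y \<in> Y \<Longrightarrow> (\<gamma>0, E y) \<in> r" "\<And>y. y \<in> Y \<Longrightarrow> x y \<in> carrier (A (E y))"
      "\<And>y. y \<in> Y \<Longrightarrow> y = \<phi> (E y) (x y)" using rep Y(2) by (metis subsetD)
    have "insert \<gamma>0 (D ` B \<union> E ` Y) \<subseteq> \<Gamma>" using g0 D(1) E(1) r_index(2) by blast
    then obtain \<epsilon> where e: "\<epsilon> \<in> \<Gamma>" "(\<gamma>0, \<epsilon>) \<in> r" "\<And>b. b \<in> B \<Longrightarrow> (D b, \<epsilon>) \<in> r" "\<And>y. y \<in> Y \<Longrightarrow> (E y, \<epsilon>) \<in> r"
      using upper_bound[of "insert \<gamma>0 (D ` B \<union> E ` Y)"] B(1) Y(1) by auto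
    have "Y \<subseteq> \<phi> \<epsilon> ` carrier (A \<epsilon>)"
    proof
      fix y assume y: "y \<in> Y"
      have "y = \<phi> \<epsilon> (f (E y) \<epsilon> (x y))" using cocone_comp[OF e(4)[OF y] E(2)[OF y]] E(3)[OF y] by simp
      then show "y \<in> \<phi> \<epsilon> ` carrier (A \<epsilon>)" using f_closed[OF e(4)[OF y] E(2)[OF y]] by blast
    qed
    then show "\<exists>(R :: ('a, 'c) ring_scheme) mR \<mu>R \<psi>. monomial_hom R mR \<mu>R S mS (\<phi> \<gamma>0 \<circ> \<mu>) P \<psi> \<and>
        Y \<subseteq> \<psi> ` carrier R \<and> depth R = krull_dim R"
      using stable[OF e(2,3)] CM[OF e(1)] by blast
  qed
qed

end

section \<open>The construction of the direct limit\<close>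

context direct_system
begin

definition inject :: "'i \<Rightarrow> 'a \<Rightarrow> ('i \<times> 'a) set" where
  "inject \<gamma> x = {w. ((\<gamma>, x), w) \<in> limit_rel \<Gamma> r A f}"

abbreviation L where "L \<equiv> direct_limit \<Gamma> r A f"

lemma limit_rel_iff:
  "((\<gamma>, x), (\<delta>, y)) \<in> limit_rel \<Gamma> r A f \<longleftrightarrow> \<gamma> \<in> \<Gamma> \<and> x \<in> carrier (A \<gamma>) \<and> \<delta> \<in> \<Gamma> \<and> y \<in> carrier (A \<delta>) \<and>
     (\<exists>\<epsilon>\<in>\<Gamma>. (\<gamma>, \<epsilon>) \<in> r \<and> (\<delta>, \<epsilon>) \<in> r \<and> f \<gamma> \<epsilon> x = f \<delta> \<epsilon> y)"
  by (simp add: limit_rel_def)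

lemma limit_rel_refl: "\<gamma> \<in> \<Gamma> \<Longrightarrow> x \<in> carrier (A \<gamma>) \<Longrightarrow> ((\<gamma>, x), (\<gamma>, x)) \<in> limit_rel \<Gamma> r A f"
  unfolding limit_rel_iff using r_refl by blast

lemma limit_rel_sym: "(v, w) \<in> limit_rel \<Gamma> r A f \<Longrightarrow> (w, v) \<in> limit_rel \<Gamma> r A f"
  by (cases v; cases w) (auto simp: limit_rel_iff intro: sym)

lemma agree_later:
  assumes "(\<gamma>, \<epsilon>) \<in> r" "(\<delta>, \<epsilon>) \<in> r" "(\<epsilon>, \<eta>) \<in> r" "x \<in> carrier (A \<gamma>)" "y \<in> carrier (A \<delta>)"
    "f \<gamma> \<epsilon> x = f \<delta> \<epsilon> y"
  shows "f \<gamma> \<eta> x = f \<delta> \<eta> y"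
  using hom_comp[OF assms(1,3,4)] hom_comp[OF assms(2,3,5)] assms(6) by simp

lemma limit_rel_trans:
  assumes "(u, v) \<in> limit_rel \<Gamma> r A f" "(v, w) \<in> limit_rel \<Gamma> r A f"
  shows "(u, w) \<in> limit_rel \<Gamma> r A f"
proof -
  obtain \<gamma> x \<delta> y \<eta> z where uvw: "u = (\<gamma>, x)" "v = (\<delta>, y)" "w = (\<eta>, z)" by (metis surj_pair)
  have c: "\<gamma> \<in> \<Gamma>" "x \<in> carrier (A \<gamma>)" "y \<in> carrier (A \<delta>)" "\<eta> \<in> \<Gamma>" "z \<in> carrier (A \<eta>)"
    using assms unfolding uvw limit_rel_iff by auto
  obtain \<alpha> where a: "(\<gamma>, \<alpha>) \<in> r" "(\<delta>, \<alpha>) \<in> r" "f \<gamma> \<alpha> x = f \<delta> \<alpha> y"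
    using assms(1) unfolding uvw limit_rel_iff by blast
  obtain \<beta> where b: "(\<delta>, \<beta>) \<in> r" "(\<eta>, \<beta>) \<in> r" "f \<delta> \<beta> y = f \<eta> \<beta> z"
    using assms(2) unfolding uvw limit_rel_iff by blast
  obtain \<epsilon> where e: "\<epsilon> \<in> \<Gamma>" "(\<alpha>, \<epsilon>) \<in> r" "(\<beta>, \<epsilon>) \<in> r"
    using directed r_index(2)[OF a(1)] r_index(2)[OF b(1)] by blast
  have "f \<gamma> \<epsilon> x = f \<eta> \<epsilon> z"
    using agree_later[OF a(1,2) e(2) c(2,3) a(3)] agree_later[OF b(1,2) e(3) c(3,5) b(3)] by simp
  moreover have "(\<gamma>, \<epsilon>) \<in> r" "(\<eta>, \<epsilon>) \<in> r" using r_trans a(1) b(2) e by blast+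
  ultimately show ?thesis unfolding uvw limit_rel_iff using c e(1) by blast
qed

lemma inject_eq: "((\<gamma>, x), (\<delta>, y)) \<in> limit_rel \<Gamma> r A f \<Longrightarrow> inject \<gamma> x = inject \<delta> y"
  unfolding inject_def using limit_rel_trans limit_rel_sym by blast

lemma inject_self: "\<gamma> \<in> \<Gamma> \<Longrightarrow> x \<in> carrier (A \<gamma>) \<Longrightarrow> (\<gamma>, x) \<in> inject \<gamma> x"
  by (simp add: inject_def limit_rel_refl)

lemma inject_eqD:
  assumes "inject \<gamma> x = inject \<delta> y" "\<delta> \<in> \<Gamma>" "y \<in> carrier (A \<delta>)"
  shows "((\<gamma>, x), (\<delta>, y)) \<in> limit_rel \<Gamma> r A f"
  using inject_self[OF assms(2,3)] unfolding assms(1)[symmetric] by (simp add: inject_def)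

lemma inject_push:
  assumes "(\<gamma>, \<delta>) \<in> r" "x \<in> carrier (A \<gamma>)"
  shows "inject \<delta> (f \<gamma> \<delta> x) = inject \<gamma> x"
proof -
  have d: "\<delta> \<in> \<Gamma>" using r_index(2)[OF assms(1)] .
  have "f \<delta> \<delta> (f \<gamma> \<delta> x) = f \<gamma> \<delta> x" using hom_id[OF d f_closed[OF assms]] .
  then show ?thesis
    using assms d r_refl[OF d] r_index(1)[OF assms(1)] f_closed[OF assms]
    by (intro inject_eq) (auto simp: limit_rel_iff)
qed

lemma carrier_L: "carrier L = {inject \<gamma> x | \<gamma> x. \<gamma> \<in> \<Gamma> \<and> x \<in> carrier (A \<gamma>)}"
  by (auto simp: direct_limit_def quotient_def inject_def Image_def)

lemma inject_closed: "\<gamma> \<in> \<Gamma> \<Longrightarrow> x \<in> carrier (A \<gamma>) \<Longrightarrow> inject \<gamma> x \<in> carrier L"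
  unfolding carrier_L by blast

text \<open>Sums and products in the limit have the same shape, with \<open>p\<close> the operation at each index. Two
choices of representatives and of an upper bound agree at a common later index.\<close>

lemma inject_binop:
  assumes g: "\<gamma> \<in> \<Gamma>" and x: "x \<in> carrier (A \<gamma>)" and y: "y \<in> carrier (A \<gamma>)"
    and closed: "\<And>\<delta> a b. \<lbrakk>\<delta> \<in> \<Gamma>; a \<in> carrier (A \<delta>); b \<in> carrier (A \<delta>)\<rbrakk> \<Longrightarrow> p \<delta> a b \<in> carrier (A \<delta>)"
    and hom_p: "\<And>\<delta> \<epsilon> a b. \<lbrakk>(\<delta>, \<epsilon>) \<in> r; a \<in> carrier (A \<delta>); b \<in> carrier (A \<delta>)\<rbrakk>
      \<Longrightarrow> f \<delta> \<epsilon> (p \<delta> a b) = p \<epsilon> (f \<delta> \<epsilon> a) (f \<delta> \<epsilon> b)"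
  shows "{w. \<exists>\<gamma>' x' \<delta>' y' \<epsilon>. (\<gamma>', x') \<in> inject \<gamma> x \<and> (\<delta>', y') \<in> inject \<gamma> y \<and> (\<gamma>', \<epsilon>) \<in> r \<and> (\<delta>', \<epsilon>) \<in> r \<and>
      ((\<epsilon>, p \<epsilon> (f \<gamma>' \<epsilon> x') (f \<delta>' \<epsilon> y')), w) \<in> limit_rel \<Gamma> r A f} = inject \<gamma> (p \<gamma> x y)" (is "?U = _")
proof
  show "inject \<gamma> (p \<gamma> x y) \<subseteq> ?U"
  proof
    fix w assume "w \<in> inject \<gamma> (p \<gamma> x y)"
    then have "((\<gamma>, p \<gamma> (f \<gamma> \<gamma> x) (f \<gamma> \<gamma> y)), w) \<in> limit_rel \<Gamma> r A f"
      using hom_id[OF g x] hom_id[OF g y] by (simp add: inject_def)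
    then show "w \<in> ?U" using inject_self[OF g x] inject_self[OF g y] r_refl[OF g] by blast
  qed
  show "?U \<subseteq> inject \<gamma> (p \<gamma> x y)"
  proof
    fix w assume "w \<in> ?U"
    then obtain \<gamma>' x' \<delta>' y' \<epsilon> where 1: "((\<gamma>, x), (\<gamma>', x')) \<in> limit_rel \<Gamma> r A f"
      "((\<gamma>, y), (\<delta>', y')) \<in> limit_rel \<Gamma> r A f" and e: "(\<gamma>', \<epsilon>) \<in> r" "(\<delta>', \<epsilon>) \<in> r"
      and w: "((\<epsilon>, p \<epsilon> (f \<gamma>' \<epsilon> x') (f \<delta>' \<epsilon> y')), w) \<in> limit_rel \<Gamma> r A f"
      unfolding inject_def by blast
    obtain \<alpha> where a: "(\<gamma>, \<alpha>) \<in> r" "(\<gamma>', \<alpha>) \<in> r" "f \<gamma> \<alpha> x = f \<gamma>' \<alpha> x'"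
      using 1(1) unfolding limit_rel_iff by blast
    obtain \<beta> where b: "(\<gamma>, \<beta>) \<in> r" "(\<delta>', \<beta>) \<in> r" "f \<gamma> \<beta> y = f \<delta>' \<beta> y'"
      using 1(2) unfolding limit_rel_iff by blast
    have x': "x' \<in> carrier (A \<gamma>')" and y': "y' \<in> carrier (A \<delta>')" using 1 by (auto simp: limit_rel_iff)
    have "{\<alpha>, \<beta>, \<epsilon>} \<subseteq> \<Gamma>" using r_index(2) a b e by blast
    then obtain \<eta> where h: "\<eta> \<in> \<Gamma>" "(\<alpha>, \<eta>) \<in> r" "(\<beta>, \<eta>) \<in> r" "(\<epsilon>, \<eta>) \<in> r"
      using upper_bound[of "{\<alpha>, \<beta>, \<epsilon>}"] by auto
    have gh: "(\<gamma>, \<eta>) \<in> r" using r_trans a(1) h(2) by blast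
    have eG: "\<epsilon> \<in> \<Gamma>" using r_index(2)[OF e(1)] .
    have fx: "f \<gamma>' \<epsilon> x' \<in> carrier (A \<epsilon>)" "f \<delta>' \<epsilon> y' \<in> carrier (A \<epsilon>)" using f_closed e x' y' by auto
    have "f \<gamma> \<eta> (p \<gamma> x y) = p \<eta> (f \<gamma>' \<eta> x') (f \<delta>' \<eta> y')"
      using hom_p[OF gh x y] agree_later[OF a(1,2) h(2) x x' a(3)] agree_later[OF b(1,2) h(3) y y' b(3)] by simp
    also have "\<dots> = f \<epsilon> \<eta> (p \<epsilon> (f \<gamma>' \<epsilon> x') (f \<delta>' \<epsilon> y'))"
      using hom_p[OF h(4) fx] hom_comp[OF e(1) h(4) x'] hom_comp[OF e(2) h(4) y'] by simp
    finally have "((\<gamma>, p \<gamma> x y), (\<epsilon>, p \<epsilon> (f \<gamma>' \<epsilon> x') (f \<delta>' \<epsilon> y'))) \<in> limit_rel \<Gamma> r A f"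
      unfolding limit_rel_iff using g closed[OF g x y] eG closed[OF eG fx] h(1,4) gh by blast
    then show "w \<in> inject \<gamma> (p \<gamma> x y)" unfolding inject_def using limit_rel_trans w by blast
  qed
qed

lemma inject_mult:
  assumes "\<gamma> \<in> \<Gamma>" "x \<in> carrier (A \<gamma>)" "y \<in> carrier (A \<gamma>)"
  shows "inject \<gamma> x \<otimes>\<^bsub>L\<^esub> inject \<gamma> y = inject \<gamma> (x \<otimes>\<^bsub>A \<gamma>\<^esub> y)"
proof -
  have "a \<otimes>\<^bsub>A \<delta>\<^esub> b \<in> carrier (A \<delta>)" if "\<delta> \<in> \<Gamma>" "a \<in> carrier (A \<delta>)" "b \<in> carrier (A \<delta>)" for \<delta> a b
    using monoid.m_closed[OF ring.is_monoid[OF A_ring[OF that(1)]] that(2,3)] .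
  from inject_binop[where p = "\<lambda>\<delta> a b. a \<otimes>\<^bsub>A \<delta>\<^esub> b", OF assms this ring_hom_mult[OF hom]] show ?thesis
    by (simp add: direct_limit_def)
qed

lemma inject_add:
  assumes "\<gamma> \<in> \<Gamma>" "x \<in> carrier (A \<gamma>)" "y \<in> carrier (A \<gamma>)"
  shows "inject \<gamma> x \<oplus>\<^bsub>L\<^esub> inject \<gamma> y = inject \<gamma> (x \<oplus>\<^bsub>A \<gamma>\<^esub> y)"
proof -
  have "a \<oplus>\<^bsub>A \<delta>\<^esub> b \<in> carrier (A \<delta>)" if "\<delta> \<in> \<Gamma>" "a \<in> carrier (A \<delta>)" "b \<in> carrier (A \<delta>)" for \<delta> a b
    using ring.ring_simprules(1)[OF A_ring[OF that(1)] that(2,3)] .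
  from inject_binop[where p = "\<lambda>\<delta> a b. a \<oplus>\<^bsub>A \<delta>\<^esub> b", OF assms this ring_hom_add[OF hom]] show ?thesis
    by (simp add: direct_limit_def)
qed

lemma inject_const:
  assumes g: "\<gamma> \<in> \<Gamma>" and c: "\<And>\<delta>. \<delta> \<in> \<Gamma> \<Longrightarrow> c \<delta> \<in> carrier (A \<delta>)"
    and hom_c: "\<And>\<delta> \<epsilon>. (\<delta>, \<epsilon>) \<in> r \<Longrightarrow> f \<delta> \<epsilon> (c \<delta>) = c \<epsilon>"
  shows "{w. \<exists>\<delta>\<in>\<Gamma>. ((\<delta>, c \<delta>), w) \<in> limit_rel \<Gamma> r A f} = inject \<gamma> (c \<gamma>)"
proof -
  have "inject \<delta> (c \<delta>) = inject \<gamma> (c \<gamma>)" if d: "\<delta> \<in> \<Gamma>" for \<delta>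
  proof -
    obtain \<epsilon> where e: "(\<gamma>, \<epsilon>) \<in> r" "(\<delta>, \<epsilon>) \<in> r" using directed[OF g d] by blast
    show ?thesis using inject_push[OF e(1) c[OF g]] inject_push[OF e(2) c[OF d]] hom_c e by simp
  qed
  then have "w \<in> inject \<gamma> (c \<gamma>)" if "\<delta> \<in> \<Gamma>" "((\<delta>, c \<delta>), w) \<in> limit_rel \<Gamma> r A f" for \<delta> w
    using that by (auto simp: inject_def)
  then show ?thesis using g by (auto simp: inject_def)
qed

lemma inject_one: "\<gamma> \<in> \<Gamma> \<Longrightarrow> inject \<gamma> \<one>\<^bsub>A \<gamma>\<^esub> = \<one>\<^bsub>L\<^esub>"
  using inject_const[of \<gamma> "\<lambda>\<delta>. \<one>\<^bsub>A \<delta>\<^esub>"] ring_hom_one[OF hom] monoid.one_closed[OF ring.is_monoid[OF A_ring]]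
  by (simp add: direct_limit_def)

lemma inject_zero: "\<gamma> \<in> \<Gamma> \<Longrightarrow> inject \<gamma> \<zero>\<^bsub>A \<gamma>\<^esub> = \<zero>\<^bsub>L\<^esub>"
  using inject_const[of \<gamma> "\<lambda>\<delta>. \<zero>\<^bsub>A \<delta>\<^esub>"] ring_hom_zero[OF hom A_ring A_ring] r_index
    ring.ring_simprules(2)[OF A_ring]
  by (simp add: direct_limit_def)

lemma common_index:
  assumes "U \<in> carrier L" "V \<in> carrier L" "W \<in> carrier L"
  obtains \<epsilon> x y z where "\<epsilon> \<in> \<Gamma>" "x \<in> carrier (A \<epsilon>)" "y \<in> carrier (A \<epsilon>)" "z \<in> carrier (A \<epsilon>)"
    "U = inject \<epsilon> x" "V = inject \<epsilon> y" "W = inject \<epsilon> z"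
proof -
  obtain \<alpha> a \<beta> b \<gamma> c where 1: "\<alpha> \<in> \<Gamma>" "a \<in> carrier (A \<alpha>)" "U = inject \<alpha> a"
    and 2: "\<beta> \<in> \<Gamma>" "b \<in> carrier (A \<beta>)" "V = inject \<beta> b"
    and 3: "\<gamma> \<in> \<Gamma>" "c \<in> carrier (A \<gamma>)" "W = inject \<gamma> c"
    using assms unfolding carrier_L by blast
  obtain \<epsilon> where e: "\<epsilon> \<in> \<Gamma>" "(\<alpha>, \<epsilon>) \<in> r" "(\<beta>, \<epsilon>) \<in> r" "(\<gamma>, \<epsilon>) \<in> r"
    using upper_bound[of "{\<alpha>, \<beta>, \<gamma>}"] 1(1) 2(1) 3(1) by auto
  show ?thesis
    by (rule that[OF e(1) f_closed[OF e(2) 1(2)] f_closed[OF e(3) 2(2)] f_closed[OF e(4) 3(2)]])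
      (simp_all add: inject_push e 1 2 3)
qed

lemma cring_L: "cring L"
proof -
  obtain \<gamma> where g: "\<gamma> \<in> \<Gamma>" using nonempty by blast
  have one_in: "\<one>\<^bsub>L\<^esub> \<in> carrier L"
    using inject_closed[OF g monoid.one_closed[OF ring.is_monoid[OF A_ring[OF g]]]] inject_one[OF g] by simp
  have zero_in: "\<zero>\<^bsub>L\<^esub> \<in> carrier L"
    using inject_closed[OF g ring.ring_simprules(2)[OF A_ring[OF g]]] inject_zero[OF g] by simp
  have closed: "U \<oplus>\<^bsub>L\<^esub> V \<in> carrier L" "U \<otimes>\<^bsub>L\<^esub> V \<in> carrier L"
    and comm: "U \<oplus>\<^bsub>L\<^esub> V = V \<oplus>\<^bsub>L\<^esub> U" "U \<otimes>\<^bsub>L\<^esub> V = V \<otimes>\<^bsub>L\<^esub> U"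
    and unit: "\<zero>\<^bsub>L\<^esub> \<oplus>\<^bsub>L\<^esub> U = U" "\<one>\<^bsub>L\<^esub> \<otimes>\<^bsub>L\<^esub> U = U"
    and neg: "\<exists>U'\<in>carrier L. U' \<oplus>\<^bsub>L\<^esub> U = \<zero>\<^bsub>L\<^esub>"
    and assoc: "(U \<oplus>\<^bsub>L\<^esub> V) \<oplus>\<^bsub>L\<^esub> W = U \<oplus>\<^bsub>L\<^esub> (V \<oplus>\<^bsub>L\<^esub> W)" "(U \<otimes>\<^bsub>L\<^esub> V) \<otimes>\<^bsub>L\<^esub> W = U \<otimes>\<^bsub>L\<^esub> (V \<otimes>\<^bsub>L\<^esub> W)"
    and distr: "(U \<oplus>\<^bsub>L\<^esub> V) \<otimes>\<^bsub>L\<^esub> W = U \<otimes>\<^bsub>L\<^esub> W \<oplus>\<^bsub>L\<^esub> V \<otimes>\<^bsub>L\<^esub> W"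
    if UVW: "U \<in> carrier L" "V \<in> carrier L" "W \<in> carrier L" for U V W
  proof -
    obtain \<epsilon> x y z where e: "\<epsilon> \<in> \<Gamma>" and xyz: "x \<in> carrier (A \<epsilon>)" "y \<in> carrier (A \<epsilon>)" "z \<in> carrier (A \<epsilon>)"
      and eq: "U = inject \<epsilon> x" "V = inject \<epsilon> y" "W = inject \<epsilon> z"
      using common_index[OF UVW] by blast
    interpret E: cring "A \<epsilon>" by (rule is_cring[OF e])
    note ops = e xyz inject_add inject_mult inject_closed E.a_ac E.m_ac E.l_distr E.r_distr
    show "U \<oplus>\<^bsub>L\<^esub> V \<in> carrier L" "U \<otimes>\<^bsub>L\<^esub> V \<in> carrier L"
      "U \<oplus>\<^bsub>L\<^esub> V = V \<oplus>\<^bsub>L\<^esub> U" "U \<otimes>\<^bsub>L\<^esub> V = V \<otimes>\<^bsub>L\<^esub> U"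
      "\<zero>\<^bsub>L\<^esub> \<oplus>\<^bsub>L\<^esub> U = U" "\<one>\<^bsub>L\<^esub> \<otimes>\<^bsub>L\<^esub> U = U"
      "(U \<oplus>\<^bsub>L\<^esub> V) \<oplus>\<^bsub>L\<^esub> W = U \<oplus>\<^bsub>L\<^esub> (V \<oplus>\<^bsub>L\<^esub> W)" "(U \<otimes>\<^bsub>L\<^esub> V) \<otimes>\<^bsub>L\<^esub> W = U \<otimes>\<^bsub>L\<^esub> (V \<otimes>\<^bsub>L\<^esub> W)"
      "(U \<oplus>\<^bsub>L\<^esub> V) \<otimes>\<^bsub>L\<^esub> W = U \<otimes>\<^bsub>L\<^esub> W \<oplus>\<^bsub>L\<^esub> V \<otimes>\<^bsub>L\<^esub> W"
      unfolding eq inject_zero[OF e, symmetric] inject_one[OF e, symmetric] by (simp_all add: ops)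
    have "inject \<epsilon> (\<ominus>\<^bsub>A \<epsilon>\<^esub> x) \<oplus>\<^bsub>L\<^esub> U = \<zero>\<^bsub>L\<^esub>"
      using xyz by (simp add: eq e inject_add E.l_neg inject_zero)
    then show "\<exists>U'\<in>carrier L. U' \<oplus>\<^bsub>L\<^esub> U = \<zero>\<^bsub>L\<^esub>" using inject_closed[OF e E.a_inv_closed[OF xyz(1)]] by blast
  qed
  show ?thesis
  proof (intro cringI abelian_groupI comm_monoidI)
    fix U V W assume U: "U \<in> carrier L" and V: "V \<in> carrier L" and W: "W \<in> carrier L"
    show "U \<oplus>\<^bsub>L\<^esub> V \<oplus>\<^bsub>L\<^esub> W = U \<oplus>\<^bsub>L\<^esub> (V \<oplus>\<^bsub>L\<^esub> W)" "U \<otimes>\<^bsub>L\<^esub> V \<otimes>\<^bsub>L\<^esub> W = U \<otimes>\<^bsub>L\<^esub> (V \<otimes>\<^bsub>L\<^esub> W)"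
      "(U \<oplus>\<^bsub>L\<^esub> V) \<otimes>\<^bsub>L\<^esub> W = U \<otimes>\<^bsub>L\<^esub> W \<oplus>\<^bsub>L\<^esub> V \<otimes>\<^bsub>L\<^esub> W"
      by (rule assoc[OF U V W] distr[OF U V W])+
  next
    fix U V assume U: "U \<in> carrier L" and V: "V \<in> carrier L"
    show "U \<oplus>\<^bsub>L\<^esub> V \<in> carrier L" "U \<otimes>\<^bsub>L\<^esub> V \<in> carrier L"
      "U \<oplus>\<^bsub>L\<^esub> V = V \<oplus>\<^bsub>L\<^esub> U" "U \<otimes>\<^bsub>L\<^esub> V = V \<otimes>\<^bsub>L\<^esub> U"
      by (rule closed[OF U V U] comm[OF U V U])+
  next
    fix U assume U: "U \<in> carrier L"
    show "\<zero>\<^bsub>L\<^esub> \<oplus>\<^bsub>L\<^esub> U = U" "\<one>\<^bsub>L\<^esub> \<otimes>\<^bsub>L\<^esub> U = U" "\<exists>U'\<in>carrier L. U' \<oplus>\<^bsub>L\<^esub> U = \<zero>\<^bsub>L\<^esub>"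
      by (rule unit[OF U U U] neg[OF U U U])+
  qed (fact zero_in, fact one_in)
qed

lemma limit_cocone_L: "limit_cocone \<Gamma> r A f L inject"
proof (intro limit_cocone.intro limit_cocone_axioms.intro direct_system_axioms cring_L)
  show "inject \<gamma> \<in> ring_hom (A \<gamma>) L" if "\<gamma> \<in> \<Gamma>" for \<gamma>
    by (rule ring_hom_memI) (simp_all add: that inject_closed inject_mult inject_add inject_one)
  show "inject \<delta> (f \<gamma> \<delta> x) = inject \<gamma> x" if "(\<gamma>, \<delta>) \<in> r" "x \<in> carrier (A \<gamma>)" for \<gamma> \<delta> x
    by (rule inject_push[OF that])
  show "\<exists>\<gamma>\<in>\<Gamma>. \<exists>x\<in>carrier (A \<gamma>). s = inject \<gamma> x" if "s \<in> carrier L" for s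
    using that unfolding carrier_L by blast
  show "\<exists>\<delta>. (\<gamma>, \<delta>) \<in> r \<and> f \<gamma> \<delta> x = f \<gamma> \<delta> y"
    if "\<gamma> \<in> \<Gamma>" "x \<in> carrier (A \<gamma>)" "y \<in> carrier (A \<gamma>)" "inject \<gamma> x = inject \<gamma> y" for \<gamma> x y
    using inject_eqD[OF that(4,1,3)] unfolding limit_rel_iff by blast
qed

end

lemma (in limit_cocone) limit_cocone_iso:
  assumes T: "cring T" and h: "h \<in> ring_iso S T"
  shows "limit_cocone \<Gamma> r A f T (\<lambda>\<gamma>. h \<circ> \<phi> \<gamma>)"
proof (intro limit_cocone.intro limit_cocone_axioms.intro direct_system_axioms T)
  have hh: "h \<in> ring_hom S T" and bij: "bij_betw h (carrier S) (carrier T)"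
    using h by (auto simp: ring_iso_def)
  show "h \<circ> \<phi> \<gamma> \<in> ring_hom (A \<gamma>) T" if "\<gamma> \<in> \<Gamma>" for \<gamma>
    by (rule ring_hom_trans[OF cocone_hom[OF that] hh])
  show "(h \<circ> \<phi> \<delta>) (f \<gamma> \<delta> x) = (h \<circ> \<phi> \<gamma>) x" if "(\<gamma>, \<delta>) \<in> r" "x \<in> carrier (A \<gamma>)" for \<gamma> \<delta> x
    using cocone_comp[OF that] by simp
  show "\<exists>\<gamma>\<in>\<Gamma>. \<exists>x\<in>carrier (A \<gamma>). t = (h \<circ> \<phi> \<gamma>) x" if t: "t \<in> carrier T" for t
  proof -
    obtain s where s: "s \<in> carrier S" "t = h s" using bij t by (metis bij_betw_imp_surj_on imageE)
    then show ?thesis using cocone_surj[OF s(1)] by auto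
  qed
  show "\<exists>\<delta>. (\<gamma>, \<delta>) \<in> r \<and> f \<gamma> \<delta> x = f \<gamma> \<delta> y"
    if g: "\<gamma> \<in> \<Gamma>" "x \<in> carrier (A \<gamma>)" "y \<in> carrier (A \<gamma>)" and eq: "(h \<circ> \<phi> \<gamma>) x = (h \<circ> \<phi> \<gamma>) y" for \<gamma> x y
  proof -
    have "\<phi> \<gamma> x = \<phi> \<gamma> y"
      using eq cocone_closed[OF g(1)] g(2,3) bij by (simp add: bij_betw_def inj_on_def)
    then show ?thesis by (rule cocone_eq[OF g])
  qed
qed

lemma (in limit_cocone) cohen_macaulay_limit:
  assumes "\<And>\<gamma>. \<gamma> \<in> \<Gamma> \<Longrightarrow> cohen_macaulay_local_ring (A \<gamma>)"
    and "\<And>\<gamma>. \<gamma> \<in> \<Gamma> \<Longrightarrow> maximalideal (\<mm> \<gamma>) (A \<gamma>)"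
    and "\<And>\<gamma> \<delta>. (\<gamma>, \<delta>) \<in> r \<Longrightarrow> (\<delta>, \<gamma>) \<notin> r \<Longrightarrow> Idl\<^bsub>A \<delta>\<^esub> (f \<gamma> \<delta> ` \<mm> \<gamma>) = \<mm> \<delta>"
  shows "cohen_macaulay_local_ring S"
proof (rule local_limit_cocone.limit_cohen_macaulay)
  show "local_limit_cocone \<Gamma> r A f S \<phi> \<mm>"
    by (intro local_limit_cocone.intro local_limit_cocone_axioms.intro limit_cocone_axioms assms(2,3)
        cohen_macaulay_local_ring.axioms(1,2)[OF assms(1)])
  show "depth (A \<gamma>) = krull_dim (A \<gamma>)" if "\<gamma> \<in> \<Gamma>" for \<gamma>
    by (rule cohen_macaulay_local_ring.depth_eq_dim[OF assms(1)[OF that]])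
qed

section \<open>Localization at the units\<close>

context cring
begin

lemma frac_rel_Units_iff:
  "((a, s), (b, t)) \<in> frac_rel R (Units R) \<longleftrightarrow>
    a \<in> carrier R \<and> s \<in> Units R \<and> b \<in> carrier R \<and> t \<in> Units R \<and> t \<otimes> a = s \<otimes> b"
proof -
  have "(\<exists>u\<in>Units R. u \<otimes> (t \<otimes> a) = u \<otimes> (s \<otimes> b)) \<longleftrightarrow> t \<otimes> a = s \<otimes> b"
    if "a \<in> carrier R" "s \<in> Units R" "b \<in> carrier R" "t \<in> Units R"
    using that by (auto simp: Units_closed intro: Units_one_closed)
  then show ?thesis unfolding frac_rel_def by auto
qed

text \<open>When only units are inverted, the fraction \<open>a/s\<close> is the fraction of \<open>s\<inverse> a\<close> by \<open>\<one>\<close>. The class of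
\<open>a\<close> consists of the pairs \<open>(t a, t)\<close>, which makes the operations on classes explicit.\<close>

lemma localization_Units_iso:
  defines "h \<equiv> \<lambda>a. {w. ((a, \<one>), w) \<in> frac_rel R (Units R)}"
  shows "h \<in> ring_iso R (localization R (Units R))" (is "h \<in> ring_iso R ?T")
    and "cring (localization R (Units R))"
proof -
  have h_iff: "(b, t) \<in> h a \<longleftrightarrow> t \<in> Units R \<and> b = t \<otimes> a" if "a \<in> carrier R" for a b t
    using that by (auto simp: h_def frac_rel_Units_iff)
  have cls: "{w. ((s \<otimes> a, s), w) \<in> frac_rel R (Units R)} = h a" if a: "a \<in> carrier R" and s: "s \<in> Units R" for a s
  proof -
    have "((s \<otimes> a, s), (b, t)) \<in> frac_rel R (Units R) \<longleftrightarrow> (b, t) \<in> h a" for b t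
    proof -
      have "t \<otimes> (s \<otimes> a) = s \<otimes> (t \<otimes> a)" if "t \<in> Units R"
        using a s that by (simp add: Units_closed m_lcomm)
      then show ?thesis
        using a s by (auto simp: h_iff[OF a] frac_rel_Units_iff Units_closed)
    qed
    then show ?thesis by auto
  qed
  have op: "{w. \<exists>a' s b' t. (a', s) \<in> h a \<and> (b', t) \<in> h b \<and> ((p a' s b' t, s \<otimes> t), w) \<in> frac_rel R (Units R)} = h c"
    if a: "a \<in> carrier R" and b: "b \<in> carrier R" and c: "c \<in> carrier R"
      and p: "\<And>s t. \<lbrakk>s \<in> Units R; t \<in> Units R\<rbrakk> \<Longrightarrow> p (s \<otimes> a) s (t \<otimes> b) t = (s \<otimes> t) \<otimes> c" for a b c p
  proof -
    have "{w. \<exists>a' s b' t. (a', s) \<in> h a \<and> (b', t) \<in> h b \<and> ((p a' s b' t, s \<otimes> t), w) \<in> frac_rel R (Units R)}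
      = {w. \<exists>s\<in>Units R. \<exists>t\<in>Units R. ((p (s \<otimes> a) s (t \<otimes> b) t, s \<otimes> t), w) \<in> frac_rel R (Units R)}"
      by (auto simp: h_iff[OF a] h_iff[OF b])
    also have "\<dots> = {w. \<exists>s\<in>Units R. \<exists>t\<in>Units R. w \<in> h c}"
      using p cls[OF c] by (metis (mono_tags, lifting) Units_m_closed mem_Collect_eq)
    also have "\<dots> = h c" using Units_one_closed by blast
    finally show ?thesis .
  qed
  have carr: "carrier ?T = h ` carrier R"
  proof -
    have "carrier ?T = {{w. ((a, s), w) \<in> frac_rel R (Units R)} | a s. a \<in> carrier R \<and> s \<in> Units R}"
      by (auto simp: localization_def quotient_def Image_def)
    also have "\<dots> = h ` carrier R"
    proof (intro equalityI subsetI)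
      fix w assume "w \<in> {{w. ((a, s), w) \<in> frac_rel R (Units R)} | a s. a \<in> carrier R \<and> s \<in> Units R}"
      then obtain a s where as: "a \<in> carrier R" "s \<in> Units R" "w = {w. ((a, s), w) \<in> frac_rel R (Units R)}" by blast
      have "s \<otimes> (inv s \<otimes> a) = a" using as by (simp add: m_assoc[symmetric] Units_closed)
      then have "w = h (inv s \<otimes> a)" using cls[of "inv s \<otimes> a" s] as by simp
      then show "w \<in> h ` carrier R" using as by simp
    qed (auto simp: h_def)
    finally show ?thesis .
  qed
  have "inj_on h (carrier R)"
  proof (rule inj_onI)
    fix a b assume ab: "a \<in> carrier R" "b \<in> carrier R" "h a = h b"
    then have "(a, \<one>) \<in> h b" using h_iff[OF ab(1), of a \<one>] by simp
    then show "a = b" using h_iff[OF ab(2)] ab(2) by simp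
  qed
  then have bij: "bij_betw h (carrier R) (carrier ?T)" by (simp add: bij_betw_def carr)
  have hom: "h \<in> ring_hom R ?T"
  proof (rule ring_hom_memI)
    fix a b assume ab: "a \<in> carrier R" "b \<in> carrier R"
    show "h a \<in> carrier ?T" using ab carr by blast
    have "(s \<otimes> a) \<otimes> (t \<otimes> b) = (s \<otimes> t) \<otimes> (a \<otimes> b)" if "s \<in> Units R" "t \<in> Units R" for s t
      using ab that[THEN Units_closed] by algebra
    then show "h (a \<otimes> b) = h a \<otimes>\<^bsub>?T\<^esub> h b"
      using op[of a b "a \<otimes> b" "\<lambda>a' s b' t. a' \<otimes> b'"] ab by (simp add: localization_def)
    have "t \<otimes> (s \<otimes> a) \<oplus> s \<otimes> (t \<otimes> b) = (s \<otimes> t) \<otimes> (a \<oplus> b)" if "s \<in> Units R" "t \<in> Units R" for s t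
      using ab that[THEN Units_closed] by algebra
    then show "h (a \<oplus> b) = h a \<oplus>\<^bsub>?T\<^esub> h b"
      using op[of a b "a \<oplus> b" "\<lambda>a' s b' t. (t \<otimes> a') \<oplus> (s \<otimes> b')"] ab by (simp add: localization_def)
  next
    show "h \<one> = \<one>\<^bsub>?T\<^esub>" by (simp add: localization_def h_def)
  qed
  show iso: "h \<in> ring_iso R ?T" using hom bij by (simp add: ring_iso_def)
  have "h \<zero> = \<zero>\<^bsub>?T\<^esub>" by (simp add: localization_def h_def)
  then show "cring ?T" using ring_iso_imp_img_cring[OF iso] by simp
qed

end

section \<open>Direct limits of Cohen--Macaulay local rings\<close>

theorem corollary3p7:
  fixes \<Gamma> :: "'i set" and r :: "('i \<times> 'i) set"
    and A :: "'i \<Rightarrow> ('a, 'b) ring_scheme" and f :: "'i \<Rightarrow> 'i \<Rightarrow> 'a \<Rightarrow> 'a"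
    and \<mm> :: "'i \<Rightarrow> 'a set"
  assumes "direct_system \<Gamma> r A f"
    and "\<And>\<gamma>. \<gamma> \<in> \<Gamma> \<Longrightarrow> cohen_macaulay_local_ring (A \<gamma>)"
    and "\<And>\<gamma>. \<gamma> \<in> \<Gamma> \<Longrightarrow> maximalideal (\<mm> \<gamma>) (A \<gamma>)"
    and "\<And>\<gamma> \<delta>. (\<gamma>, \<delta>) \<in> r \<Longrightarrow> (\<delta>, \<gamma>) \<notin> r \<Longrightarrow> Idl\<^bsub>A \<delta>\<^esub> (f \<gamma> \<delta> ` \<mm> \<gamma>) = \<mm> \<delta>"
  shows "noetherian_ring (direct_limit \<Gamma> r A f) \<and> cohen_macaulay_ring (direct_limit \<Gamma> r A f)"
proof -
  interpret direct_system \<Gamma> r A f by (rule assms(1))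
  note limit = limit_cocone.cohen_macaulay_limit[OF _ assms(2-4)]
  have L: "cohen_macaulay_local_ring L" by (rule limit[OF limit_cocone_L])
  interpret L: cohen_macaulay_local_ring L by (rule L)
  have "cohen_macaulay_local_ring (localization L (carrier L - M))" if M: "maximalideal M L" for M
  proof -
    have "c \<notin> M" if "c \<in> Units L" for c
    proof
      assume c: "c \<in> M"
      have MI: "ideal M L" by (rule maximalideal.axioms(1)[OF M])
      have "inv\<^bsub>L\<^esub> c \<otimes>\<^bsub>L\<^esub> c \<in> M" by (rule ideal.I_l_closed[OF MI c L.Units_inv_closed[OF that]])
      then show False
        using that ideal.one_imp_carrier[OF MI] maximalideal.I_notcarr[OF M] by (simp add: L.Units_l_inv)
    qed
    then have "carrier L - M = Units L"
      using local_ring_Units[OF L.local_ring_axioms M] L.Units_closed by blast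
    then show ?thesis
      using limit[OF limit_cocone.limit_cocone_iso[OF limit_cocone_L L.localization_Units_iso(2,1)]] by simp
  qed
  then have "cohen_macaulay_ring L"
    by (intro cohen_macaulay_ring.intro cohen_macaulay_ring_axioms.intro L.is_cring L.noetherian_ring_axioms)
  then show ?thesis using L.noetherian_ring_axioms by blast
qed

end
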